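(* Let $\Omega\subset\mathbb{C}^2$ be a smoothly bounded domain of finite type, with defining function $\rho$, such that $|z|\le 1$ for all $z\in\Omega$, $(1,0)\in\partial\Omega$, $\frac{\partial\rho}{\partial z_1}$ and $\frac{\partial\rho}{\partial\overline z_1}$ do not vanish at $(1,0)$, and the vector $\langle 1,0\rangle$ is an outward normal vector to $\partial\Omega$ at $(1,0)$. Let $h_1,h_2:(0,1]\to[1,+\infty)$ be continuous decreasing functions with $\lim_{x\to0+}h_i(x)=+\infty$ for $i=1,2$, and let $\mathscr{A}_{h_1,h_2}(\zeta)$ be the approach region at $\zeta$ defined in the context. Then there exist a neighborhood $U$ of $(1,0)$ in $\partial\Omega$ and a bounded holomorphic function $f$ on $\Omega$ such that for every point $\zeta\in U$ the limit $$\lim_{\mathscr{A}_{h_1,h_2}(\zeta)\ni z\to\zeta}f(z)$$ does not exist.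
   Context: Vector fields and type. In a small neighborhood $V$ of $(1,0)$ in $\mathbb{C}^2$ on which $\frac{\partial\rho}{\partial z_1}\neq0$ and $\frac{\partial\rho}{\partial\overline z_1}\ne 0$, put $$L=-\frac{\partial \rho}{\partial z_2}\frac{\partial}{\partial z_1}+\frac{\partial \rho}{\partial z_1}\frac{\partial}{\partial z_2},\quad \overline{L}=-\frac{\partial \rho}{\partial \overline{z}_2}\frac{\partial}{\partial \overline{z}_1}+\frac{\partial \rho}{\partial \overline{z}_1}\frac{\partial}{\partial \overline{z}_2},\quad T=\frac{\partial \rho}{\partial \overline{z}_1}\frac{\partial}{\partial z_1}-\frac{\partial \rho}{\partial z_1}\frac{\partial}{\partial \overline{z}_1};$$ these span the (complexified) tangent space to $\partial\Omega$ at every boundary point in $V$. The fields $L,\overline L$ are iterated commutators of degree $1$; if $\mathscr{L}_{k-1}$ is an iterated commutator of degree $k-1$, then $[L,\mathscr{L}_{k-1}]$ and $[\overline L,\mathscr{L}_{k-1}]$ are iterated commutators of degree $k$. Each iterated commutator $\mathscr{L}$ satisfies $\mathscr{L}\equiv\lambda_{\mathscr{L}}T \bmod (L,\overline L)$ for a coefficient function $\lambda_{\mathscr{L}}$. Let $\mathscr{M}_k$ be the collection of all these linearly independent iterated commutators of degree less than or equal to $k$, and $$\Lambda_k(z)=\sqrt{\sum_{\mathscr{L}\in\mathscr{M}_k}|\lambda_{\mathscr{L}}(z)|^2}.$$ The type $\tau_z$ of a boundary point $z$ is the smallest $k$ with $\Lambda_k(z)\ne0$ (for boundary points outside $V$,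 defined in the same way after a choice of coordinates in which the $z_1$-derivatives of $\rho$ do not vanish). Finite type means that all boundary points have finite type, and $\tau=\max_{z\in\partial\Omega}\tau_z<\infty$. Distances. For $z\in\Omega$ near $\partial\Omega$, $\pi(z)$ is the Euclidean normal projection of $z$ on $\partial\Omega$, $\delta(z)=|z-\pi(z)|$ is the Euclidean distance from $z$ to $\partial\Omega$, and $\delta_n(z)$ is the distance from $z$ to $\pi(z)$ in the complex normal direction (the modulus of the component of $z-\pi(z)$ along the complex normal direction to $\partial\Omega$ at $\pi(z)$). Set $$D(z)=\inf_{2\le k\le\tau}\Big(\frac{\delta(z)}{\Lambda_k(\pi(z))}\Big)^{1/k},\qquad \Lambda^{\theta}(\zeta)=\sum_{k=2}^{\tau}\theta^k\Lambda_k(\zeta),$$ where terms with $\Lambda_k(\pi(z))=0$ in the infimum are read as $+\infty$. Polarization. $R(z,w)$ is a fixed polarization of $\rho$: a $C^\infty$ complex-valued function with $R(z,z)=\rho(z)$, with $\overline\partial_zR(z,w)$ vanishing to infinite order on $z=w$, and with $R(z,w)-\overline{R(w,z)}$ vanishing to infinite order on $z=w$. Approach region. For $w\in\partial\Omega$ near $(1,0)$, $\mathscr{A}_{h_1,h_2}(w)$ is the set of $z\in\Omega\cap V$ (with $V$ small enough that the quantities above are defined) such that $$|z-w|<h_1(\delta_n(z))\,D(z)\quad\text{and}\quad |R(\pi(z),w)|<h_2(\delta_n(z))\,\Lambda^{D(z)}(w).$$ *)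

theory Defs
  imports "HOL-Analysis.Analysis"
begin

type_synonym c2 = "complex \<times> complex"

subsection \<open>Smooth and holomorphic functions\<close>

text \<open>Only meant for open \<open>S\<close>: the derivatives are taken in the full space.\<close>

fun k_smooth_on :: "nat \<Rightarrow> 'a::real_normed_vector set \<Rightarrow> ('a \<Rightarrow> 'b::real_normed_vector) \<Rightarrow> bool" where
  "k_smooth_on 0 S f \<longleftrightarrow> continuous_on S f"
| "k_smooth_on (Suc n) S f \<longleftrightarrow>
     (\<forall>x\<in>S. f differentiable (at x)) \<and>
     (\<forall>v. k_smooth_on n S (\<lambda>x. frechet_derivative f (at x) v))"

definition smooth_on :: "'a::real_normed_vector set \<Rightarrow> ('a \<Rightarrow> 'b::real_normed_vector) \<Rightarrow> bool" where
  "smooth_on S f \<longleftrightarrow> (\<forall>n. k_smooth_on n S f)"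

definition holomorphic2_on :: "(c2 \<Rightarrow> complex) \<Rightarrow> c2 set \<Rightarrow> bool" where
  "holomorphic2_on f S \<longleftrightarrow>
     (\<forall>z\<in>S. \<exists>a b. (f has_derivative (\<lambda>v. a * fst v + b * snd v)) (at z))"

text \<open>Wirtinger derivatives \<open>\<partial>/\<partial>z\<^sub>1\<close>, \<open>\<partial>/\<partial>z\<^sub>2\<close> and their conjugates.\<close>

definition dz1 :: "(c2 \<Rightarrow> complex) \<Rightarrow> c2 \<Rightarrow> complex" where
  "dz1 f z = (frechet_derivative f (at z) (1, 0) - \<i> * frechet_derivative f (at z) (\<i>, 0)) / 2"

definition dz2 :: "(c2 \<Rightarrow> complex) \<Rightarrow> c2 \<Rightarrow> complex" where
  "dz2 f z = (frechet_derivative f (at z) (0, 1) - \<i> * frechet_derivative f (at z) (0, \<i>)) / 2"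

definition dzbar1 :: "(c2 \<Rightarrow> complex) \<Rightarrow> c2 \<Rightarrow> complex" where
  "dzbar1 f z = (frechet_derivative f (at z) (1, 0) + \<i> * frechet_derivative f (at z) (\<i>, 0)) / 2"

definition dzbar2 :: "(c2 \<Rightarrow> complex) \<Rightarrow> c2 \<Rightarrow> complex" where
  "dzbar2 f z = (frechet_derivative f (at z) (0, 1) + \<i> * frechet_derivative f (at z) (0, \<i>)) / 2"

abbreviation cplx :: "(c2 \<Rightarrow> real) \<Rightarrow> c2 \<Rightarrow> complex" where
  "cplx \<rho> \<equiv> (\<lambda>z. complex_of_real (\<rho> z))"

subsection \<open>Domains and defining functions\<close>

text \<open>A defining function need only be given on a neighbourhood \<open>W\<close> of the boundary.\<close>

definition defining_function :: "c2 set \<Rightarrow> c2 set \<Rightarrow> (c2 \<Rightarrow> real) \<Rightarrow> bool" where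
  "defining_function \<Omega> W \<rho> \<longleftrightarrow>
     open W \<and> frontier \<Omega> \<subseteq> W \<and> smooth_on W \<rho> \<and>
     \<Omega> \<inter> W = {z \<in> W. \<rho> z < 0} \<and>
     (\<forall>z\<in>frontier \<Omega>. \<exists>v. frechet_derivative \<rho> (at z) v \<noteq> 0)"

definition smoothly_bounded_domain :: "c2 set \<Rightarrow> c2 set \<Rightarrow> (c2 \<Rightarrow> real) \<Rightarrow> bool" where
  "smoothly_bounded_domain \<Omega> W \<rho> \<longleftrightarrow>
     open \<Omega> \<and> connected \<Omega> \<and> \<Omega> \<noteq> {} \<and> bounded \<Omega> \<and> defining_function \<Omega> W \<rho>"

text \<open>The outward normal vectors at \<open>p\<close> are the positive multiples of the gradient of \<open>\<rho>\<close>
  for the real inner product of \<open>\<complex>\<^sup>2 = \<real>\<^sup>4\<close>.\<close>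

definition outward_normal :: "(c2 \<Rightarrow> real) \<Rightarrow> c2 \<Rightarrow> c2 \<Rightarrow> bool" where
  "outward_normal \<rho> p n \<longleftrightarrow>
     n \<noteq> 0 \<and> (\<exists>c>0. \<forall>v. frechet_derivative \<rho> (at p) v = c * (n \<bullet> v))"

subsection \<open>Complexified vector fields and iterated commutators\<close>

text \<open>A complexified vector field is given by its coefficients with respect to
  \<open>\<partial>/\<partial>z\<^sub>1, \<partial>/\<partial>z\<^sub>2\<close> (components 1 and 2) and their conjugates (components 3 and 4).\<close>

type_synonym vfield = "c2 \<Rightarrow> complex ^ 4"

definition field_apply :: "vfield \<Rightarrow> (c2 \<Rightarrow> complex) \<Rightarrow> c2 \<Rightarrow> complex" where
  "field_apply X f z =
     X z $ 1 * dz1 f z + X z $ 2 * dz2 f z + X z $ 3 * dzbar1 f z + X z $ 4 * dzbar2 f z"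

definition commutator :: "vfield \<Rightarrow> vfield \<Rightarrow> vfield" where
  "commutator X Y = (\<lambda>z. \<chi> i. field_apply X (\<lambda>w. Y w $ i) z - field_apply Y (\<lambda>w. X w $ i) z)"

definition field_L :: "(c2 \<Rightarrow> real) \<Rightarrow> vfield" where
  "field_L \<rho> = (\<lambda>z. vector [- dz2 (cplx \<rho>) z, dz1 (cplx \<rho>) z, 0, 0])"

definition field_Lbar :: "(c2 \<Rightarrow> real) \<Rightarrow> vfield" where
  "field_Lbar \<rho> = (\<lambda>z. vector [0, 0, - dzbar2 (cplx \<rho>) z, dzbar1 (cplx \<rho>) z])"

definition field_T :: "(c2 \<Rightarrow> real) \<Rightarrow> vfield" where
  "field_T \<rho> = (\<lambda>z. vector [dzbar1 (cplx \<rho>) z, 0, - dz1 (cplx \<rho>) z, 0])"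

inductive iterated_commutator :: "(c2 \<Rightarrow> real) \<Rightarrow> nat \<Rightarrow> vfield \<Rightarrow> bool" for \<rho> where
  L: "iterated_commutator \<rho> 1 (field_L \<rho>)"
| Lbar: "iterated_commutator \<rho> 1 (field_Lbar \<rho>)"
| comm_L: "iterated_commutator \<rho> k X \<Longrightarrow>
     iterated_commutator \<rho> (Suc k) (commutator (field_L \<rho>) X)"
| comm_Lbar: "iterated_commutator \<rho> k X \<Longrightarrow>
     iterated_commutator \<rho> (Suc k) (commutator (field_Lbar \<rho>) X)"

text \<open>Coefficient \<open>\<lambda>\<close> in \<open>X \<equiv> \<lambda> T mod (L, Lbar)\<close>.  The fields \<open>L, Lbar, T\<close> annihilate \<open>\<rho>\<close>
  identically, hence so do all iterated commutators; therefore \<open>\<lambda>\<close> exists and is unique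
  wherever \<open>\<partial>\<rho>/\<partial>z\<^sub>1 \<noteq> 0\<close>.\<close>

definition T_coeff :: "(c2 \<Rightarrow> real) \<Rightarrow> vfield \<Rightarrow> c2 \<Rightarrow> complex" where
  "T_coeff \<rho> X z =
     (THE c. \<exists>a b. X z = c *s field_T \<rho> z + a *s field_L \<rho> z + b *s field_Lbar \<rho> z)"

lemma vector_4_nth:
  "(vector [a, b, c, d] :: 'a::zero ^ 4) $ 1 = a" "(vector [a, b, c, d] :: 'a ^ 4) $ 2 = b"
  "(vector [a, b, c, d] :: 'a ^ 4) $ 3 = c" "(vector [a, b, c, d] :: 'a ^ 4) $ 4 = d"
  unfolding vector_def by (simp_all add: fun_eq_iff)

lemma T_coeff_eq:
  assumes "dz1 (cplx \<rho>) z \<noteq> 0" "dzbar1 (cplx \<rho>) z \<noteq> 0"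
    and "X z = c *s field_T \<rho> z + a *s field_L \<rho> z + b *s field_Lbar \<rho> z"
  shows "T_coeff \<rho> X z = c"
  unfolding T_coeff_def
  apply (rule the_equality)
  using assms(3) apply blast
  using assms
  apply (auto simp: vec_eq_iff forall_4 field_T_def field_L_def field_Lbar_def vector_4_nth)
  done

definition lin_indep_on :: "c2 set \<Rightarrow> vfield set \<Rightarrow> bool" where
  "lin_indep_on V B \<longleftrightarrow>
     (\<forall>F c. finite F \<and> F \<subseteq> B \<and> (\<forall>z\<in>V. (\<Sum>X\<in>F. c X *s X z) = 0) \<longrightarrow> (\<forall>X\<in>F. c X = 0))"

text \<open>\<open>M\<close> is an admissible choice of the collection of linearly independent iterated commutators
  of degree at most \<open>k\<close>: a maximal subset that is linearly independent over \<open>\<complex>\<close> as a set of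
  vector fields on \<open>V\<close>.  Different choices change \<open>\<Lambda>\<^sub>k\<close> only by bounded factors.\<close>

definition commutator_basis :: "(c2 \<Rightarrow> real) \<Rightarrow> c2 set \<Rightarrow> nat \<Rightarrow> vfield set \<Rightarrow> bool" where
  "commutator_basis \<rho> V k M \<longleftrightarrow>
     M \<subseteq> {X. \<exists>j\<le>k. iterated_commutator \<rho> j X} \<and> lin_indep_on V M \<and>
     (\<forall>B. M \<subseteq> B \<and> B \<subseteq> {X. \<exists>j\<le>k. iterated_commutator \<rho> j X} \<and> lin_indep_on V B \<longrightarrow> B = M)"

definition Lambda :: "(c2 \<Rightarrow> real) \<Rightarrow> vfield set \<Rightarrow> c2 \<Rightarrow> real" where
  "Lambda \<rho> M z = sqrt (\<Sum>X\<in>M. (cmod (T_coeff \<rho> X z))\<^sup>2)"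

subsection \<open>Type\<close>

text \<open>\<open>k\<close> with \<open>\<Lambda>\<^sub>k(z) \<noteq> 0\<close>, at a point with \<open>\<partial>\<rho>/\<partial>z\<^sub>1 \<noteq> 0\<close>; the condition does not depend on
  the neighbourhood \<open>V\<close> or on the choice of \<open>M\<close>.\<close>

definition Lambda_nonzero :: "(c2 \<Rightarrow> real) \<Rightarrow> c2 \<Rightarrow> nat \<Rightarrow> bool" where
  "Lambda_nonzero \<rho> z k \<longleftrightarrow>
     (\<exists>V M. open V \<and> z \<in> V \<and> smooth_on V \<rho> \<and>
        (\<forall>x\<in>V. dz1 (cplx \<rho>) x \<noteq> 0 \<and> dzbar1 (cplx \<rho>) x \<noteq> 0) \<and>
        commutator_basis \<rho> V k M \<and> Lambda \<rho> M z \<noteq> 0)"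

text \<open>Where \<open>\<partial>\<rho>/\<partial>z\<^sub>1\<close> vanishes, \<open>\<partial>\<rho>/\<partial>z\<^sub>2\<close> does not, and the two coordinates are exchanged.\<close>

definition Lambda_nonzero_at :: "(c2 \<Rightarrow> real) \<Rightarrow> c2 \<Rightarrow> nat \<Rightarrow> bool" where
  "Lambda_nonzero_at \<rho> z k \<longleftrightarrow>
     (if dz1 (cplx \<rho>) z \<noteq> 0 then Lambda_nonzero \<rho> z k
      else Lambda_nonzero (\<rho> \<circ> prod.swap) (prod.swap z) k)"

definition point_type :: "(c2 \<Rightarrow> real) \<Rightarrow> c2 \<Rightarrow> nat" where
  "point_type \<rho> z = (LEAST k. Lambda_nonzero_at \<rho> z k)"

definition finite_type :: "c2 set \<Rightarrow> (c2 \<Rightarrow> real) \<Rightarrow> bool" where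
  "finite_type \<Omega> \<rho> \<longleftrightarrow>
     (\<forall>z\<in>frontier \<Omega>. \<exists>k. Lambda_nonzero_at \<rho> z k) \<and> bdd_above (point_type \<rho> ` frontier \<Omega>)"

definition domain_type :: "c2 set \<Rightarrow> (c2 \<Rightarrow> real) \<Rightarrow> nat" where
  "domain_type \<Omega> \<rho> = Max (point_type \<rho> ` frontier \<Omega>)"

subsection \<open>Distances\<close>

abbreviation proj :: "c2 set \<Rightarrow> c2 \<Rightarrow> c2" where
  "proj \<Omega> z \<equiv> closest_point (frontier \<Omega>) z"

definition bdist :: "c2 set \<Rightarrow> c2 \<Rightarrow> real" where
  "bdist \<Omega> z = dist z (proj \<Omega> z)"

text \<open>The complex normal direction at \<open>p\<close> is spanned by
  \<open>n = (\<partial>\<rho>/\<partial>zbar\<^sub>1, \<partial>\<rho>/\<partial>zbar\<^sub>2)\<close>; the component of \<open>v\<close> along it is the Hermitian product of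
  \<open>v\<close> with \<open>n / |n|\<close>.\<close>

definition bdist_n :: "c2 set \<Rightarrow> (c2 \<Rightarrow> real) \<Rightarrow> c2 \<Rightarrow> real" where
  "bdist_n \<Omega> \<rho> z =
     (let p = proj \<Omega> z; v = z - p; n = (dzbar1 (cplx \<rho>) p, dzbar2 (cplx \<rho>) p)
      in cmod (fst v * cnj (fst n) + snd v * cnj (snd n)) / norm n)"

text \<open>In the next two definitions \<open>M k\<close> is the collection used to form \<open>\<Lambda>\<^sub>k\<close>.  Indices with
  \<open>\<Lambda>\<^sub>k = 0\<close> contribute \<open>+\<infinity>\<close> to the infimum, so they are left out.\<close>

definition Dfun :: "c2 set \<Rightarrow> (c2 \<Rightarrow> real) \<Rightarrow> (nat \<Rightarrow> vfield set) \<Rightarrow> c2 \<Rightarrow> real" where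
  "Dfun \<Omega> \<rho> M z =
     (INF k\<in>{k\<in>{2..domain_type \<Omega> \<rho>}. Lambda \<rho> (M k) (proj \<Omega> z) \<noteq> 0}.
        root k (bdist \<Omega> z / Lambda \<rho> (M k) (proj \<Omega> z)))"

definition Lambda_upper :: "c2 set \<Rightarrow> (c2 \<Rightarrow> real) \<Rightarrow> (nat \<Rightarrow> vfield set) \<Rightarrow> real \<Rightarrow> c2 \<Rightarrow> real" where
  "Lambda_upper \<Omega> \<rho> M \<theta> \<zeta> = (\<Sum>k=2..domain_type \<Omega> \<rho>. \<theta> ^ k * Lambda \<rho> (M k) \<zeta>)"

subsection \<open>Polarization\<close>

definition vanishes_infinite_order_at :: "('a::metric_space \<Rightarrow> complex) \<Rightarrow> 'a \<Rightarrow> bool" where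
  "vanishes_infinite_order_at g p \<longleftrightarrow>
     (\<forall>N::nat. \<exists>C. \<forall>\<^sub>F x in nhds p. cmod (g x) \<le> C * dist x p ^ N)"

definition polarization :: "c2 set \<Rightarrow> (c2 \<Rightarrow> real) \<Rightarrow> (c2 \<Rightarrow> c2 \<Rightarrow> complex) \<Rightarrow> bool" where
  "polarization W \<rho> R \<longleftrightarrow>
     smooth_on (W \<times> W) (\<lambda>(z, w). R z w) \<and>
     (\<forall>z\<in>W. R z z = complex_of_real (\<rho> z)) \<and>
     (\<forall>p\<in>W. vanishes_infinite_order_at (\<lambda>(z, w). dzbar1 (\<lambda>u. R u w) z) (p, p) \<and>
             vanishes_infinite_order_at (\<lambda>(z, w). dzbar2 (\<lambda>u. R u w) z) (p, p) \<and>
             vanishes_infinite_order_at (\<lambda>(z, w). R z w - cnj (R w z)) (p, p))"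

subsection \<open>Approach regions\<close>

text \<open>The neighbourhood \<open>V\<close> of \<open>p\<close> is so small that \<open>L, Lbar, T\<close> span the tangent space on it and
  every point of \<open>\<Omega> \<inter> V\<close> has a unique nearest boundary point, which lies in \<open>V\<close> (so that the
  \<open>\<Lambda>\<^sub>k\<close> are available there).\<close>

definition small_nbhd :: "c2 set \<Rightarrow> c2 set \<Rightarrow> (c2 \<Rightarrow> real) \<Rightarrow> c2 \<Rightarrow> c2 set \<Rightarrow> bool" where
  "small_nbhd \<Omega> W \<rho> p V \<longleftrightarrow>
     open V \<and> p \<in> V \<and> V \<subseteq> W \<and>
     (\<forall>z\<in>V. dz1 (cplx \<rho>) z \<noteq> 0 \<and> dzbar1 (cplx \<rho>) z \<noteq> 0) \<and>
     (\<forall>z\<in>\<Omega> \<inter> V. (\<exists>!q. q \<in> frontier \<Omega> \<and> dist z q = infdist z (frontier \<Omega>)) \<and> proj \<Omega> z \<in> V)"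

definition approach_region ::
    "c2 set \<Rightarrow> (c2 \<Rightarrow> real) \<Rightarrow> c2 set \<Rightarrow> (nat \<Rightarrow> vfield set) \<Rightarrow> (c2 \<Rightarrow> c2 \<Rightarrow> complex) \<Rightarrow>
     (real \<Rightarrow> real) \<Rightarrow> (real \<Rightarrow> real) \<Rightarrow> c2 \<Rightarrow> c2 set" where
  "approach_region \<Omega> \<rho> V M R h1 h2 w =
     {z \<in> \<Omega> \<inter> V.
        dist z w < h1 (bdist_n \<Omega> \<rho> z) * Dfun \<Omega> \<rho> M z \<and>
        cmod (R (proj \<Omega> z) w) < h2 (bdist_n \<Omega> \<rho> z) * Lambda_upper \<Omega> \<rho> M (Dfun \<Omega> \<rho> M z) w}"

text \<open>Decreasing is read in the weak sense.\<close>

definition aperture :: "(real \<Rightarrow> real) \<Rightarrow> bool" where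
  "aperture h \<longleftrightarrow>
     continuous_on {0<..1} h \<and> (\<forall>x\<in>{0<..1}. 1 \<le> h x) \<and> antimono_on {0<..1} h \<and>
     filterlim h at_top (at_right 0)"

end

theory Submission
  imports Defs "HOL-Complex_Analysis.Cauchy_Integral_Formula"
begin

text \<open>Since \<open>\<Omega>\<close> lies in the unit ball and touches the sphere at \<open>(1, 0)\<close>, its boundary is strictly
  convex near \<open>(1, 0)\<close>. Hence the type is 2 there, \<open>D\<close> is bounded below by a multiple of
  \<open>\<delta>\<^sup>1\<^sup>/\<^sup>2\<close>, and the complex tangent planes at boundary points \<open>p\<close> near \<open>(1, 0)\<close> give
  functions \<open>l p\<close> with positive real part on \<open>\<Omega>\<close>. If the points \<open>p\<close> are \<open>a H\<close>-separated for the quasi-distance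
  \<open>\<bar>l p q\<bar>\<close>, with \<open>H\<close> large, then the sum of \<open>(a / (a + l p))\<^sup>7\<close> is almost bounded by 1, is close to 1 at the
  points at height a small fraction of \<open>a\<close> below each \<open>p\<close>, and tends to 0 on compact sets as \<open>a\<close> tends to 0.
  Because the apertures tend to infinity, the approach region of every nearby boundary point
  contains one of these points. Squeezing the values towards the segment from 0 to 1 allows infinitely many such sums
  to be combined into a bounded function whose values near 0 and near 1 both accumulate in every approach region.\<close>

subsection \<open>Smooth functions and second order Taylor expansion\<close>

text \<open>Two demands pull against each other. For the sum of the peaks to stay almost below 1 the
  net must be coarse, of mesh \<open>a * H\<close> with \<open>H\<close> large. Yet every nearby
  boundary point has to find some peak point in its approach region. A region of fixed aperture only
  reaches peaks whose quasi-distance is comparable to their height. Unbounded apertures admit any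
  fixed ratio once the height is small, so \<open>H\<close> may be fixed first and the height chosen
  last. The exponent 7 beats a packing count. Quasi-balls are compared with Euclidean balls in
  \<open>c2 \<times> complex\<close>, of real dimension 6, so at most a constant times
  \<open>(r / S) ^ 6\<close> net points lie within \<open>r\<close>, and one further power makes the
  sum over dyadic shells converge. Values in the disc are not enough for the iteration:
  \<open>f * (1 - g) + a * g\<close> is a convex combination only when \<open>g\<close> lies on the
  segment from 0 to 1. The map to a thin lens restores this up to an error that is summable over the
  steps.\<close>

lemma k_smooth_on_cong:
  assumes "open S" "k_smooth_on n S f" "\<And>x. x \<in> S \<Longrightarrow> f x = g x"
  shows "k_smooth_on n S g"
  using assms(2,3)
proof (induction n arbitrary: f g)
  case 0
  then show ?case
    using continuous_on_cong by force
next
  case (Suc n)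
  have "frechet_derivative f (at x) = frechet_derivative g (at x)" if "x \<in> S" for x
    using Suc.prems that assms(1) by (intro frechet_derivative_transform_within_open) auto
  moreover have "g differentiable (at x)" if "x \<in> S" for x
    using Suc.prems that assms(1)
    by (metis differentiable_def has_derivative_transform_within_open k_smooth_on.simps(2))
  ultimately show ?case
    using Suc.prems Suc.IH[of "\<lambda>x. frechet_derivative f (at x) v" "\<lambda>x. frechet_derivative g (at x) v" for v]
    by auto
qed

lemma k_smooth_on_Suc_imp: "k_smooth_on (Suc n) S f \<Longrightarrow> k_smooth_on n S f"
proof (induction n arbitrary: f)
  case 0
  then show ?case
    by (simp add: continuous_on_eq_continuous_within continuous_at_imp_continuous_at_within
        differentiable_imp_continuous_within)
next
  case (Suc n)
  then show ?case by auto
qed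

lemma k_smooth_on_subset: "k_smooth_on n S f \<Longrightarrow> T \<subseteq> S \<Longrightarrow> k_smooth_on n T f"
  by (induction n arbitrary: f) (auto intro: continuous_on_subset)

lemma k_smooth_on_const: "k_smooth_on n S (\<lambda>_. c)"
  by (induction n arbitrary: c) auto

lemma frechet_derivative_eqI: "(f has_derivative f') (at x) \<Longrightarrow> frechet_derivative f (at x) = f'"
  using frechet_derivative_at by metis

lemma frechet_derivative_bounded_linear:
  assumes "bounded_linear T" "f differentiable (at x)"
  shows "frechet_derivative (\<lambda>x. T (f x)) (at x) v = T (frechet_derivative f (at x) v)"
  using bounded_linear.has_derivative[OF assms(1)] assms(2) frechet_derivative_works
  by (metis frechet_derivative_eqI)

lemma k_smooth_on_bounded_linear:
  assumes "open S" "bounded_linear T" "k_smooth_on n S f"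
  shows "k_smooth_on n S (\<lambda>x. T (f x))"
  using assms(3)
proof (induction n arbitrary: f)
  case 0
  then show ?case
    using assms(2) bounded_linear.continuous_on by auto
next
  case (Suc n)
  have "k_smooth_on n S (\<lambda>x. T (frechet_derivative f (at x) v))" for v
    using Suc by auto
  then have "k_smooth_on n S (\<lambda>x. frechet_derivative (\<lambda>x. T (f x)) (at x) v)" for v
    by (rule k_smooth_on_cong[OF assms(1)])
      (use Suc.prems assms(2) in \<open>simp add: frechet_derivative_bounded_linear\<close>)
  moreover have "(\<lambda>x. T (f x)) differentiable (at x)" if "x \<in> S" for x
    using Suc.prems that bounded_linear.has_derivative[OF assms(2)] by (fastforce simp: differentiable_def)
  ultimately show ?case by auto
qed

lemma k_smooth_on_add:
  assumes "open S" "k_smooth_on n S f" "k_smooth_on n S g"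
  shows "k_smooth_on n S (\<lambda>x. f x + g x)"
  using assms(2,3)
proof (induction n arbitrary: f g)
  case 0
  then show ?case
    by (auto intro: continuous_intros)
next
  case (Suc n)
  have "k_smooth_on n S (\<lambda>x. frechet_derivative f (at x) v + frechet_derivative g (at x) v)" for v
    using Suc by auto
  then have "k_smooth_on n S (\<lambda>x. frechet_derivative (\<lambda>x. f x + g x) (at x) v)" for v
  proof (rule k_smooth_on_cong[OF assms(1)])
    fix x assume "x \<in> S"
    then have "(f has_derivative frechet_derivative f (at x)) (at x)"
      "(g has_derivative frechet_derivative g (at x)) (at x)"
      using Suc.prems by (simp_all add: frechet_derivative_works)
    from has_derivative_add[OF this]
    show "frechet_derivative f (at x) v + frechet_derivative g (at x) v
      = frechet_derivative (\<lambda>x. f x + g x) (at x) v"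
      by (simp add: frechet_derivative_eqI)
  qed
  then show ?case using Suc.prems by (auto intro: differentiable_add)
qed

lemma k_smooth_on_mult:
  fixes f g :: "'a::real_normed_vector \<Rightarrow> 'b::real_normed_algebra"
  assumes "open S" "k_smooth_on n S f" "k_smooth_on n S g"
  shows "k_smooth_on n S (\<lambda>x. f x * g x)"
  using assms(2,3)
proof (induction n arbitrary: f g)
  case 0
  then show ?case
    by (auto intro: continuous_intros)
next
  case (Suc n)
  have "k_smooth_on n S (\<lambda>x. f x * frechet_derivative g (at x) v)"
    "k_smooth_on n S (\<lambda>x. frechet_derivative f (at x) v * g x)" for v
    using Suc.prems k_smooth_on_Suc_imp[OF Suc.prems(1)] k_smooth_on_Suc_imp[OF Suc.prems(2)]
    by (auto intro!: Suc.IH)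
  then have "k_smooth_on n S (\<lambda>x. f x * frechet_derivative g (at x) v + frechet_derivative f (at x) v * g x)" for v
    using k_smooth_on_add[OF assms(1)] by blast
  then have "k_smooth_on n S (\<lambda>x. frechet_derivative (\<lambda>x. f x * g x) (at x) v)" for v
  proof (rule k_smooth_on_cong[OF assms(1)])
    fix x assume "x \<in> S"
    then have "(f has_derivative frechet_derivative f (at x)) (at x)"
      "(g has_derivative frechet_derivative g (at x)) (at x)"
      using Suc.prems by (simp_all add: frechet_derivative_works)
    from has_derivative_mult[OF this]
    show "f x * frechet_derivative g (at x) v + frechet_derivative f (at x) v * g x
      = frechet_derivative (\<lambda>x. f x * g x) (at x) v"
      by (simp add: frechet_derivative_eqI)
  qed
  moreover have "(\<lambda>x. f x * g x) differentiable (at x)" if "x \<in> S" for x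
    using Suc.prems that by (fastforce simp: differentiable_def dest: has_derivative_mult)
  ultimately show ?case by auto
qed

lemma smooth_on_subset: "smooth_on S f \<Longrightarrow> T \<subseteq> S \<Longrightarrow> smooth_on T f"
  by (auto simp: smooth_on_def intro: k_smooth_on_subset)

lemma smooth_on_const: "smooth_on S (\<lambda>_. c)"
  by (simp add: smooth_on_def k_smooth_on_const)

lemma smooth_on_bounded_linear:
  "open S \<Longrightarrow> bounded_linear T \<Longrightarrow> smooth_on S f \<Longrightarrow> smooth_on S (\<lambda>x. T (f x))"
  by (simp add: smooth_on_def k_smooth_on_bounded_linear)

lemma smooth_on_add: "open S \<Longrightarrow> smooth_on S f \<Longrightarrow> smooth_on S g \<Longrightarrow> smooth_on S (\<lambda>x. f x + g x)"
  by (simp add: smooth_on_def k_smooth_on_add)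

lemma smooth_on_mult:
  fixes f g :: "'a::real_normed_vector \<Rightarrow> 'b::real_normed_algebra"
  shows "open S \<Longrightarrow> smooth_on S f \<Longrightarrow> smooth_on S g \<Longrightarrow> smooth_on S (\<lambda>x. f x * g x)"
  by (simp add: smooth_on_def k_smooth_on_mult)

lemma smooth_on_cmult:
  fixes f :: "'a::real_normed_vector \<Rightarrow> 'b::real_normed_algebra"
  shows "open S \<Longrightarrow> smooth_on S f \<Longrightarrow> smooth_on S (\<lambda>x. c * f x)"
  using smooth_on_mult smooth_on_const by blast

lemma smooth_on_minus: "open S \<Longrightarrow> smooth_on S f \<Longrightarrow> smooth_on S (\<lambda>x. - f x)"
  using smooth_on_bounded_linear[OF _ bounded_linear_minus[OF bounded_linear_ident]] .

lemma smooth_on_diff: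
  "open S \<Longrightarrow> smooth_on S f \<Longrightarrow> smooth_on S g \<Longrightarrow> smooth_on S (\<lambda>x. f x - g x)"
  using smooth_on_add[of S f "\<lambda>x. - g x"] smooth_on_minus[of S g] by simp

lemma smooth_on_frechet_derivative:
  "smooth_on S f \<Longrightarrow> smooth_on S (\<lambda>x. frechet_derivative f (at x) v)"
  unfolding smooth_on_def by (metis k_smooth_on.simps(2))

lemma smooth_on_differentiable: "smooth_on S f \<Longrightarrow> x \<in> S \<Longrightarrow> f differentiable (at x)"
  unfolding smooth_on_def by (metis k_smooth_on.simps(2))

lemma smooth_on_has_derivative:
  "smooth_on S f \<Longrightarrow> x \<in> S \<Longrightarrow> (f has_derivative frechet_derivative f (at x)) (at x)"
  using smooth_on_differentiable frechet_derivative_works by blast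

lemma smooth_on_continuous: "smooth_on S f \<Longrightarrow> continuous_on S f"
  unfolding smooth_on_def by (metis k_smooth_on.simps(1))

section \<open>Mean value and Taylor estimates on compact convex sets\<close>

lemma linear_euclidean_expand:
  fixes f :: "'a::euclidean_space \<Rightarrow> 'b::real_normed_vector"
  assumes "linear f"
  shows "f v = (\<Sum>b\<in>Basis. (v \<bullet> b) *\<^sub>R f b)"
proof -
  have "f v = f (\<Sum>b\<in>Basis. (v \<bullet> b) *\<^sub>R b)"
    by (simp only: euclidean_representation)
  also have "\<dots> = (\<Sum>b\<in>Basis. (v \<bullet> b) *\<^sub>R f b)"
    by (simp only: linear_sum[OF assms] linear_cmul[OF assms])
  finally show ?thesis .
qed

text \<open>The sum over the basis replaces the operator norm because, for smooth \<open>f\<close>,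
  it is visibly continuous in \<open>x\<close> and hence bounded on compact sets.\<close>

lemma frechet_derivative_norm_le:
  fixes f :: "'a::euclidean_space \<Rightarrow> 'b::real_normed_vector"
  assumes "f differentiable (at x)"
  shows "norm (frechet_derivative f (at x) v) \<le> (\<Sum>b\<in>Basis. norm (frechet_derivative f (at x) b)) * norm v"
proof -
  have "norm (frechet_derivative f (at x) v) = norm (\<Sum>b\<in>Basis. (v \<bullet> b) *\<^sub>R frechet_derivative f (at x) b)"
    using linear_euclidean_expand[OF linear_frechet_derivative[OF assms], of v] by simp
  also have "\<dots> \<le> (\<Sum>b\<in>Basis. norm v * norm (frechet_derivative f (at x) b))"
    by (rule sum_norm_le) (auto intro!: mult_right_mono simp: Basis_le_norm)
  finally show ?thesis
    by (simp add: sum_distrib_left mult.commute)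
qed

lemma smooth_on_lipschitz:
  fixes f :: "'a::euclidean_space \<Rightarrow> 'b::real_normed_vector"
  assumes "smooth_on S f" "compact K" "convex K" "K \<subseteq> S"
  shows "\<exists>C\<ge>0. \<forall>x\<in>K. \<forall>y\<in>K. norm (f x - f y) \<le> C * norm (x - y)"
proof -
  have "continuous_on K (\<lambda>x. \<Sum>b\<in>Basis. norm (frechet_derivative f (at x) b))"
    by (intro continuous_intros continuous_on_subset[OF smooth_on_continuous assms(4)]
        smooth_on_frechet_derivative assms)
  then obtain B where B: "\<And>x. x \<in> K \<Longrightarrow> (\<Sum>b\<in>Basis. norm (frechet_derivative f (at x) b)) \<le> B"
    using compact_imp_bounded[OF compact_continuous_image[OF _ assms(2)]]
    by (force simp: bounded_real dest: abs_le_D1)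
  \<comment> \<open>The maximum covers an empty \<open>K\<close>, where \<open>B\<close> might be
    negative.\<close>
  have "norm (f x - f y) \<le> max B 0 * norm (x - y)" if "x \<in> K" "y \<in> K" for x y
  proof (rule differentiable_bound[OF assms(3)])
    show "(f has_derivative frechet_derivative f (at x)) (at x within K)" if "x \<in> K" for x
      using that assms smooth_on_has_derivative has_derivative_at_withinI by blast
    show "onorm (frechet_derivative f (at x)) \<le> max B 0" if "x \<in> K" for x
    proof (rule onorm_bound)
      fix v
      have "norm (frechet_derivative f (at x) v)
          \<le> (\<Sum>b\<in>Basis. norm (frechet_derivative f (at x) b)) * norm v"
        using that assms by (intro frechet_derivative_norm_le smooth_on_differentiable[OF assms(1)]) auto
      also have "\<dots> \<le> max B 0 * norm v"
        using B[OF that] by (intro mult_right_mono) auto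
      finally show "norm (frechet_derivative f (at x) v) \<le> max B 0 * norm v" .
    qed simp
  qed (use that in auto)
  then show ?thesis by (intro exI[of _ "max B 0"]) auto
qed

text \<open>Linearity in \<open>v\<close> reduces the uniform bound to the finitely many basis
  directions, each a smooth function of the point.\<close>

lemma smooth_on_lipschitz_derivative:
  fixes f :: "'a::euclidean_space \<Rightarrow> 'b::real_normed_vector"
  assumes "smooth_on S f" "compact K" "convex K" "K \<subseteq> S"
  shows "\<exists>C\<ge>0. \<forall>x\<in>K. \<forall>y\<in>K. \<forall>v. norm (frechet_derivative f (at x) v - frechet_derivative f (at y) v)
            \<le> C * norm (x - y) * norm v"
proof -
  have "\<forall>b\<in>Basis. \<exists>C\<ge>0. \<forall>x\<in>K. \<forall>y\<in>K.
      norm (frechet_derivative f (at x) b - frechet_derivative f (at y) b) \<le> C * norm (x - y)"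
    using smooth_on_lipschitz[OF smooth_on_frechet_derivative[OF assms(1)] assms(2-4)] by blast
  then obtain C where C: "\<And>b. b \<in> Basis \<Longrightarrow> C b \<ge> 0" "\<And>b x y. b \<in> Basis \<Longrightarrow> x \<in> K \<Longrightarrow> y \<in> K \<Longrightarrow>
      norm (frechet_derivative f (at x) b - frechet_derivative f (at y) b) \<le> C b * norm (x - y)"
    by metis
  have "norm (frechet_derivative f (at x) v - frechet_derivative f (at y) v)
            \<le> (\<Sum>b\<in>Basis. C b) * norm (x - y) * norm v" if xy: "x \<in> K" "y \<in> K" for x y v
  proof -
    have lin: "linear (\<lambda>v. frechet_derivative f (at x) v - frechet_derivative f (at y) v)"
      using assms xy by (intro linear_compose_sub linear_frechet_derivative smooth_on_differentiable[OF assms(1)]) auto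
    have "norm (frechet_derivative f (at x) v - frechet_derivative f (at y) v)
      = norm (\<Sum>b\<in>Basis. (v \<bullet> b) *\<^sub>R (frechet_derivative f (at x) b - frechet_derivative f (at y) b))"
      using linear_euclidean_expand[OF lin, of v] by simp
    also have "\<dots> \<le> (\<Sum>b\<in>Basis. norm v * (C b * norm (x - y)))"
      using C xy by (intro sum_norm_le) (auto intro!: mult_mono simp: Basis_le_norm)
    finally show ?thesis
      by (simp add: sum_distrib_left sum_distrib_right mult_ac)
  qed
  then show ?thesis
    using C(1) by (intro exI[of _ "\<Sum>b\<in>Basis. C b"]) (auto intro: sum_nonneg)
qed

text \<open>The linearization error on a segment is at most its length times the oscillation of the
  derivative, which is Lipschitz.\<close>

lemma smooth_on_taylor_first:
  fixes f :: "'a::euclidean_space \<Rightarrow> 'b::real_normed_vector"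
  assumes "smooth_on S f" "compact K" "convex K" "K \<subseteq> S"
  shows "\<exists>C\<ge>0. \<forall>x\<in>K. \<forall>y\<in>K. norm (f y - f x - frechet_derivative f (at x) (y - x)) \<le> C * (norm (y - x))\<^sup>2"
proof -
  obtain C where C: "C \<ge> 0" "\<And>x y v. x \<in> K \<Longrightarrow> y \<in> K \<Longrightarrow>
     norm (frechet_derivative f (at x) v - frechet_derivative f (at y) v) \<le> C * norm (x - y) * norm v"
    using smooth_on_lipschitz_derivative[OF assms] by metis
  have "norm (f y - f x - frechet_derivative f (at x) (y - x)) \<le> C * (norm (y - x))\<^sup>2"
    if xy: "x \<in> K" "y \<in> K" for x y
  proof -
    have seg: "closed_segment x y \<subseteq> K"
      using xy assms(3) closed_segment_subset by blast
    have "norm (f y - f x - frechet_derivative f (at x) (y - x)) \<le> norm (y - x) * (C * norm (y - x))"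
    proof (rule differentiable_bound_linearization[where S="closed_segment x y" and f="f"])
      show "x + t *\<^sub>R (y - x) \<in> closed_segment x y" if "t \<in> {0..1}" for t
        using that by (auto simp: in_segment algebra_simps intro!: exI[of _ t])
      show "(f has_derivative frechet_derivative f (at z)) (at z within closed_segment x y)"
        if "z \<in> closed_segment x y" for z
        using that seg assms smooth_on_has_derivative has_derivative_at_withinI by blast
      show "onorm (frechet_derivative f (at z) - frechet_derivative f (at x)) \<le> C * norm (y - x)"
        if z: "z \<in> closed_segment x y" for z
      proof (rule onorm_bound)
        fix v :: 'a
        have "norm (z - x) \<le> norm (y - x)"
          using segment_bound[OF z] by (simp add: norm_minus_commute)
        then have "C * norm (z - x) * norm v \<le> C * norm (y - x) * norm v"
          using C(1) by (intro mult_right_mono mult_left_mono) auto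
        then show "norm ((frechet_derivative f (at z) - frechet_derivative f (at x)) v) \<le> C * norm (y - x) * norm v"
          using C(2)[of z x v] z seg xy by fastforce
      qed (use C in auto)
    qed auto
    then show ?thesis by (simp add: power2_eq_square mult_ac)
  qed
  then show ?thesis using C by blast
qed

definition second_derivative :: "('a::real_normed_vector \<Rightarrow> 'b::real_normed_vector) \<Rightarrow> 'a \<Rightarrow> 'a \<Rightarrow> 'a \<Rightarrow> 'b"
  where "second_derivative f x v w = frechet_derivative (\<lambda>y. frechet_derivative f (at y) v) (at x) w"

lemma smooth_on_second_derivative: "smooth_on S f \<Longrightarrow> smooth_on S (\<lambda>x. second_derivative f x v w)"
  unfolding second_derivative_def by (intro smooth_on_frechet_derivative)

lemma linear_second_derivative_right:
  assumes "smooth_on S f" "x \<in> S"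
  shows "linear (second_derivative f x v)"
  unfolding second_derivative_def[abs_def]
  using assms by (intro linear_frechet_derivative smooth_on_differentiable[OF smooth_on_frechet_derivative])

lemma linear_second_derivative_left:
  assumes "open S" "smooth_on S f" "x \<in> S"
  shows "linear (\<lambda>v. second_derivative f x v w)"
proof (rule linearI)
  note d = smooth_on_has_derivative[OF smooth_on_frechet_derivative[OF assms(2)] assms(3)]
  note lin = linear_frechet_derivative[OF smooth_on_differentiable[OF assms(2)]]
  fix a b
  have "((\<lambda>y. frechet_derivative f (at y) (a + b)) has_derivative
      (\<lambda>w. second_derivative f x a w + second_derivative f x b w)) (at x)"
    unfolding second_derivative_def
    by (rule has_derivative_transform_within_open[OF has_derivative_add[OF d d] assms(1,3)])
      (simp add: linear_add[OF lin])
  then show "second_derivative f x (a + b) w = second_derivative f x a w + second_derivative f x b w"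
    by (simp add: second_derivative_def frechet_derivative_eqI)
  fix c :: real
  have "((\<lambda>y. frechet_derivative f (at y) (c *\<^sub>R b)) has_derivative
      (\<lambda>w. c *\<^sub>R second_derivative f x b w)) (at x)"
    unfolding second_derivative_def
    by (rule has_derivative_transform_within_open[OF has_derivative_scaleR_right[OF d] assms(1,3)])
      (simp add: linear_cmul[OF lin])
  then show "second_derivative f x (c *\<^sub>R b) w = c *\<^sub>R second_derivative f x b w"
    by (simp add: second_derivative_def frechet_derivative_eqI)
qed

lemma second_derivative_expand:
  fixes f :: "'a::euclidean_space \<Rightarrow> 'b::real_normed_vector"
  assumes "open S" "smooth_on S f" "x \<in> S"
  shows "second_derivative f x v w =
    (\<Sum>b\<in>Basis. \<Sum>c\<in>Basis. ((v \<bullet> b) * (w \<bullet> c)) *\<^sub>R second_derivative f x b c)"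
proof -
  note R = linear_second_derivative_right[OF assms(2,3)]
  note L = linear_second_derivative_left[OF assms]
  have "second_derivative f x v w = (\<Sum>b\<in>Basis. (v \<bullet> b) *\<^sub>R second_derivative f x b w)"
    by (rule linear_euclidean_expand[OF L])
  also have "\<dots> = (\<Sum>b\<in>Basis. (v \<bullet> b) *\<^sub>R (\<Sum>c\<in>Basis. (w \<bullet> c) *\<^sub>R second_derivative f x b c))"
    by (simp only: linear_euclidean_expand[OF R, of _ w])
  finally show ?thesis
    by (simp add: scaleR_sum_right)
qed

text \<open>By bilinearity, uniformity in \<open>v\<close> and \<open>w\<close> reduces to the
  continuity of finitely many coefficients at \<open>e\<close>.\<close>

lemma second_derivative_continuous:
  fixes f :: "'a::euclidean_space \<Rightarrow> 'b::real_normed_vector"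
  assumes "open S" "smooth_on S f" "e \<in> S" "\<epsilon> > 0"
  shows "\<exists>r>0. ball e r \<subseteq> S \<and> (\<forall>x\<in>ball e r. \<forall>v w.
     norm (second_derivative f x v w - second_derivative f e v w) \<le> \<epsilon> * norm v * norm w)"
proof -
  define h where "h x = (\<Sum>b\<in>Basis. \<Sum>c\<in>Basis. norm (second_derivative f x b c - second_derivative f e b c))" for x
  have "continuous_on S h"
    unfolding h_def by (intro continuous_intros smooth_on_continuous smooth_on_second_derivative assms)
  then have "isCont h e"
    using assms continuous_on_eq_continuous_at by blast
  then have "\<forall>\<^sub>F x in at e. dist (h x) (h e) < \<epsilon>"
    using assms(4) unfolding isCont_def tendsto_iff by blast
  then obtain r1 where r1: "r1 > 0" "\<And>x. x \<noteq> e \<Longrightarrow> dist x e < r1 \<Longrightarrow> dist (h x) (h e) < \<epsilon>"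
    unfolding eventually_at by blast
  obtain r2 where r2: "r2 > 0" "ball e r2 \<subseteq> S"
    using assms openE by blast
  have he: "h e = 0" by (simp add: h_def)
  have "norm (second_derivative f x v w - second_derivative f e v w) \<le> \<epsilon> * norm v * norm w"
    if x: "x \<in> ball e (min r1 r2)" for x v w
  proof -
    have xS: "x \<in> S" using x r2 by auto
    have hx: "h x \<le> \<epsilon>"
      using r1(2)[of x] x he assms(4) by (cases "x = e") (auto simp: dist_commute)
    have "second_derivative f x v w - second_derivative f e v w =
      (\<Sum>b\<in>Basis. \<Sum>c\<in>Basis. ((v \<bullet> b) * (w \<bullet> c)) *\<^sub>R (second_derivative f x b c - second_derivative f e b c))"
      unfolding second_derivative_expand[OF assms(1,2) xS, of v w]
        second_derivative_expand[OF assms(1-3), of v w]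
      by (simp add: sum_subtractf scaleR_diff_right)
    also have "norm \<dots> \<le> (\<Sum>b\<in>Basis. \<Sum>c\<in>Basis.
        norm v * norm w * norm (second_derivative f x b c - second_derivative f e b c))"
      by (intro sum_norm_le) (auto simp: abs_mult intro!: mult_mono Basis_le_norm)
    also have "\<dots> = norm v * norm w * h x"
      by (simp add: h_def sum_distrib_left)
    also have "\<dots> \<le> norm v * norm w * \<epsilon>"
      using hx by (intro mult_left_mono) auto
    finally show ?thesis by (simp add: mult_ac)
  qed
  then show ?thesis
    using r1 r2 by (intro exI[of _ "min r1 r2"]) auto
qed

text \<open>The base point \<open>p\<close> varies while the Hessian stays frozen at
  \<open>e\<close>; replacing the Hessian at the intermediate point by the one at \<open>e\<close>
  costs \<epsilon>. This is what lets information at the single point \<open>e\<close> govern all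
  nearby points.\<close>

lemma smooth_on_taylor_second:
  fixes f :: "'a::euclidean_space \<Rightarrow> real"
  assumes "open S" "smooth_on S f" "e \<in> S" "\<epsilon> > 0"
  shows "\<exists>r>0. ball e r \<subseteq> S \<and> (\<forall>p\<in>ball e r. \<forall>z\<in>ball e r.
     \<bar>f z - f p - frechet_derivative f (at p) (z - p) - second_derivative f e (z - p) (z - p) / 2\<bar>
       \<le> \<epsilon> * (norm (z - p))\<^sup>2)"
proof -
  obtain r where r: "r > 0" "ball e r \<subseteq> S" "\<And>x v w. x \<in> ball e r \<Longrightarrow>
     norm (second_derivative f x v w - second_derivative f e v w) \<le> \<epsilon> * norm v * norm w"
    using second_derivative_continuous[OF assms] by metis
  have "\<bar>f z - f p - frechet_derivative f (at p) (z - p) - second_derivative f e (z - p) (z - p) / 2\<bar>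
       \<le> \<epsilon> * (norm (z - p))\<^sup>2" if pz: "p \<in> ball e r" "z \<in> ball e r" for p z
  proof -
    define v where "v = z - p"
    have seg: "p + t *\<^sub>R v \<in> ball e r" if "0 \<le> t" "t \<le> 1" for t
    proof -
      have "(1 - t) *\<^sub>R p + t *\<^sub>R z \<in> ball e r"
        using that pz convex_ball[of e r] by (intro convexD) auto
      then show ?thesis by (simp add: v_def algebra_simps)
    qed
    \<comment> \<open>The function and its first two derivatives along the segment, in the indexed
      form that \<open>Maclaurin\<close> expects.\<close>
    define d where "d m t = (if m = 0 then f (p + t *\<^sub>R v)
       else if m = 1 then frechet_derivative f (at (p + t *\<^sub>R v)) v
       else second_derivative f (p + t *\<^sub>R v) v v)" for m :: nat and t :: real
    have line: "((\<lambda>t. p + t *\<^sub>R v) has_derivative (\<lambda>s. s *\<^sub>R v)) (at t)" for t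
      by (auto intro!: derivative_eq_intros)
    have D: "((\<lambda>t. g (p + t *\<^sub>R v)) has_field_derivative frechet_derivative g (at (p + t *\<^sub>R v)) v) (at t)"
      if "smooth_on S g" "0 \<le> t" "t \<le> 1" for g :: "'a \<Rightarrow> real" and t
    proof -
      have S: "p + t *\<^sub>R v \<in> S" using seg that r by blast
      have "((\<lambda>t. g (p + t *\<^sub>R v)) has_derivative (\<lambda>s. frechet_derivative g (at (p + t *\<^sub>R v)) (s *\<^sub>R v))) (at t)"
        using has_derivative_compose[OF line smooth_on_has_derivative[OF that(1) S]] by simp
      moreover have "(\<lambda>s. frechet_derivative g (at (p + t *\<^sub>R v)) (s *\<^sub>R v)) = (*) (frechet_derivative g (at (p + t *\<^sub>R v)) v)"
        by (simp add: fun_eq_iff mult.commute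
            linear_cmul[OF linear_frechet_derivative[OF smooth_on_differentiable[OF that(1) S]]])
      ultimately show ?thesis
        unfolding has_field_derivative_def by simp
    qed
    have "\<exists>t>0. t < 1 \<and> f (p + 1 *\<^sub>R v) = (\<Sum>m<2. (d m 0 / fact m) * 1 ^ m) + (d 2 t / fact 2) * 1 ^ 2"
    proof (rule Maclaurin)
      show "d 0 = (\<lambda>t. f (p + t *\<^sub>R v))" by (simp add: d_def fun_eq_iff)
      show "\<forall>m t. m < 2 \<and> 0 \<le> t \<and> t \<le> 1 \<longrightarrow> (d m has_real_derivative d (Suc m) t) (at t)"
      proof (intro allI impI)
        fix m :: nat and t :: real
        assume *: "m < 2 \<and> 0 \<le> t \<and> t \<le> 1"
        then consider "m = 0" | "m = 1" by linarith
        then show "(d m has_real_derivative d (Suc m) t) (at t)"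
        proof cases
          case 1
          then show ?thesis
            using D[OF assms(2), of t] * by (simp add: d_def[abs_def])
        next
          case 2
          then show ?thesis
            using D[OF smooth_on_frechet_derivative[OF assms(2), of v], of t] *
            by (simp add: d_def[abs_def] second_derivative_def)
        qed
      qed
    qed auto
    then obtain t where t: "0 < t" "t < 1"
      "f (p + 1 *\<^sub>R v) = (\<Sum>m<2. (d m 0 / fact m) * 1 ^ m) + (d 2 t / fact 2) * 1 ^ 2"
      by blast
    have "f z = f p + frechet_derivative f (at p) v + second_derivative f (p + t *\<^sub>R v) v v / 2"
      using t(3) by (simp add: d_def v_def numeral_2_eq_2)
    moreover have "\<bar>second_derivative f (p + t *\<^sub>R v) v v - second_derivative f e v v\<bar> \<le> \<epsilon> * (norm v)\<^sup>2"
      using r(3)[OF seg[of t], of v v] t by (simp add: power2_eq_square mult.assoc)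
    moreover have "0 \<le> \<epsilon> * (norm v)\<^sup>2" using assms(4) by simp
    ultimately show ?thesis
      unfolding v_def[symmetric] by linarith
  qed
  then show ?thesis using r by blast
qed

text \<open>The second difference over a parallelogram is symmetric in \<open>v\<close> and
  \<open>w\<close>. Expanding along \<open>w\<close> at the two corners \<open>e\<close> and
  \<open>e + s *\<^sub>R v\<close>, the quadratic terms cancel and a difference quotient of the
  first derivative remains, whose limit is the mixed derivative.\<close>

lemma second_derivative_symmetric:
  fixes f :: "'a::euclidean_space \<Rightarrow> real"
  assumes "open S" "smooth_on S f" "e \<in> S"
  shows "second_derivative f e v w = second_derivative f e w v"
proof -
  define Q where "Q = second_derivative f e"
  have main: "((\<lambda>s. (f (e + s *\<^sub>R v + s *\<^sub>R w) - f (e + s *\<^sub>R v) - f (e + s *\<^sub>R w) + f e) / s\<^sup>2)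
      \<longlongrightarrow> Q w v) (at_right 0)" for v w :: 'a
  proof (rule tendstoI)
    fix \<epsilon> :: real assume \<epsilon>: "\<epsilon> > 0"
    \<comment> \<open>Two Taylor errors, each \<open>\<eta> * (norm w)\<^sup>2\<close> after
      division by \<open>s\<^sup>2\<close>, must fit into \<epsilon>/2; the summand 1 covers
      \<open>w = 0\<close>.\<close>
    define \<eta> where "\<eta> = \<epsilon> / (2 * ((norm w)\<^sup>2 + (norm w)\<^sup>2 + 1))"
    have \<eta>: "\<eta> > 0" unfolding \<eta>_def using \<epsilon> by (intro divide_pos_pos) (auto intro: add_nonneg_pos)
    obtain r where r: "r > 0" "ball e r \<subseteq> S" "\<And>p z. p \<in> ball e r \<Longrightarrow> z \<in> ball e r \<Longrightarrow>
     \<bar>f z - f p - frechet_derivative f (at p) (z - p) - Q (z - p) (z - p) / 2\<bar> \<le> \<eta> * (norm (z - p))\<^sup>2"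
      using smooth_on_taylor_second[OF assms \<eta>] unfolding Q_def by metis
    have "((\<lambda>s. (frechet_derivative f (at (e + s *\<^sub>R v)) w - frechet_derivative f (at e) w) / s) \<longlongrightarrow> Q w v) (at 0)"
    proof -
      have "((\<lambda>s. e + s *\<^sub>R v) has_derivative (\<lambda>s. s *\<^sub>R v)) (at 0)"
        by (auto intro!: derivative_eq_intros)
      moreover have "((\<lambda>y. frechet_derivative f (at y) w) has_derivative Q w) (at (e + 0 *\<^sub>R v))"
        using smooth_on_has_derivative[OF smooth_on_frechet_derivative[OF assms(2), of w] assms(3)]
        unfolding Q_def second_derivative_def by simp
      ultimately have "((\<lambda>s. frechet_derivative f (at (e + s *\<^sub>R v)) w) has_derivative (\<lambda>s. Q w (s *\<^sub>R v))) (at 0)"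
        by (rule has_derivative_compose)
      moreover have "(\<lambda>s. Q w (s *\<^sub>R v)) = (*) (Q w v)"
        by (simp add: fun_eq_iff mult.commute Q_def linear_cmul[OF linear_second_derivative_right[OF assms(2,3)]])
      ultimately have "((\<lambda>s. frechet_derivative f (at (e + s *\<^sub>R v)) w) has_field_derivative Q w v) (at 0)"
        unfolding has_field_derivative_def by simp
      then show ?thesis
        unfolding has_field_derivative_iff by simp
    qed
    then have "((\<lambda>s. (frechet_derivative f (at (e + s *\<^sub>R v)) w - frechet_derivative f (at e) w) / s) \<longlongrightarrow> Q w v) (at_right 0)"
      by (rule filterlim_mono) (auto simp: at_le)
    then have ev1: "\<forall>\<^sub>F s in at_right 0.
        dist ((frechet_derivative f (at (e + s *\<^sub>R v)) w - frechet_derivative f (at e) w) / s) (Q w v) < \<epsilon> / 2"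
      using \<epsilon> tendstoD half_gt_zero by blast
    have ball: "\<forall>\<^sub>F s in at_right 0. e + s *\<^sub>R u \<in> ball e r" for u :: 'a
    proof -
      have "((\<lambda>s. e + s *\<^sub>R u) \<longlongrightarrow> e + 0 *\<^sub>R u) (at_right 0)" by (intro tendsto_intros)
      then show ?thesis
        using r(1) by (intro topological_tendstoD[where S="ball e r"]) auto
    qed
    show "\<forall>\<^sub>F s in at_right 0. dist ((f (e + s *\<^sub>R v + s *\<^sub>R w) - f (e + s *\<^sub>R v) - f (e + s *\<^sub>R w) + f e) / s\<^sup>2) (Q w v) < \<epsilon>"
      using ev1 ball[of v] ball[of w] ball[of "v + w"] eventually_at_right_less[of 0]
    proof eventually_elim
      case (elim s)
      define A where "A = f (e + s *\<^sub>R v + s *\<^sub>R w) - f (e + s *\<^sub>R v)"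
      define B where "B = f (e + s *\<^sub>R w) - f e"
      define a where "a = frechet_derivative f (at (e + s *\<^sub>R v)) w"
      define b where "b = frechet_derivative f (at e) w"
      \<comment> \<open>The same \<open>q\<close> serves both corners because the Hessian is frozen
        at \<open>e\<close>; it drops out of \<open>A - B\<close>.\<close>
      define q where "q = Q (s *\<^sub>R w) (s *\<^sub>R w) / 2"
      have SS: "e + s *\<^sub>R v \<in> S" using elim r by auto
      have "\<bar>A - frechet_derivative f (at (e + s *\<^sub>R v)) (s *\<^sub>R w) - q\<bar> \<le> \<eta> * (norm (s *\<^sub>R w))\<^sup>2"
        using r(3)[of "e + s *\<^sub>R v" "e + s *\<^sub>R v + s *\<^sub>R w"] elim
        by (simp add: A_def q_def algebra_simps)
      then have 1: "\<bar>A - s * a - q\<bar> \<le> \<eta> * (norm w)\<^sup>2 * s\<^sup>2"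
        by (simp add: linear_cmul[OF linear_frechet_derivative[OF smooth_on_differentiable[OF assms(2) SS]]] a_def
            power_mult_distrib mult_ac)
      have "\<bar>B - frechet_derivative f (at e) (s *\<^sub>R w) - q\<bar> \<le> \<eta> * (norm (s *\<^sub>R w))\<^sup>2"
        using r(3)[of e "e + s *\<^sub>R w"] elim r(1)
        by (simp add: B_def q_def algebra_simps)
      then have 2: "\<bar>B - s * b - q\<bar> \<le> \<eta> * (norm w)\<^sup>2 * s\<^sup>2"
        by (simp add: linear_cmul[OF linear_frechet_derivative[OF smooth_on_differentiable[OF assms(2,3)]]] b_def
            power_mult_distrib mult_ac)
      have "\<bar>(A - B) - s * (a - b)\<bar> \<le> 2 * (\<eta> * (norm w)\<^sup>2) * s\<^sup>2"
        using 1 2 by (simp add: algebra_simps abs_le_iff)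
      then have "\<bar>(A - B) - s * (a - b)\<bar> / s\<^sup>2 \<le> 2 * (\<eta> * (norm w)\<^sup>2)"
        using elim by (simp add: divide_le_eq)
      moreover have "(A - B) / s\<^sup>2 - (a - b) / s = ((A - B) - s * (a - b)) / s\<^sup>2"
        using elim by (simp add: field_simps power2_eq_square)
      ultimately have "\<bar>(A - B) / s\<^sup>2 - (a - b) / s\<bar> \<le> 2 * (\<eta> * (norm w)\<^sup>2)"
        using elim by (simp add: abs_divide)
      also have "\<dots> \<le> \<epsilon> / 2"
      proof -
        have "0 < 2 * ((norm w)\<^sup>2 + (norm w)\<^sup>2 + 1)" by (auto intro: add_nonneg_pos)
        then have "\<eta> * (2 * ((norm w)\<^sup>2 + (norm w)\<^sup>2 + 1)) = \<epsilon>"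
          unfolding \<eta>_def by simp
        then show ?thesis using \<eta> by (simp add: algebra_simps)
      qed
      finally have "\<bar>(A - B) / s\<^sup>2 - (a - b) / s\<bar> \<le> \<epsilon> / 2" .
      moreover have "\<bar>(a - b) / s - Q w v\<bar> < \<epsilon> / 2"
        using elim(1) by (simp add: a_def b_def dist_real_def)
      ultimately have "\<bar>(A - B) / s\<^sup>2 - Q w v\<bar> < \<epsilon>"
        by linarith
      then show ?case
        by (simp add: A_def B_def dist_real_def algebra_simps)
    qed
  qed
  have "(\<lambda>s. (f (e + s *\<^sub>R v + s *\<^sub>R w) - f (e + s *\<^sub>R v) - f (e + s *\<^sub>R w) + f e) / s\<^sup>2)
     = (\<lambda>s. (f (e + s *\<^sub>R w + s *\<^sub>R v) - f (e + s *\<^sub>R w) - f (e + s *\<^sub>R v) + f e) / s\<^sup>2)"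
    by (simp add: add_ac diff_diff_eq)
  then have "Q w v = Q v w"
    using main[of v w] main[of w v] by (intro tendsto_unique[of "at_right (0::real)"]) auto
  then show ?thesis by (simp add: Q_def)
qed

subsection \<open>Bounded holomorphic functions without limits\<close>

lemma holomorphic2_on_const: "holomorphic2_on (\<lambda>_. c) S"
  unfolding holomorphic2_on_def by (auto intro!: exI[of _ 0] derivative_eq_intros)

lemma holomorphic2_on_add:
  assumes "holomorphic2_on f S" "holomorphic2_on g S"
  shows "holomorphic2_on (\<lambda>z. f z + g z) S"
  unfolding holomorphic2_on_def
proof
  fix z assume "z \<in> S"
  then obtain a b c d where
    "(f has_derivative (\<lambda>v. a * fst v + b * snd v)) (at z)"
    "(g has_derivative (\<lambda>v. c * fst v + d * snd v)) (at z)"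
    using assms unfolding holomorphic2_on_def by blast
  from has_derivative_add[OF this]
  have "((\<lambda>z. f z + g z) has_derivative (\<lambda>v. (a + c) * fst v + (b + d) * snd v)) (at z)"
    by (simp add: algebra_simps)
  then show "\<exists>a b. ((\<lambda>z. f z + g z) has_derivative (\<lambda>v. a * fst v + b * snd v)) (at z)"
    by blast
qed

lemma holomorphic2_on_mult:
  assumes "holomorphic2_on f S" "holomorphic2_on g S"
  shows "holomorphic2_on (\<lambda>z. f z * g z) S"
  unfolding holomorphic2_on_def
proof
  fix z assume "z \<in> S"
  then obtain a b c d where
    "(f has_derivative (\<lambda>v. a * fst v + b * snd v)) (at z)"
    "(g has_derivative (\<lambda>v. c * fst v + d * snd v)) (at z)"
    using assms unfolding holomorphic2_on_def by blast
  from has_derivative_mult[OF this]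
  have "((\<lambda>z. f z * g z) has_derivative
      (\<lambda>v. (f z * c + a * g z) * fst v + (f z * d + b * g z) * snd v)) (at z)"
    by (simp add: algebra_simps)
  then show "\<exists>a b. ((\<lambda>z. f z * g z) has_derivative (\<lambda>v. a * fst v + b * snd v)) (at z)"
    by blast
qed

lemma holomorphic2_on_sum:
  "finite I \<Longrightarrow> (\<And>i. i \<in> I \<Longrightarrow> holomorphic2_on (f i) S) \<Longrightarrow> holomorphic2_on (\<lambda>z. \<Sum>i\<in>I. f i z) S"
  by (induction rule: finite_induct) (auto intro: holomorphic2_on_add holomorphic2_on_const)

lemma holomorphic2_on_compose:
  assumes "holomorphic2_on f S" "\<phi> holomorphic_on T" "open T" "\<And>z. z \<in> S \<Longrightarrow> f z \<in> T"
  shows "holomorphic2_on (\<lambda>z. \<phi> (f z)) S"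
  unfolding holomorphic2_on_def
proof
  fix z assume z: "z \<in> S"
  obtain a b where f: "(f has_derivative (\<lambda>v. a * fst v + b * snd v)) (at z)"
    using assms(1) z unfolding holomorphic2_on_def by blast
  have "(\<phi> has_derivative (*) (deriv \<phi> (f z))) (at (f z))"
    using holomorphic_derivI[OF assms(2,3) assms(4)[OF z]] by (simp add: has_field_derivative_def)
  from has_derivative_compose[OF f this]
  have "((\<lambda>z. \<phi> (f z)) has_derivative
      (\<lambda>v. (deriv \<phi> (f z) * a) * fst v + (deriv \<phi> (f z) * b) * snd v)) (at z)"
    by (simp add: algebra_simps)
  then show "\<exists>a b. ((\<lambda>z. \<phi> (f z)) has_derivative (\<lambda>v. a * fst v + b * snd v)) (at z)"
    by blast
qed

text \<open>On the complex line through \<open>x\<close> in the direction \<open>e\<close> this is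
  the one-variable Cauchy inequality.\<close>

lemma cauchy_estimate_slice:
  fixes f :: "c2 \<Rightarrow> complex"
  assumes "r > 0" "cball x r \<subseteq> S" "norm e \<le> 1"
    and hol: "\<And>z. z \<in> S \<Longrightarrow> (f has_derivative (\<lambda>v. a z * fst v + b z * snd v)) (at z)"
    and bound: "\<And>z. z \<in> cball x r \<Longrightarrow> norm (f z) \<le> B"
  shows "norm (a x * fst e + b x * snd e) \<le> B / r"
proof -
  define L where "L = (\<lambda>w::complex. x + (w * fst e, w * snd e))"
  define \<phi> where "\<phi> w = f (L w)" for w
  have norm_L: "dist x (L w) \<le> norm w" for w
  proof -
    have "dist x (L w) = norm w * norm e"
      by (simp add: L_def dist_norm norm_Pair norm_mult power_mult_distrib norm_prod_def real_sqrt_mult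
          flip: distrib_left)
    then show ?thesis
      using assms(3) mult_left_mono[of "norm e" 1 "norm w"] by simp
  qed
  have D: "(\<phi> has_field_derivative (a (L w) * fst e + b (L w) * snd e)) (at w)" if "w \<in> cball 0 r" for w
  proof -
    have "L w \<in> S"
      using norm_L[of w] that assms(2) by (auto simp: subset_eq)
    moreover have "(L has_derivative (\<lambda>w. (w * fst e, w * snd e))) (at w)"
      unfolding L_def by (auto intro!: derivative_eq_intros)
    ultimately have "(\<phi> has_derivative (\<lambda>u. a (L w) * fst (u * fst e, u * snd e) + b (L w) * snd (u * fst e, u * snd e))) (at w)"
      unfolding \<phi>_def using has_derivative_compose[OF _ hol, of L] by blast
    moreover have "(\<lambda>u. a (L w) * fst (u * fst e, u * snd e) + b (L w) * snd (u * fst e, u * snd e))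
      = (*) (a (L w) * fst e + b (L w) * snd e)"
      by (simp add: fun_eq_iff algebra_simps)
    ultimately show ?thesis
      by (simp add: has_field_derivative_def)
  qed
  have "norm ((deriv ^^ 1) \<phi> 0) \<le> fact 1 * B / r ^ 1"
  proof (rule Cauchy_inequality)
    show "\<phi> holomorphic_on ball 0 r"
      unfolding holomorphic_on_def field_differentiable_def
      using D has_field_derivative_at_within by (meson ball_subset_cball subsetD)
    show "continuous_on (cball 0 r) \<phi>"
      using D DERIV_isCont by (intro continuous_at_imp_continuous_on) blast
    show "norm (\<phi> w) \<le> B" if "norm (0 - w) = r" for w
      using bound[of "L w"] norm_L[of w] that by (simp add: \<phi>_def)
  qed (use assms in auto)
  moreover have "deriv \<phi> 0 = a x * fst e + b x * snd e"
    using DERIV_imp_deriv[OF D[of 0]] assms(1) by (simp add: L_def flip: zero_prod_def)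
  ultimately show ?thesis by simp
qed

text \<open>Cauchy estimates on balls of half the radius turn uniform convergence of the functions
  into uniform convergence of the coefficients of their derivatives. Termwise differentiation then
  gives the limit a complex linear derivative.\<close>

lemma holomorphic2_on_uniform_limit:
  assumes "\<And>n. holomorphic2_on (f n) S"
    and lim: "\<And>z. z \<in> S \<Longrightarrow> \<exists>r>0. cball z r \<subseteq> S \<and> uniform_limit (cball z r) f g sequentially"
  shows "holomorphic2_on g S"
  unfolding holomorphic2_on_def
proof
  fix z assume "z \<in> S"
  then obtain r where r: "r > 0" "cball z r \<subseteq> S" "uniform_limit (cball z r) f g sequentially"
    using lim by blast
  obtain a b where ab: "\<And>n z. z \<in> S \<Longrightarrow> (f n has_derivative (\<lambda>v. a n z * fst v + b n z * snd v)) (at z)"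
    using assms(1) unfolding holomorphic2_on_def by metis
  define T where "T = ball z (r / 2)"
  have cb: "cball x (r / 2) \<subseteq> cball z r" if "x \<in> T" for x
    using that by (simp add: T_def dist_commute cball_subset_cball_iff)
  have cau: "uniformly_Cauchy_on (cball z r) f"
    using r(3) uniformly_convergent_Cauchy unfolding uniformly_convergent_on_def by blast
  have C: "uniformly_Cauchy_on T (\<lambda>n x. a n x * fst e + b n x * snd e)" if e: "norm e \<le> 1" for e
    unfolding uniformly_Cauchy_on_def
  proof (intro allI impI)
    fix \<epsilon> :: real assume \<epsilon>: "\<epsilon> > 0"
    \<comment> \<open>The Cauchy estimate divides by \<open>r / 2\<close>, so this accuracy for the
      functions yields \<epsilon>/2 for the derivatives.\<close>
    then have "\<epsilon> * r / 4 > 0" using r by simp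
    then obtain N where N: "\<And>x m n. x \<in> cball z r \<Longrightarrow> m \<ge> N \<Longrightarrow> n \<ge> N \<Longrightarrow> dist (f m x) (f n x) < \<epsilon> * r / 4"
      using cau unfolding uniformly_Cauchy_on_def by metis
    have "dist (a m x * fst e + b m x * snd e) (a n x * fst e + b n x * snd e) < \<epsilon>"
      if "x \<in> T" "m \<ge> N" "n \<ge> N" for x m n
    proof -
      have "norm ((a m x - a n x) * fst e + (b m x - b n x) * snd e) \<le> (\<epsilon> * r / 4) / (r / 2)"
      proof (rule cauchy_estimate_slice[where S=S and f="\<lambda>z. f m z - f n z"])
        show "cball x (r / 2) \<subseteq> S" using cb[OF that(1)] r by blast
        show "((\<lambda>z. f m z - f n z) has_derivative (\<lambda>v. (a m y - a n y) * fst v + (b m y - b n y) * snd v)) (at y)"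
          if "y \<in> S" for y
          using has_derivative_diff[OF ab[OF that] ab[OF that], of m n] by (simp add: algebra_simps)
        show "norm (f m y - f n y) \<le> \<epsilon> * r / 4" if "y \<in> cball x (r / 2)" for y
          using N[of y m n] that \<open>m \<ge> N\<close> \<open>n \<ge> N\<close> cb[OF \<open>x \<in> T\<close>] by (force simp: dist_norm)
      qed (use r e in auto)
      also have "\<dots> < \<epsilon>" using r \<epsilon> by simp
      finally show ?thesis by (simp add: dist_norm algebra_simps)
    qed
    then show "\<exists>M. \<forall>x\<in>T. \<forall>m\<ge>M. \<forall>n\<ge>M. dist (a m x * fst e + b m x * snd e) (a n x * fst e + b n x * snd e) < \<epsilon>"
      by blast
  qed
  have "uniformly_convergent_on T a" "uniformly_convergent_on T b"
    using C[of "(1, 0)"] C[of "(0, 1)"]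
    by (auto simp: norm_Pair intro: Cauchy_uniformly_convergent)
  then obtain A B where AB: "uniform_limit T a A sequentially" "uniform_limit T b B sequentially"
    unfolding uniformly_convergent_on_def by blast
  have zT: "z \<in> T" and open_T: "open T" using r by (simp_all add: T_def)
  have "\<exists>h. \<forall>x\<in>T. (\<lambda>n. f n x) \<longlonglongrightarrow> h x \<and> (h has_derivative (\<lambda>v. A x * fst v + B x * snd v)) (at x within T)"
  proof (rule has_derivative_sequence)
    show "convex T" by (simp add: T_def)
    show "(f n has_derivative (\<lambda>v. a n x * fst v + b n x * snd v)) (at x within T)" if "x \<in> T" for n x
    proof -
      have "x \<in> S" using cb[OF that] r that centre_in_cball by (meson divide_nonneg_nonneg less_imp_le subsetD zero_le_numeral)
      then show ?thesis using ab has_derivative_at_withinI by blast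
    qed
    show "\<forall>\<^sub>F n in sequentially. \<forall>x\<in>T. \<forall>h. norm (a n x * fst h + b n x * snd h - (A x * fst h + B x * snd h)) \<le> \<epsilon> * norm h"
      if "\<epsilon> > 0" for \<epsilon>
    proof -
      have "\<forall>\<^sub>F n in sequentially. \<forall>x\<in>T. dist (a n x) (A x) < \<epsilon> / 2"
        "\<forall>\<^sub>F n in sequentially. \<forall>x\<in>T. dist (b n x) (B x) < \<epsilon> / 2"
        using AB that half_gt_zero unfolding uniform_limit_iff by blast+
      then show ?thesis
      proof eventually_elim
        case (elim n)
        show ?case
        proof (intro ballI allI)
          fix x :: c2 and h :: c2
          assume "x \<in> T"
          then have *: "norm (a n x - A x) \<le> \<epsilon> / 2" "norm (b n x - B x) \<le> \<epsilon> / 2"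
            using elim by (auto simp: dist_norm less_imp_le)
          have "norm (a n x * fst h + b n x * snd h - (A x * fst h + B x * snd h))
             = norm ((a n x - A x) * fst h + (b n x - B x) * snd h)"
            by (simp add: algebra_simps)
          also have "\<dots> \<le> norm (a n x - A x) * norm (fst h) + norm (b n x - B x) * norm (snd h)"
            by (metis norm_mult norm_triangle_ineq)
          also have "\<dots> \<le> \<epsilon> / 2 * norm h + \<epsilon> / 2 * norm h"
            using * that norm_fst_le[of "fst h" "snd h"] norm_snd_le[of "snd h" "fst h"]
            by (intro add_mono mult_mono) auto
          finally show "norm (a n x * fst h + b n x * snd h - (A x * fst h + B x * snd h)) \<le> \<epsilon> * norm h"
            by (simp add: algebra_simps)
        qed
      qed
    qed
    show "z \<in> T" by fact
    show "(\<lambda>n. f n z) \<longlonglongrightarrow> g z"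
      using tendsto_uniform_limitI[OF r(3)] r by simp
  qed
  then obtain h where h: "\<And>x. x \<in> T \<Longrightarrow> (\<lambda>n. f n x) \<longlonglongrightarrow> h x"
    "(h has_derivative (\<lambda>v. A z * fst v + B z * snd v)) (at z within T)"
    using zT by blast
  have eq: "h x = g x" if "x \<in> T" for x
  proof -
    have "x \<in> cball z r" using that r by (auto simp: T_def)
    then show ?thesis
      using h(1)[OF that] tendsto_uniform_limitI[OF r(3)] LIMSEQ_unique by blast
  qed
  have "(h has_derivative (\<lambda>v. A z * fst v + B z * snd v)) (at z)"
    using h(2) by (simp only: at_within_open[OF zT open_T])
  from has_derivative_transform_within_open[OF this open_T zT eq]
  have "(g has_derivative (\<lambda>v. A z * fst v + B z * snd v)) (at z)" .
  then show "\<exists>a b. (g has_derivative (\<lambda>v. a * fst v + b * snd v)) (at z)" by blast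
qed

section \<open>Combining infinitely many peak functions\<close>

lemma geometric_increments_bound:
  fixes x :: "nat \<Rightarrow> 'a::real_normed_vector"
  assumes "\<And>n. n \<ge> N \<Longrightarrow> norm (x (Suc n) - x n) \<le> 3 * (1/2) ^ (n + 4)" "N \<le> m" "m \<le> n"
  shows "norm (x n - x m) \<le> 3 * (1/2) ^ (m + 3)"
proof -
  \<comment> \<open>The subtracted term strengthens the claim so that the induction closes.\<close>
  have "norm (x n - x m) \<le> 3 * ((1/2) ^ (m + 3) - (1/2) ^ (n + 3))"
    using assms(3)
  proof (induction n rule: dec_induct)
    case (step n)
    have "norm (x (Suc n) - x m) \<le> norm (x (Suc n) - x n) + norm (x n - x m)"
      using norm_triangle_ineq[of "x (Suc n) - x n" "x n - x m"] by simp
    then show ?case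
      using step assms(1)[of n] assms(2) by (simp add: power_add power_divide)
  qed simp
  then show ?thesis by (rule order_trans) simp
qed

text \<open>The functions \<open>f\<^sub>n\<close> with \<open>f\<^sub>n\<^sub>+\<^sub>1 = f\<^sub>n (1 - g\<^sub>n) + a\<^sub>n g\<^sub>n\<close> stay bounded because \<open>g\<^sub>n\<close> is close to the
  segment from 0 to 1, and \<open>f\<^sub>n\<^sub>+\<^sub>1\<close> is close to \<open>a\<^sub>n\<close> wherever \<open>g\<^sub>n\<close> is close to 1.\<close>

lemma bounded_holomorphic2_without_limits:
  fixes \<Omega> U :: "c2 set" and A :: "c2 \<Rightarrow> c2 set"
  assumes "open \<Omega>" "U \<inter> \<Omega> = {}"
    and peak: "\<And>\<epsilon> K. \<epsilon> > 0 \<Longrightarrow> compact K \<Longrightarrow> K \<subseteq> \<Omega> \<Longrightarrow>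
      \<exists>g Z. holomorphic2_on g \<Omega> \<and> (\<forall>z\<in>\<Omega>. cmod (g z) + cmod (1 - g z) \<le> 1 + \<epsilon>) \<and>
        (\<forall>z\<in>K. cmod (g z) \<le> \<epsilon>) \<and> finite Z \<and> Z \<subseteq> \<Omega> \<and> (\<forall>z\<in>Z. cmod (g z - 1) \<le> \<epsilon>) \<and>
        (\<forall>\<zeta>\<in>U. \<exists>z\<in>Z \<inter> A \<zeta>. dist z \<zeta> < \<epsilon>)"
  shows "\<exists>f. holomorphic2_on f \<Omega> \<and> bounded (f ` \<Omega>) \<and> (\<forall>\<zeta>\<in>U. \<not> (\<exists>l. (f \<longlongrightarrow> l) (at \<zeta> within A \<zeta>)))"
proof -
  obtain C :: "nat \<Rightarrow> c2 set" where C: "\<And>n. compact (C n)" "\<And>n. C n \<subseteq> \<Omega>"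
    "\<And>K. compact K \<Longrightarrow> K \<subseteq> \<Omega> \<Longrightarrow> \<exists>N. \<forall>n\<ge>N. K \<subseteq> C n"
    using open_Union_compact_subsets[OF assms(1)] by metis
  \<comment> \<open>Small enough that \<open>2 * \<epsilon> n \<le> (1/2) ^ Suc n\<close>, which is
    the room left by the bound \<open>2 - (1/2) ^ n\<close> on \<open>f n\<close>.\<close>
  define \<epsilon> :: "nat \<Rightarrow> real" where "\<epsilon> n = (1/2) ^ (n + 4)" for n
  have \<epsilon>: "\<epsilon> n > 0" for n by (simp add: \<epsilon>_def)
  define good where "good n K g Z \<longleftrightarrow> holomorphic2_on g \<Omega> \<and> (\<forall>z\<in>\<Omega>. cmod (g z) + cmod (1 - g z) \<le> 1 + \<epsilon> n) \<and>
        (\<forall>z\<in>K. cmod (g z) \<le> \<epsilon> n) \<and> finite Z \<and> Z \<subseteq> \<Omega> \<and> (\<forall>z\<in>Z. cmod (g z - 1) \<le> \<epsilon> n) \<and>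
        (\<forall>\<zeta>\<in>U. \<exists>z\<in>Z \<inter> A \<zeta>. dist z \<zeta> < \<epsilon> n)" for n K g Z
  have "\<exists>g Z. good n K g Z" if "compact K" "K \<subseteq> \<Omega>" for n K
    unfolding good_def using peak[OF \<epsilon> that] .
  note good_ex = this
  \<comment> \<open>Choosing for every set at once makes the exhaustion below definable by plain
    recursion, although each stage depends on the peaks already chosen.\<close>
  define G where "G n K = (SOME g. \<exists>Z. good n K g Z)" for n K
  define Z where "Z n K = (SOME Z. good n K (G n K) Z)" for n K
  have GZ: "good n K (G n K) (Z n K)" if "compact K" "K \<subseteq> \<Omega>" for n K
  proof -
    have "\<exists>Z. good n K (G n K) Z"
      unfolding G_def by (rule someI_ex[where P="\<lambda>g. \<exists>Z. good n K g Z", OF good_ex[OF that]])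
    then show ?thesis unfolding Z_def by (rule someI_ex)
  qed
  \<comment> \<open>Each stage swallows the peak points of the previous step. All later
    \<open>g\<close> are then small there, so the value near \<open>a n\<close> that
    \<open>f (Suc n)\<close> takes at those points survives in the limit.\<close>
  define K where "K = rec_nat (C 0) (\<lambda>n K. C (Suc n) \<union> K \<union> Z n K)"
  have K_Suc: "K (Suc n) = C (Suc n) \<union> K n \<union> Z n (K n)" and K_0: "K 0 = C 0" for n
    by (simp_all add: K_def)
  have K: "compact (K n) \<and> K n \<subseteq> \<Omega>" for n
  proof (induction n)
    case (Suc n)
    then show ?case
      using GZ[of "K n" n] C by (auto simp: K_Suc good_def finite_imp_compact intro!: compact_Un)
  qed (use C in \<open>auto simp: K_0\<close>)
  have C_K: "C n \<subseteq> K n" for n by (cases n) (auto simp: K_Suc K_0)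
  have K_mono: "K m \<subseteq> K n" if "m \<le> n" for m n
    using that by (rule lift_Suc_mono_le[rotated]) (auto simp: K_Suc)
  define g where "g n = G n (K n)" for n
  define P where "P n = Z n (K n)" for n
  have hol_g: "holomorphic2_on (g n) \<Omega>"
    and g_seg: "\<And>z. z \<in> \<Omega> \<Longrightarrow> cmod (g n z) + cmod (1 - g n z) \<le> 1 + \<epsilon> n"
    and g_K: "\<And>z. z \<in> K n \<Longrightarrow> cmod (g n z) \<le> \<epsilon> n"
    and P_sub: "P n \<subseteq> \<Omega>"
    and g_P: "\<And>z. z \<in> P n \<Longrightarrow> cmod (g n z - 1) \<le> \<epsilon> n"
    and P_vis: "\<And>\<zeta>. \<zeta> \<in> U \<Longrightarrow> \<exists>z\<in>P n \<inter> A \<zeta>. dist z \<zeta> < \<epsilon> n" for n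
    using GZ[of "K n" n] K unfolding g_def P_def good_def by blast+
  \<comment> \<open>The prescribed values alternate, so that no limit can accommodate both.\<close>
  define a :: "nat \<Rightarrow> complex" where "a n = (if even n then 0 else 1)" for n
  have a: "cmod (a n) \<le> 1" for n by (simp add: a_def)
  define f where "f = rec_nat (\<lambda>z. 0) (\<lambda>n h z. h z * (1 - g n z) + a n * g n z)"
  have f_0: "f 0 = (\<lambda>z. 0)" and f_Suc: "f (Suc n) = (\<lambda>z. f n z * (1 - g n z) + a n * g n z)" for n
    by (simp_all add: f_def)
  have hol_f: "holomorphic2_on (f n) \<Omega>" for n
  proof (induction n)
    case (Suc n)
    have "holomorphic2_on (\<lambda>z. f n z * (1 + (-1) * g n z) + a n * g n z) \<Omega>"
      using Suc hol_g by (intro holomorphic2_on_add holomorphic2_on_mult holomorphic2_on_const) auto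
    then show ?case by (simp add: f_Suc)
  qed (simp add: f_0 holomorphic2_on_const)
  \<comment> \<open>The bound is at least 1 throughout, so it dominates \<open>a n\<close> as well
    as \<open>f n\<close>; the lens condition then multiplies it by at most
    \<open>1 + \<epsilon> n\<close>.\<close>
  have f_bound: "cmod (f n z) \<le> 2 - (1/2) ^ n" if "z \<in> \<Omega>" for n z
  proof (induction n)
    case (Suc n)
    have M: "1 \<le> 2 - (1/2::real) ^ n" by (simp add: power_le_one)
    have "cmod (f (Suc n) z) \<le> cmod (f n z) * cmod (1 - g n z) + cmod (a n) * cmod (g n z)"
      unfolding f_Suc by (metis norm_mult norm_triangle_ineq)
    also have "\<dots> \<le> (2 - (1/2) ^ n) * cmod (1 - g n z) + (2 - (1/2) ^ n) * cmod (g n z)"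
      using Suc a[of n] M by (intro add_mono mult_right_mono) auto
    also have "\<dots> = (2 - (1/2) ^ n) * (cmod (g n z) + cmod (1 - g n z))"
      by (simp add: algebra_simps)
    also have "\<dots> \<le> (2 - (1/2) ^ n) * (1 + \<epsilon> n)"
      using g_seg[OF that] M by (intro mult_left_mono) auto
    also have "\<dots> = 2 - (1/2) ^ n + 2 * \<epsilon> n - (1/2) ^ n * \<epsilon> n"
      by (simp add: algebra_simps)
    also have "\<dots> \<le> 2 - (1/2) ^ n + 2 * \<epsilon> n" using \<epsilon>[of n] by simp
    also have "\<dots> \<le> 2 - (1/2) ^ Suc n"
      by (simp add: \<epsilon>_def power_add power_divide field_simps)
    finally show ?case .
  qed (simp add: f_0)
  have f_le_2: "cmod (f n z) \<le> 2" if "z \<in> \<Omega>" for n z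
    by (rule order_trans[OF f_bound[OF that]]) simp
  have f_incr: "cmod (f (Suc n) z - f n z) \<le> 3 * (1/2) ^ (n + 4)" if "z \<in> K n" for n z
  proof -
    have z: "z \<in> \<Omega>" using that K by blast
    have "f (Suc n) z - f n z = (a n - f n z) * g n z"
      by (simp add: f_Suc algebra_simps)
    then have "cmod (f (Suc n) z - f n z) = cmod (a n - f n z) * cmod (g n z)"
      by (simp add: norm_mult)
    also have "\<dots> \<le> 3 * \<epsilon> n"
      using norm_triangle_ineq4[of "a n" "f n z"] a[of n] f_le_2[OF z, of n] g_K[OF that]
      by (intro mult_mono) auto
    finally show ?thesis by (simp add: \<epsilon>_def)
  qed
  have f_cauchy: "cmod (f n z - f m z) \<le> 3 * (1/2) ^ (m + 3)" if "z \<in> K N" "N \<le> m" "m \<le> n" for z N m n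
    by (rule geometric_increments_bound[OF _ that(2,3)]) (use f_incr K_mono that in blast)
  define F where "F z = lim (\<lambda>n. f n z)" for z
  have conv: "(\<lambda>n. f n z) \<longlonglongrightarrow> F z" if z: "z \<in> K N" for z N
  proof -
    have "Cauchy (\<lambda>n. f n z)"
    proof (rule metric_CauchyI)
      fix e :: real assume "e > 0"
      then obtain M where M: "(1/2) ^ M < e / 3"
        using real_arch_pow_inv[of "e/3" "1/2"] by auto
      have *: "cmod (f n z - f m z) < e" if "max M N \<le> m" "m \<le> n" for m n
      proof -
        have "3 * (1/2::real) ^ (m + 3) \<le> 3 * (1/2) ^ M"
          using that by (intro mult_left_mono power_decreasing) auto
        then show ?thesis using f_cauchy[OF z, of m n] that M by linarith
      qed
      have "dist (f m z) (f n z) < e" if "max M N \<le> m" "max M N \<le> n" for m n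
        using *[of m n] *[of n m] that by (cases "m \<le> n") (auto simp: dist_norm norm_minus_commute)
      then show "\<exists>M. \<forall>m\<ge>M. \<forall>n\<ge>M. dist (f m z) (f n z) < e" by blast
    qed
    then show ?thesis
      unfolding F_def by (simp add: Cauchy_convergent convergent_LIMSEQ_iff flip: convergent_LIMSEQ_iff)
  qed
  have F_near: "cmod (F z - f m z) \<le> 3 * (1/2) ^ (m + 3)" if "z \<in> K N" "N \<le> m" for z N m
  proof (rule tendsto_upperbound)
    show "(\<lambda>n. cmod (f n z - f m z)) \<longlonglongrightarrow> cmod (F z - f m z)"
      using conv[OF that(1)] by (intro tendsto_intros)
    show "\<forall>\<^sub>F n in sequentially. cmod (f n z - f m z) \<le> 3 * (1/2) ^ (m + 3)"
      using f_cauchy[OF that] eventually_sequentially by auto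
  qed simp
  have in_K: "\<exists>N. z \<in> K N" if "z \<in> \<Omega>" for z
    using C(3)[of "{z}"] that C_K by (metis compact_sing empty_subsetI insert_subset order_refl subsetD)
  have "holomorphic2_on F \<Omega>"
  proof (rule holomorphic2_on_uniform_limit[OF hol_f])
    fix z assume "z \<in> \<Omega>"
    then obtain r where r: "r > 0" "cball z r \<subseteq> \<Omega>"
      using assms(1) open_contains_cball by blast
    obtain N where N: "cball z r \<subseteq> K N"
      using C(3)[OF compact_cball r(2)] C_K by blast
    have "uniform_limit (cball z r) f F sequentially"
      unfolding uniform_limit_iff
    proof (intro allI impI)
      fix e :: real assume "e > 0"
      then obtain M where M: "(1/2) ^ M < e / 3"
        using real_arch_pow_inv[of "e/3" "1/2"] by auto
      have "dist (f n x) (F x) < e" if "n \<ge> max M N" "x \<in> cball z r" for n x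
      proof -
        have "3 * (1/2::real) ^ (n + 3) \<le> 3 * (1/2) ^ M"
          using that by (intro mult_left_mono power_decreasing) auto
        moreover have "cmod (F x - f n x) \<le> 3 * (1/2) ^ (n + 3)"
          using that N by (intro F_near[of x N]) auto
        ultimately show ?thesis
          using M unfolding dist_norm norm_minus_commute[of "f n x"] by linarith
      qed
      then show "\<forall>\<^sub>F n in sequentially. \<forall>x\<in>cball z r. dist (f n x) (F x) < e"
        unfolding eventually_sequentially by blast
    qed
    then show "\<exists>r>0. cball z r \<subseteq> \<Omega> \<and> uniform_limit (cball z r) f F sequentially"
      using r by blast
  qed
  moreover have "bounded (F ` \<Omega>)"
    unfolding bounded_iff
  proof (intro exI ballI)
    fix y assume "y \<in> F ` \<Omega>"
    then obtain z where z: "z \<in> \<Omega>" "y = F z" by blast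
    then obtain N where "z \<in> K N" using in_K by blast
    then show "norm y \<le> 2"
      unfolding z(2) using f_le_2[OF z(1)]
      by (intro tendsto_upperbound[OF tendsto_norm[OF conv]]) auto
  qed
  moreover have "\<not> (\<exists>l. (F \<longlongrightarrow> l) (at \<zeta> within A \<zeta>))" if \<zeta>: "\<zeta> \<in> U" for \<zeta>
  proof
    assume "\<exists>l. (F \<longlongrightarrow> l) (at \<zeta> within A \<zeta>)"
    then obtain l where "(F \<longlongrightarrow> l) (at \<zeta> within A \<zeta>)" by blast
    then have "\<forall>\<^sub>F z in at \<zeta> within A \<zeta>. dist (F z) l < 1/16"
      by (rule tendstoD) simp
    then obtain d where d: "d > 0" "\<And>z. z \<in> A \<zeta> \<Longrightarrow> z \<noteq> \<zeta> \<Longrightarrow> dist z \<zeta> < d \<Longrightarrow> dist (F z) l < 1/16"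
      unfolding eventually_at by blast
    obtain N where N: "(1/2) ^ N < d"
      using real_arch_pow_inv[of d "1/2"] d by auto
    \<comment> \<open>The errors are 3/16 for the distance of \<open>f (Suc n) z\<close> from
      \<open>a n\<close>, 3/16 for the distance of \<open>F z\<close> from
      \<open>f (Suc n) z\<close>, and 1/16 for the assumed limit; together they are 7/16.\<close>
    have near: "dist (a n) l < 1/2" if "n \<ge> N" for n
    proof -
      obtain z where z: "z \<in> P n" "z \<in> A \<zeta>" "dist z \<zeta> < \<epsilon> n"
        using P_vis[OF \<zeta>] by blast
      have zO: "z \<in> \<Omega>" using P_sub z by blast
      have "\<epsilon> n \<le> (1/2) ^ N"
        unfolding \<epsilon>_def using that by (intro power_decreasing) auto
      then have 1: "dist (F z) l < 1/16"
        using d(2)[OF z(2)] z zO N \<zeta> assms(2) by fastforce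
      have "z \<in> K (Suc n)" using z by (simp add: K_Suc P_def)
      from F_near[OF this order_refl] have 2: "cmod (F z - f (Suc n) z) \<le> 3 * (1/2) ^ (Suc n + 3)" .
      have "f (Suc n) z - a n = (f n z - a n) * (1 - g n z)"
        by (simp add: f_Suc algebra_simps)
      then have "cmod (f (Suc n) z - a n) = cmod (f n z - a n) * cmod (1 - g n z)"
        by (simp add: norm_mult)
      also have "\<dots> \<le> 3 * \<epsilon> n"
        using norm_triangle_ineq4[of "f n z" "a n"] a[of n] f_le_2[OF zO, of n] g_P[OF z(1)]
        by (intro mult_mono) (auto simp: norm_minus_commute)
      finally have 3: "cmod (f (Suc n) z - a n) \<le> 3 * (1/2) ^ (n + 4)" by (simp add: \<epsilon>_def)
      have 4: "(1/2::real) ^ (n + 4) = (1/2) ^ n / 16" "(1/2::real) ^ (Suc n + 3) = (1/2) ^ n / 16"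
        by (simp_all add: power_add power_divide)
      have 5: "(1/2::real) ^ n \<le> 1" by (simp add: power_le_one)
      have "dist (a n) l \<le> cmod (f (Suc n) z - a n) + cmod (F z - f (Suc n) z) + dist (F z) l"
        using dist_triangle[of "a n" l "F z"] dist_triangle[of "a n" "F z" "f (Suc n) z"]
        by (simp add: dist_norm norm_minus_commute)
      also have "\<dots> < 1/2"
        using 1 2 3 5 unfolding 4 by linarith
      finally show ?thesis .
    qed
    have "dist (0::complex) 1 < 1"
      using near[of "2 * N"] near[of "2 * N + 1"] dist_triangle_half_l[of 0 l 1 1]
      by (auto simp: a_def dist_commute)
    then show False by simp
  qed
  ultimately show ?thesis by blast
qed

text \<open>The hypothesis puts \<open>u\<close> in the sector of half-angle arccos \<open>c\<close>
  around the positive axis. For \<open>w = u / (1 + u)\<close> the conclusion says that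
  \<open>cmod w + cmod (1 - w)\<close> is at most \<open>1 / sqrt c\<close>.\<close>

lemma sector_segment_bound:
  assumes "c > 0" "c \<le> 1" "cmod u * c \<le> Re u"
  shows "(1 + cmod u)\<^sup>2 * c \<le> (cmod (1 + u))\<^sup>2"
proof -
  have "c * (1 + (cmod u)\<^sup>2) \<le> 1 + (cmod u)\<^sup>2"
    using assms by (intro mult_left_le_one_le) auto
  moreover have "(cmod (1 + u))\<^sup>2 = 1 + 2 * Re u + (cmod u)\<^sup>2"
    by (simp only: cmod_power2) (simp add: power2_eq_square algebra_simps)
  moreover have "(1 + cmod u)\<^sup>2 * c = c * (1 + (cmod u)\<^sup>2) + 2 * (cmod u * c)"
    by (simp add: power2_eq_square algebra_simps)
  ultimately show ?thesis
    using assms(3) by linarith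
qed

text \<open>A branch of \<open>w\<^sup>\<kappa>\<close> maps the right half-plane into a thin sector, which \<open>u \<mapsto> u / (1 + u)\<close>
  maps to a thin lens around the segment from 0 to 1.\<close>

lemma disc_to_lens:
  assumes "\<epsilon> > 0"
  shows "\<exists>\<epsilon>'>0. \<exists>\<phi>. \<phi> holomorphic_on ball 0 1 \<and>
    (\<forall>w\<in>ball 0 1. cmod (\<phi> w) + cmod (1 - \<phi> w) \<le> 1 + \<epsilon>) \<and>
    (\<forall>w\<in>ball 0 1. cmod w \<le> \<epsilon>' \<longrightarrow> cmod (\<phi> w) \<le> \<epsilon>) \<and>
    (\<forall>w\<in>ball 0 1. cmod (w - 1) \<le> \<epsilon>' \<longrightarrow> cmod (\<phi> w - 1) \<le> \<epsilon>)"
proof -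
  \<comment> \<open>The power \<open>\<kappa>\<close> maps the half-plane into the sector of
    half-angle \<open>\<kappa> * (pi / 2)\<close>, so its cosine has to exceed this number.\<close>
  have e1: "1 / (1 + \<epsilon>)\<^sup>2 < 1"
    using assms by (simp add: divide_less_eq_1 power2_eq_square algebra_simps add_pos_pos)
  have "((\<lambda>\<kappa>. cos (\<kappa> * (pi / 2))) \<longlongrightarrow> cos (0 * (pi / 2))) (at_right 0)"
    by (intro tendsto_intros)
  then have "\<forall>\<^sub>F \<kappa> in at_right 0. 1 / (1 + \<epsilon>)\<^sup>2 < cos (\<kappa> * (pi / 2))"
    using e1 by (intro order_tendstoD(1)) simp
  moreover have "\<forall>\<^sub>F \<kappa>::real in at_right 0. \<kappa> < 1"
    using eventually_at_right_real[of 0 1] by (auto elim: eventually_mono)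
  ultimately have "\<forall>\<^sub>F \<kappa> in at_right 0. 1 / (1 + \<epsilon>)\<^sup>2 < cos (\<kappa> * (pi / 2)) \<and> \<kappa> < 1 \<and> 0 < \<kappa>"
    using eventually_at_right_less by eventually_elim auto
  then obtain \<kappa> :: real where \<kappa>: "0 < \<kappa>" "\<kappa> < 1" "1 / (1 + \<epsilon>)\<^sup>2 < cos (\<kappa> * (pi / 2))"
    using eventually_happens'[OF trivial_limit_at_right_real] by blast
  define c where "c = cos (\<kappa> * (pi / 2))"
  have c: "0 < c" "c \<le> 1" "1 / (1 + \<epsilon>)\<^sup>2 < c"
    using \<kappa>(3) assms unfolding c_def by (auto intro: order_trans less_trans[of 0 "1 / (1 + \<epsilon>)\<^sup>2"])
  \<comment> \<open>Chosen with \<open>q / (1 - q) = \<epsilon>\<close>, the resulting bound for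
    \<open>u / (1 + u)\<close> when \<open>cmod u \<le> q\<close>.\<close>
  define q where "q = \<epsilon> / (1 + \<epsilon>)"
  have q: "0 < q" "q < 1" using assms by (auto simp: q_def)
  \<comment> \<open>Near \<open>w = 0\<close> the transform \<open>W\<close> below has modulus at
    most \<open>3 * \<eta>\<close>, whose power is exactly \<open>q\<close>.\<close>
  define \<eta> where "\<eta> = q powr (1 / \<kappa>) / 3"
  have \<eta>: "\<eta> > 0" "(3 * \<eta>) powr \<kappa> = q"
    using q \<kappa> by (auto simp: \<eta>_def powr_powr)
  \<comment> \<open>For \<open>w\<close> within \<open>b\<close> of 1, the modulus of
    \<open>W w\<close> is at least \<open>\<eta> / b\<close>. Its power
    \<open>1 + 1 / \<epsilon>\<close> makes \<open>cmod (1 + u w)\<close> at least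
    \<open>1 / \<epsilon>\<close>.\<close>
  define b where "b = \<eta> / (1 + 1 / \<epsilon>) powr (1 / \<kappa>)"
  have "1 + 1 / \<epsilon> > 0" using assms by (simp add: add_pos_pos)
  then have b: "b > 0" "(\<eta> / b) powr \<kappa> = 1 + 1 / \<epsilon>"
    using \<eta> \<kappa> assms by (auto simp: b_def powr_powr)
  define \<epsilon>' where "\<epsilon>' = min (1/2) b"
  \<comment> \<open>The Cayley transform onto the right half-plane, scaled so that 0 goes to the
    small number \<eta> while 1 still goes to infinity.\<close>
  define W where "W w = of_real \<eta> * (1 + w) / (1 - w)" for w :: complex
  define u where "u w = W w powr of_real \<kappa>" for w
  define \<phi> where "\<phi> w = u w / (1 + u w)" for w
  have ReW: "Re (W w) > 0" if w: "w \<in> ball 0 1" for w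
  proof -
    have "w \<noteq> 1" using w by auto
    then have "W w = of_real (\<eta> / (cmod (1 - w))\<^sup>2) * ((1 + w) * cnj (1 - w))"
    proof -
      have *: "a * c / b = a / (b * d) * (c * d)" if "b \<noteq> 0" "d \<noteq> 0" for a b c d :: complex
        using that by simp
      have "cnj (1 - w) \<noteq> 0" "1 - w \<noteq> 0"
        using \<open>w \<noteq> 1\<close> by (simp_all only: complex_cnj_zero_iff) auto
      then show ?thesis
        unfolding W_def of_real_divide complex_norm_square by (intro *)
    qed
    moreover have "Re ((1 + w) * cnj (1 - w)) = 1 - (cmod w)\<^sup>2"
      by (simp only: cmod_power2) (simp add: power2_eq_square algebra_simps)
    moreover have "(cmod w)\<^sup>2 < 1" using w by (simp add: power_less_one_iff)
    ultimately show ?thesis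
      using \<eta> \<open>w \<noteq> 1\<close> by (simp add: Re_divide_of_real)
  qed
  have norm_u: "cmod (u w) = cmod (W w) powr \<kappa>" for w
    unfolding u_def by (simp add: norm_powr_real_powr')
  have Re_u: "cmod (u w) * c \<le> Re (u w)" if w: "w \<in> ball 0 1" for w
  proof -
    have W0: "W w \<noteq> 0" using ReW[OF w] by auto
    have "\<bar>Im (Ln (W w))\<bar> < pi / 2"
      using ReW[OF w] Re_Ln_pos_lt[OF W0] by simp
    then have "\<bar>\<kappa> * Im (Ln (W w))\<bar> \<le> \<kappa> * (pi / 2)"
      using \<kappa> by (simp add: abs_mult)
    moreover have "\<kappa> * (pi / 2) \<le> pi" using \<kappa> mult_mono[of \<kappa> 1 "pi/2" pi] by simp
    ultimately have "c \<le> cos (\<bar>\<kappa> * Im (Ln (W w))\<bar>)"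
      unfolding c_def by (intro cos_monotone_0_pi_le) auto
    also have "\<dots> = cos (\<kappa> * Im (Ln (W w)))" by simp
    finally have "cmod (u w) * c \<le> cmod (u w) * cos (\<kappa> * Im (Ln (W w)))"
      by (rule mult_left_mono) simp
    also have "\<dots> = Re (u w)"
      unfolding u_def powr_def using W0 by (simp add: Re_exp)
    finally show ?thesis .
  qed
  have lens: "1 + cmod (u w) \<le> (1 + \<epsilon>) * cmod (1 + u w)" if w: "w \<in> ball 0 1" for w
  proof (rule power2_le_imp_le)
    have "(1 + cmod (u w))\<^sup>2 * (1 / (1 + \<epsilon>)\<^sup>2) \<le> (1 + cmod (u w))\<^sup>2 * c"
      using c by (intro mult_left_mono) auto
    also have "\<dots> \<le> (cmod (1 + u w))\<^sup>2"
      using sector_segment_bound[OF c(1,2) Re_u[OF w]] .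
    finally show "(1 + cmod (u w))\<^sup>2 \<le> ((1 + \<epsilon>) * cmod (1 + u w))\<^sup>2"
      using assms by (simp add: power_mult_distrib divide_le_eq mult.commute)
  qed (use assms in simp)
  have pos: "cmod (1 + u w) > 0" if w: "w \<in> ball 0 1" for w
  proof -
    have "0 < 1 + cmod (u w)" by (simp add: add_pos_nonneg)
    then have "0 < (1 + \<epsilon>) * cmod (1 + u w)" using lens[OF w] by linarith
    then show ?thesis using assms by (simp add: zero_less_mult_iff)
  qed
  have "\<phi> holomorphic_on ball 0 1"
  proof -
    have "W holomorphic_on ball 0 1"
      unfolding W_def[abs_def] by (intro holomorphic_intros) auto
    then have "u holomorphic_on ball 0 1"
      unfolding u_def[abs_def] using ReW
      by (intro holomorphic_on_powr_right holomorphic_on_powr holomorphic_intros)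
        (force simp: complex_nonpos_Reals_iff)+
    then show ?thesis
      unfolding \<phi>_def[abs_def] using pos by (intro holomorphic_intros) auto
  qed
  moreover have "cmod (\<phi> w) + cmod (1 - \<phi> w) \<le> 1 + \<epsilon>" if w: "w \<in> ball 0 1" for w
  proof -
    have n0: "1 + u w \<noteq> 0" using pos[OF w] by auto
    have "1 - \<phi> w = 1 / (1 + u w)" using n0 by (simp add: \<phi>_def field_simps)
    then have "cmod (\<phi> w) + cmod (1 - \<phi> w) = (1 + cmod (u w)) / cmod (1 + u w)"
      by (simp add: \<phi>_def norm_divide add_divide_distrib)
    then show ?thesis using lens[OF w] pos[OF w] by (simp add: divide_le_eq)
  qed
  moreover have "cmod (\<phi> w) \<le> \<epsilon>" if w: "w \<in> ball 0 1" "cmod w \<le> \<epsilon>'" for w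
  proof -
    have w2: "cmod w \<le> 1/2" using w by (simp add: \<epsilon>'_def)
    have 1: "cmod (1 + w) \<le> 3/2" using norm_triangle_ineq[of 1 w] w2 by simp
    have 2: "cmod (1 - w) \<ge> 1/2" using norm_triangle_ineq2[of 1 w] w2 by simp
    have "cmod (W w) = \<eta> * cmod (1 + w) / cmod (1 - w)"
      using \<eta> by (simp add: W_def norm_mult norm_divide)
    also have "\<dots> \<le> \<eta> * (3/2) / (1/2)"
      using 1 2 \<eta> by (intro frac_le mult_left_mono) auto
    finally have "cmod (W w) \<le> 3 * \<eta>" by simp
    then have uq: "cmod (u w) \<le> q"
      unfolding norm_u \<eta>(2)[symmetric] using \<kappa> by (intro powr_mono2) auto
    have 3: "cmod (1 + u w) \<ge> 1 - q"
      using norm_triangle_ineq2[of 1 "- u w"] uq by simp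
    have "cmod (\<phi> w) = cmod (u w) / cmod (1 + u w)" by (simp add: \<phi>_def norm_divide)
    also have "\<dots> \<le> q / (1 - q)" using uq 3 q by (intro frac_le) auto
    also have "\<dots> = \<epsilon>" using assms by (simp add: q_def field_simps)
    finally show ?thesis .
  qed
  moreover have "cmod (\<phi> w - 1) \<le> \<epsilon>" if w: "w \<in> ball 0 1" "cmod (w - 1) \<le> \<epsilon>'" for w
  proof -
    have w2: "cmod (1 - w) \<le> 1/2" "cmod (1 - w) \<le> b" using w by (auto simp: \<epsilon>'_def norm_minus_commute)
    have "w \<noteq> 1" using w by auto
    have "1 + w = 2 - (1 - w)" by simp
    then have 1: "cmod (1 + w) \<ge> 1" using norm_triangle_ineq2[of 2 "1 - w"] w2 by simp
    have "\<eta> / b \<le> \<eta> * cmod (1 + w) / cmod (1 - w)"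
      using 1 w2 \<eta> \<open>w \<noteq> 1\<close> by (intro frac_le) auto
    also have "\<dots> = cmod (W w)"
      using \<eta> by (simp add: W_def norm_mult norm_divide)
    finally have "cmod (u w) \<ge> 1 + 1 / \<epsilon>"
      unfolding norm_u b(2)[symmetric] using \<kappa> \<eta> b by (intro powr_mono2) auto
    then have 2: "cmod (1 + u w) \<ge> 1 / \<epsilon>"
      using norm_triangle_ineq2[of "u w" "-1"] by (simp add: add.commute)
    have n0: "1 + u w \<noteq> 0" using pos[OF w(1)] by auto
    have "\<phi> w - 1 = - 1 / (1 + u w)" using n0 by (simp add: \<phi>_def field_simps)
    then have "cmod (\<phi> w - 1) = 1 / cmod (1 + u w)" by (simp add: norm_divide)
    also have "\<dots> \<le> 1 / (1 / \<epsilon>)" using 2 assms by (intro frac_le) auto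
    finally show ?thesis by simp
  qed
  moreover have "\<epsilon>' > 0" using b by (simp add: \<epsilon>'_def)
  ultimately show ?thesis by blast
qed

text \<open>Composition with the map of \<open>disc_to_lens\<close> replaces the lens condition on
  the peak functions by the mere bound \<open>cmod (G z) < 1\<close>.\<close>

lemma bounded_holomorphic2_without_limits_disc:
  fixes \<Omega> U :: "c2 set" and A :: "c2 \<Rightarrow> c2 set"
  assumes "open \<Omega>" "U \<inter> \<Omega> = {}"
    and peak: "\<And>\<epsilon> K. \<epsilon> > 0 \<Longrightarrow> compact K \<Longrightarrow> K \<subseteq> \<Omega> \<Longrightarrow>
      \<exists>G Z. holomorphic2_on G \<Omega> \<and> (\<forall>z\<in>\<Omega>. cmod (G z) < 1) \<and>
        (\<forall>z\<in>K. cmod (G z) \<le> \<epsilon>) \<and> finite Z \<and> Z \<subseteq> \<Omega> \<and> (\<forall>z\<in>Z. cmod (G z - 1) \<le> \<epsilon>) \<and>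
        (\<forall>\<zeta>\<in>U. \<exists>z\<in>Z \<inter> A \<zeta>. dist z \<zeta> < \<epsilon>)"
  shows "\<exists>f. holomorphic2_on f \<Omega> \<and> bounded (f ` \<Omega>) \<and> (\<forall>\<zeta>\<in>U. \<not> (\<exists>l. (f \<longlongrightarrow> l) (at \<zeta> within A \<zeta>)))"
proof (rule bounded_holomorphic2_without_limits[OF assms(1,2)])
  fix \<epsilon> :: real and K :: "c2 set" assume K: "\<epsilon> > 0" "compact K" "K \<subseteq> \<Omega>"
  obtain \<epsilon>' \<phi> where \<phi>: "\<epsilon>' > 0" "\<phi> holomorphic_on ball 0 1"
    "\<And>w. w \<in> ball 0 1 \<Longrightarrow> cmod (\<phi> w) + cmod (1 - \<phi> w) \<le> 1 + \<epsilon>"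
    "\<And>w. w \<in> ball 0 1 \<Longrightarrow> cmod w \<le> \<epsilon>' \<Longrightarrow> cmod (\<phi> w) \<le> \<epsilon>"
    "\<And>w. w \<in> ball 0 1 \<Longrightarrow> cmod (w - 1) \<le> \<epsilon>' \<Longrightarrow> cmod (\<phi> w - 1) \<le> \<epsilon>"
    using disc_to_lens[OF K(1)] by blast
  have "min \<epsilon> \<epsilon>' > 0" using K \<phi> by simp
  from peak[OF this K(2,3)] obtain G Z where G: "holomorphic2_on G \<Omega>" "\<And>z. z \<in> \<Omega> \<Longrightarrow> cmod (G z) < 1"
    "\<And>z. z \<in> K \<Longrightarrow> cmod (G z) \<le> min \<epsilon> \<epsilon>'" "finite Z" "Z \<subseteq> \<Omega>"
    "\<And>z. z \<in> Z \<Longrightarrow> cmod (G z - 1) \<le> min \<epsilon> \<epsilon>'"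
    "\<And>\<zeta>. \<zeta> \<in> U \<Longrightarrow> \<exists>z\<in>Z \<inter> A \<zeta>. dist z \<zeta> < min \<epsilon> \<epsilon>'"
    by metis
  have ball: "G z \<in> ball 0 1" if "z \<in> \<Omega>" for z using G(2)[OF that] by simp
  show "\<exists>g Z. holomorphic2_on g \<Omega> \<and> (\<forall>z\<in>\<Omega>. cmod (g z) + cmod (1 - g z) \<le> 1 + \<epsilon>) \<and>
        (\<forall>z\<in>K. cmod (g z) \<le> \<epsilon>) \<and> finite Z \<and> Z \<subseteq> \<Omega> \<and> (\<forall>z\<in>Z. cmod (g z - 1) \<le> \<epsilon>) \<and>
        (\<forall>\<zeta>\<in>U. \<exists>z\<in>Z \<inter> A \<zeta>. dist z \<zeta> < \<epsilon>)"
  proof (intro exI[of _ "\<lambda>z. \<phi> (G z)"] exI[of _ Z] conjI ballI)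
    show "holomorphic2_on (\<lambda>z. \<phi> (G z)) \<Omega>"
      using ball by (intro holomorphic2_on_compose[OF G(1) \<phi>(2)]) auto
    show "cmod (\<phi> (G z)) + cmod (1 - \<phi> (G z)) \<le> 1 + \<epsilon>" if "z \<in> \<Omega>" for z
      using \<phi>(3)[OF ball[OF that]] .
    show "cmod (\<phi> (G z)) \<le> \<epsilon>" if "z \<in> K" for z
    proof -
      have "z \<in> \<Omega>" using that K by blast
      then show ?thesis using \<phi>(4)[OF ball] G(3)[OF that] by simp
    qed
    show "cmod (\<phi> (G z) - 1) \<le> \<epsilon>" if "z \<in> Z" for z
    proof -
      have "z \<in> \<Omega>" using that G(5) by blast
      then show ?thesis using \<phi>(5)[OF ball] G(6)[OF that] by simp
    qed
    show "\<exists>z\<in>Z \<inter> A \<zeta>. dist z \<zeta> < \<epsilon>" if "\<zeta> \<in> U" for \<zeta>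
      using G(7)[OF that] by auto
  qed (use G in auto)
qed

subsection \<open>Peak sums over separated boundary points\<close>

definition herm :: "c2 \<Rightarrow> c2 \<Rightarrow> complex" where
  "herm a b = fst a * cnj (fst b) + snd a * cnj (snd b)"

lemma herm_diff_left: "herm (a - b) c = herm a c - herm b c"
  and herm_diff_right: "herm a (b - c) = herm a b - herm a c"
  and herm_minus_left: "herm (- a) b = - herm a b"
  and herm_scaleR_left: "herm (t *\<^sub>R a) b = of_real t * herm a b"
  by (simp_all add: herm_def algebra_simps scaleR_conv_of_real)

lemma Re_herm: "Re (herm a b) = a \<bullet> b"
  by (simp add: herm_def inner_prod_def inner_complex_def)

lemma herm_self: "herm a a = of_real ((norm a)\<^sup>2)"
  by (simp add: herm_def norm_prod_def complex_norm_square real_sqrt_pow2 add_nonneg_nonneg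
      flip: complex_norm_square)

lemma norm_herm_le: "cmod (herm a b) \<le> norm a * norm b"
proof -
  have "cmod (herm a b) \<le> cmod (fst a) * cmod (fst b) + cmod (snd a) * cmod (snd b)"
    unfolding herm_def by (rule order_trans[OF norm_triangle_ineq]) (simp add: norm_mult)
  also have "\<dots> = (cmod (fst a), cmod (snd a)) \<bullet> (cmod (fst b), cmod (snd b))"
    by (simp add: inner_prod_def)
  also have "\<dots> \<le> norm (cmod (fst a), cmod (snd a)) * norm (cmod (fst b), cmod (snd b))"
    by (rule norm_cauchy_schwarz)
  also have "\<dots> = norm a * norm b" by (simp add: norm_prod_def)
  finally show ?thesis .
qed

text \<open>Volume comparison: the disjoint balls of radius \<delta> around the points all lie in
  the ball of radius \<open>R + \<delta>\<close> around \<open>x\<close>.\<close>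

lemma packing_bound:
  fixes f :: "'i \<Rightarrow> 'a::euclidean_space"
  assumes "finite A" "\<delta> > 0" "R \<ge> 0"
    and sep: "\<And>i j. i \<in> A \<Longrightarrow> j \<in> A \<Longrightarrow> i \<noteq> j \<Longrightarrow> 2 * \<delta> \<le> dist (f i) (f j)"
    and sub: "\<And>i. i \<in> A \<Longrightarrow> dist x (f i) \<le> R"
  shows "real (card A) * \<delta> ^ DIM('a) \<le> (R + \<delta>) ^ DIM('a)"
proof -
  define v where "v = measure lborel (ball (0::'a) 1)"
  have v: "v > 0" unfolding v_def by (rule content_ball_pos) simp
  have disj: "disjoint_family_on (\<lambda>i. ball (f i) \<delta>) A"
    unfolding disjoint_family_on_def
  proof (intro ballI impI)
    fix i j assume "i \<in> A" "j \<in> A" "i \<noteq> j"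
    then show "ball (f i) \<delta> \<inter> ball (f j) \<delta> = {}"
      using sep[of i j] by (intro disjoint_ballI) simp
  qed
  have "real (card A) * (\<delta> ^ DIM('a) * v) = (\<Sum>i\<in>A. measure lborel (ball (f i) \<delta>))"
    using assms(2) by (simp add: content_ball_conv_unit_ball[of \<delta>] v_def)
  also have "\<dots> = measure lborel (\<Union>i\<in>A. ball (f i) \<delta>)"
    using assms(1) disj emeasure_lborel_ball_finite
    by (intro measure_finite_Union[symmetric]) (auto simp: top.not_eq_extremum)
  also have "\<dots> \<le> measure lborel (ball x (R + \<delta>))"
  proof (rule measure_mono_fmeasurable)
    show "(\<Union>i\<in>A. ball (f i) \<delta>) \<subseteq> ball x (R + \<delta>)"
    proof safe
      fix i y assume "i \<in> A" "y \<in> ball (f i) \<delta>"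
      then show "y \<in> ball x (R + \<delta>)"
        using sub[of i] dist_triangle[of x y "f i"] by simp
    qed
    show "(\<Union>i\<in>A. ball (f i) \<delta>) \<in> sets lborel" by (simp add: borel_open open_UN)
    show "ball x (R + \<delta>) \<in> fmeasurable lborel"
      using emeasure_lborel_ball_finite by (intro fmeasurableI) auto
  qed
  also have "\<dots> = (R + \<delta>) ^ DIM('a) * v"
    using assms by (simp add: content_ball_conv_unit_ball[of "R + \<delta>"] v_def)
  finally show ?thesis using v by (simp flip: mult.assoc)
qed

lemma dyadic_level:
  fixes y :: real
  assumes "1 \<le> y"
  shows "\<exists>k. 2 ^ k \<le> y \<and> y < 2 ^ Suc k"
proof -
  obtain n where n: "y < 2 ^ n" using real_arch_pow[of 2 y] by auto
  define k where "k = (LEAST n. y < 2 ^ n)"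
  have k: "y < 2 ^ k" unfolding k_def by (rule LeastI[of _ n]) (fact n)
  then obtain m where m: "k = Suc m" using assms by (cases k) auto
  then have "\<not> y < 2 ^ m" unfolding k_def by (intro not_less_Least) simp
  then show ?thesis using k m by (intro exI[of _ m]) auto
qed

lemma sum_half_powers_le:
  assumes "finite (A :: nat set)"
  shows "(\<Sum>k\<in>A. (1/2::real) ^ k) \<le> 2"
proof -
  have "(\<Sum>k\<in>A. (1/2::real) ^ k) \<le> (\<Sum>k. (1/2::real) ^ k)"
    using assms by (intro sum_le_suminf summable_geometric) auto
  also have "\<dots> = 2" by (subst suminf_geometric) auto
  finally show ?thesis .
qed

text \<open>\<open>\<bar>l p z\<bar>\<close> plays the role of the nonisotropic distance between \<open>p\<close> and \<open>z\<close>.\<close>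

locale support_family =
  fixes \<Omega> \<Gamma> :: "c2 set" and N :: "c2 \<Rightarrow> c2" and c C :: real
  assumes norm_le_1: "z \<in> \<Omega> \<union> \<Gamma> \<Longrightarrow> norm z \<le> 1"
    and disjoint: "\<Gamma> \<inter> \<Omega> = {}"
    and compact: "compact \<Gamma>"
    and c_pos: "c > 0" and C_pos: "C > 0"
    and convex: "p \<in> \<Gamma> \<Longrightarrow> z \<in> \<Omega> \<union> \<Gamma> \<Longrightarrow> c * (norm (p - z))\<^sup>2 \<le> Re (herm (p - z) (N p))"
    and norm_N: "p \<in> \<Gamma> \<Longrightarrow> norm (N p) \<le> C"
    and lipschitz_N: "p \<in> \<Gamma> \<Longrightarrow> q \<in> \<Gamma> \<Longrightarrow> norm (N p - N q) \<le> C * norm (p - q)"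
begin

text \<open>Complex affine in \<open>z\<close>, since the conjugation falls on \<open>N p\<close>.
  If \<open>N p\<close> is a nonzero normal vector, the zero set is the complex tangent line at
  \<open>p\<close>.\<close>

definition l :: "c2 \<Rightarrow> c2 \<Rightarrow> complex" where "l p z = herm (p - z) (N p)"

definition \<kappa> :: real where "\<kappa> = 1 + 2 * C / c"

lemma \<kappa>_ge_1: "\<kappa> \<ge> 1" using c_pos C_pos by (simp add: \<kappa>_def)

lemma l_self [simp]: "l p p = 0" by (simp add: l_def herm_def)

lemma norm_sq_le_l: "p \<in> \<Gamma> \<Longrightarrow> z \<in> \<Omega> \<union> \<Gamma> \<Longrightarrow> c * (norm (p - z))\<^sup>2 \<le> cmod (l p z)"
  using convex complex_Re_le_cmod order_trans unfolding l_def by blast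

lemma Re_l_pos: "p \<in> \<Gamma> \<Longrightarrow> z \<in> \<Omega> \<Longrightarrow> 0 < Re (l p z)"
proof -
  assume pz: "p \<in> \<Gamma>" "z \<in> \<Omega>"
  then have "p \<noteq> z" using disjoint by blast
  then have "0 < c * (norm (p - z))\<^sup>2" using c_pos by simp
  also have "\<dots> \<le> Re (l p z)" using convex pz by (simp add: l_def)
  finally show ?thesis .
qed

lemma l_le: "p \<in> \<Gamma> \<Longrightarrow> z \<in> \<Omega> \<union> \<Gamma> \<Longrightarrow> cmod (l p z) \<le> 2 * C"
proof -
  assume pz: "p \<in> \<Gamma>" "z \<in> \<Omega> \<union> \<Gamma>"
  have "cmod (l p z) \<le> norm (p - z) * norm (N p)" unfolding l_def by (rule norm_herm_le)
  also have "norm (p - z) \<le> 2"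
    using norm_le_1[of p] norm_le_1[of z] pz norm_triangle_ineq4[of p z] by auto
  then have "norm (p - z) * norm (N p) \<le> 2 * C"
    using norm_N[OF pz(1)] by (intro mult_mono) auto
  finally show ?thesis .
qed

text \<open>The defect of additivity, \<open>herm (q - z) (N p - N q)\<close>, is quadratic in
  Euclidean distances because \<open>N\<close> is Lipschitz. Strict convexity controls squared
  distances by \<open>l\<close>, at the price of a factor \<open>1 / c\<close>.\<close>

lemma quasi_triangle:
  assumes "p \<in> \<Gamma>" "q \<in> \<Gamma>" "z \<in> \<Omega> \<union> \<Gamma>"
  shows "cmod (l p q) \<le> \<kappa> * (cmod (l p z) + cmod (l q z))"
proof -
  let ?a = "norm (p - z)" and ?b = "norm (q - z)"
  have eq: "l p q = l p z - l q z - herm (q - z) (N p - N q)"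
    by (simp add: l_def herm_diff_left herm_diff_right algebra_simps)
  have "cmod (l p q) \<le> cmod (l p z) + cmod (l q z) + cmod (herm (q - z) (N p - N q))"
    unfolding eq using norm_triangle_ineq4[of "l p z - l q z" "herm (q - z) (N p - N q)"]
      norm_triangle_ineq4[of "l p z" "l q z"] by linarith
  also have "cmod (herm (q - z) (N p - N q)) \<le> ?b * (C * (?a + ?b))"
  proof -
    have "norm (p - q) \<le> ?a + ?b" using norm_triangle_ineq4[of "p - z" "q - z"] by simp
    then have "norm (N p - N q) \<le> C * (?a + ?b)"
      using lipschitz_N[OF assms(1,2)] C_pos
      by (meson less_imp_le mult_left_mono order_trans)
    then show ?thesis
      using norm_herm_le[of "q - z" "N p - N q"] by (meson mult_left_mono norm_ge_zero order_trans)
  qed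
  also have "?b * (C * (?a + ?b)) = C * (?b * ?a + ?b\<^sup>2)"
    by (simp add: power2_eq_square algebra_simps)
  also have "\<dots> \<le> C * (2 * (?a\<^sup>2 + ?b\<^sup>2))"
  proof (rule mult_left_mono)
    have "2 * (?b * ?a) \<le> ?b\<^sup>2 + ?a\<^sup>2" using sum_squares_bound[of ?b ?a] by (simp add: mult.assoc)
    then show "?b * ?a + ?b\<^sup>2 \<le> 2 * (?a\<^sup>2 + ?b\<^sup>2)"
      using zero_le_power2[of ?a] zero_le_power2[of ?b] unfolding distrib_left by linarith
  qed (use C_pos in simp)
  also have "\<dots> \<le> C * (2 * (cmod (l p z) / c + cmod (l q z) / c))"
    using norm_sq_le_l assms C_pos c_pos
    by (intro mult_left_mono add_mono) (simp_all add: pos_le_divide_eq mult.commute)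
  finally show ?thesis by (simp add: \<kappa>_def algebra_simps add_divide_distrib)
qed

lemma quasi_symmetric:
  assumes "p \<in> \<Gamma>" "q \<in> \<Gamma>"
  shows "cmod (l q p) \<le> \<kappa> * cmod (l p q)"
  using quasi_triangle[OF assms(2,1), of q] assms by simp

definition separated :: "real \<Rightarrow> c2 set \<Rightarrow> bool" where
  "separated S P \<longleftrightarrow> finite P \<and> P \<subseteq> \<Gamma> \<and> (\<forall>p\<in>P. \<forall>q\<in>P. p \<noteq> q \<longrightarrow> S \<le> cmod (l p q))"

text \<open>The packing constant of \<open>count_bound\<close>: images of the points have spacing
  \<open>S / 2\<close> and lie in a ball of radius \<open>(4 * C / c + 2 * \<kappa>) * r\<close> in
  real dimension 6.\<close>

definition M :: real where "M = (4 * (4 * C / c + 2 * \<kappa> + 1)) ^ 6"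

lemma M_pos: "M > 0"
  using C_pos c_pos \<kappa>_ge_1 unfolding M_def by (intro zero_less_power mult_pos_pos add_nonneg_pos) auto

text \<open>The map \<open>\<Psi>\<close> records the scaled position together with the normal
  coordinate at one fixed point \<open>p0\<close>. It turns separation for \<open>l\<close> into
  Euclidean separation, so that volume comparison applies. The exponent need not be sharp, as the
  power of the peak functions is chosen one higher.\<close>

lemma count_bound:
  assumes P: "separated S P" and "z \<in> \<Omega> \<union> \<Gamma>" and S: "0 < S" "S \<le> r"
  shows "real (card {p\<in>P. cmod (l p z) \<le> r}) \<le> M * (r / S) ^ 6"
proof (cases "{p\<in>P. cmod (l p z) \<le> r} = {}")
  case True
  then show ?thesis using M_pos S by (simp only: True) simp
next
  case False
  define A where "A = {p\<in>P. cmod (l p z) \<le> r}"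
  obtain p0 where p0: "p0 \<in> A" using False by (auto simp: A_def)
  have A: "finite A" "A \<subseteq> \<Gamma>" "\<And>p q. p \<in> A \<Longrightarrow> q \<in> A \<Longrightarrow> p \<noteq> q \<Longrightarrow> S \<le> cmod (l p q)"
    using P unfolding separated_def A_def by auto
  have r: "r > 0" using S by simp
  \<comment> \<open>Points within \<open>r\<close> of \<open>z\<close> are within
    \<open>2 * sqrt (r / c)\<close> of \<open>p0\<close>; hence replacing \<open>N p\<close> by
    \<open>N p0\<close> in \<open>l p q\<close> costs at most
    \<open>k * norm (p - q)\<close>.\<close>
  define k where "k = 2 * C * sqrt (r / c)"
  have k: "k > 0" using C_pos c_pos r by (simp add: k_def)
  have near: "norm (p - p0) \<le> 2 * sqrt (r / c)" if "p \<in> A" for p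
  proof -
    have *: "norm (p - z) \<le> sqrt (r / c)" if "p \<in> A" for p
    proof (rule real_le_rsqrt)
      have "c * (norm (p - z))\<^sup>2 \<le> r"
        using norm_sq_le_l[of p z] that assms(2) A(2) by (force simp: A_def)
      then show "(norm (p - z))\<^sup>2 \<le> r / c" using c_pos by (simp add: pos_le_divide_eq mult.commute)
    qed
    show ?thesis using *[OF that] *[OF p0] norm_triangle_ineq4[of "p - z" "p0 - z"] by simp
  qed
  \<comment> \<open>If both components of \<open>\<Psi> p - \<Psi> q\<close> are below
    \<open>S / 2\<close>, then \<open>l p q\<close>, being at most their sum, is below
    \<open>S\<close>.\<close>
  define \<Psi> where "\<Psi> p = (k *\<^sub>R p, herm (p - p0) (N p0))" for p
  define L where "L = 4 * C / c + 2 * \<kappa>"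
  have L: "L > 0" using C_pos c_pos \<kappa>_ge_1 by (simp add: L_def add_pos_pos)
  have "real (card A) * (S / 4) ^ DIM(c2 \<times> complex) \<le> (L * r + S / 4) ^ DIM(c2 \<times> complex)"
  proof (rule packing_bound)
    show "2 * (S / 4) \<le> dist (\<Psi> p) (\<Psi> q)" if pq: "p \<in> A" "q \<in> A" "p \<noteq> q" for p q
    proof (rule ccontr)
      assume "\<not> ?thesis"
      then have d: "dist (\<Psi> p) (\<Psi> q) < S / 2" by simp
      have "dist (\<Psi> p) (\<Psi> q) = norm (k *\<^sub>R (p - q), herm (p - q) (N p0))"
        by (simp add: \<Psi>_def dist_norm herm_diff_left scaleR_diff_right)
      then have 1: "k * norm (p - q) < S / 2" "cmod (herm (p - q) (N p0)) < S / 2"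
        using d k norm_fst_le[of "k *\<^sub>R (p - q)" "herm (p - q) (N p0)"]
          norm_snd_le[of "herm (p - q) (N p0)" "k *\<^sub>R (p - q)"] by auto
      have "l p q = herm (p - q) (N p0) + herm (p - q) (N p - N p0)"
        by (simp add: l_def herm_diff_right)
      then have "cmod (l p q) \<le> cmod (herm (p - q) (N p0)) + cmod (herm (p - q) (N p - N p0))"
        using norm_triangle_ineq by metis
      also have "cmod (herm (p - q) (N p - N p0)) \<le> norm (p - q) * (C * (2 * sqrt (r / c)))"
      proof -
        have "norm (N p - N p0) \<le> C * norm (p - p0)"
          using lipschitz_N pq p0 A(2) by blast
        also have "\<dots> \<le> C * (2 * sqrt (r / c))"
          using near[OF pq(1)] C_pos by (intro mult_left_mono) auto
        finally show ?thesis
          using norm_herm_le[of "p - q" "N p - N p0"] by (meson mult_left_mono norm_ge_zero order_trans)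
      qed
      also have "norm (p - q) * (C * (2 * sqrt (r / c))) = k * norm (p - q)" by (simp add: k_def)
      finally have "cmod (l p q) < S" using 1 by linarith
      then show False using A(3)[OF pq] by simp
    qed
    show "dist (\<Psi> p0) (\<Psi> p) \<le> L * r" if p: "p \<in> A" for p
    proof -
      have "dist (\<Psi> p0) (\<Psi> p) = norm (k *\<^sub>R (p - p0), herm (p - p0) (N p0))"
        by (subst dist_commute) (simp add: \<Psi>_def dist_norm herm_def scaleR_diff_right)
      also have "\<dots> \<le> k * norm (p - p0) + cmod (l p0 p)"
        using norm_Pair_le[of "k *\<^sub>R (p - p0)" "herm (p - p0) (N p0)"] k
        by (simp add: l_def herm_diff_left norm_minus_commute)
      also have "k * norm (p - p0) \<le> k * (2 * sqrt (r / c))"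
        using near[OF p] k by (intro mult_left_mono) auto
      also have "k * (2 * sqrt (r / c)) = 4 * C / c * r"
        using r c_pos by (simp add: k_def)
      also have "cmod (l p0 p) \<le> \<kappa> * (r + r)"
      proof -
        have "cmod (l p0 p) \<le> \<kappa> * (cmod (l p0 z) + cmod (l p z))"
          using quasi_triangle p p0 A(2) assms(2) by blast
        also have "\<dots> \<le> \<kappa> * (r + r)"
          using p p0 \<kappa>_ge_1 by (intro mult_left_mono add_mono) (auto simp: A_def)
        finally show ?thesis .
      qed
      finally show ?thesis by (simp add: L_def algebra_simps)
    qed
  qed (use A(1) S L r in auto)
  then have "real (card A) * (S / 4) ^ 6 \<le> (L * r + S / 4) ^ 6" by simp
  also have "\<dots> \<le> ((L + 1) * r) ^ 6"
    using S L r by (intro power_mono) (auto simp: algebra_simps)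
  finally have "real (card A) \<le> ((L + 1) * r) ^ 6 / (S / 4) ^ 6"
    using S by (simp add: pos_le_divide_eq)
  also have "\<dots> = (4 * (L + 1) * (r / S)) ^ 6"
  proof -
    have "(L + 1) * r / (S / 4) = 4 * (L + 1) * (r / S)" by simp
    then show ?thesis by (simp only: power_divide[symmetric])
  qed
  also have "\<dots> = M * (r / S) ^ 6"
    by (simp only: power_mult_distrib M_def L_def)
  finally show ?thesis by (simp add: A_def)
qed

text \<open>A separated set of maximal cardinality is a net. Cardinalities are bounded because
  \<open>count_bound\<close> applies with a radius that \<open>l\<close> never exceeds.\<close>

lemma separated_net:
  assumes "S > 0" "z0 \<in> \<Omega>"
  shows "\<exists>P. separated S P \<and> (\<forall>\<zeta>\<in>\<Gamma>. \<exists>p\<in>P. cmod (l p \<zeta>) \<le> \<kappa> * S)"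
proof -
  define r where "r = max S (2 * C)"
  have bound: "card P < nat \<lceil>M * (r / S) ^ 6\<rceil> + 1" if P: "separated S P" for P
  proof -
    have "{p\<in>P. cmod (l p z0) \<le> r} = P"
    proof -
      have "cmod (l p z0) \<le> r" if "p \<in> P" for p
        using l_le[of p z0] subsetD[of P \<Gamma> p] that P assms(2)
        unfolding separated_def r_def le_max_iff_disj by blast
      then show ?thesis by blast
    qed
    then have "real (card P) \<le> M * (r / S) ^ 6"
      using count_bound[OF P, of z0 r] assms by (simp add: r_def)
    then show ?thesis by linarith
  qed
  have "separated S {}" by (simp add: separated_def)
  then obtain P where P: "separated S P" "\<And>Q. separated S Q \<Longrightarrow> card Q \<le> card P"
    using ex_has_greatest_nat[of "separated S" "{}" card] bound by metis
  have "\<exists>p\<in>P. cmod (l p \<zeta>) \<le> \<kappa> * S" if \<zeta>: "\<zeta> \<in> \<Gamma>" for \<zeta>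
  proof (rule ccontr)
    assume neg: "\<not> ?thesis"
    \<comment> \<open>The factor \<open>\<kappa>\<close> in the net radius pays for the asymmetry of
      \<open>l\<close>: separation is required in both orders.\<close>
    have *: "S \<le> cmod (l p \<zeta>) \<and> S \<le> cmod (l \<zeta> p)" if "p \<in> P" for p
    proof -
      have "p \<in> \<Gamma>" using that P(1) by (auto simp: separated_def)
      have "\<kappa> * S < cmod (l p \<zeta>)" using neg that by force
      moreover have "cmod (l p \<zeta>) \<le> \<kappa> * cmod (l \<zeta> p)" using quasi_symmetric \<zeta> \<open>p \<in> \<Gamma>\<close> by blast
      moreover have "S \<le> \<kappa> * S" using \<kappa>_ge_1 assms by simp
      ultimately have "S \<le> cmod (l p \<zeta>)" "\<kappa> * S < \<kappa> * cmod (l \<zeta> p)" by linarith+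
      then show ?thesis using \<kappa>_ge_1 by simp
    qed
    then have "\<zeta> \<notin> P" using assms(1) *[of \<zeta>] by auto
    moreover have "separated S (insert \<zeta> P)"
      using P(1) \<zeta> * by (auto simp: separated_def)
    ultimately show False
      using P(2)[of "insert \<zeta> P"] P(1) by (simp add: separated_def)
  qed
  then show ?thesis using P(1) by blast
qed

text \<open>Two such points would be at quasi-distance below \<open>S\<close>. Hence at each
  \<open>z\<close> at most one term of the peak sum is large.\<close>

lemma near_unique:
  assumes P: "separated S P" and "z \<in> \<Omega> \<union> \<Gamma>" "p \<in> P" "q \<in> P"
    and "cmod (l p z) < S / (2 * \<kappa>)" "cmod (l q z) < S / (2 * \<kappa>)"
  shows "p = q"
proof (rule ccontr)
  assume "p \<noteq> q"
  then have "S \<le> cmod (l p q)" using assms by (simp add: separated_def)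
  also have "\<dots> \<le> \<kappa> * (cmod (l p z) + cmod (l q z))"
    using assms by (intro quasi_triangle) (auto simp: separated_def)
  also have "\<dots> < \<kappa> * (S / (2 * \<kappa>) + S / (2 * \<kappa>))"
    using assms \<kappa>_ge_1 by (intro mult_strict_left_mono add_strict_mono) auto
  also have "\<dots> = S" using \<kappa>_ge_1 by (simp add: field_simps)
  finally show False by simp
qed

text \<open>Shell \<open>i\<close>, where \<open>cmod (l p z)\<close> is about \<open>2 ^ i\<close>
  times the threshold, holds at most \<open>M * 64 * 2 ^ (6 * i)\<close> points, each contributing
  at most \<open>(1/2) ^ (7 * i)\<close>; the geometric series adds the last factor 2.\<close>

lemma far_sum_bound:
  assumes P: "separated S P" and z: "z \<in> \<Omega> \<union> \<Gamma>" and S: "0 < S"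
  shows "(\<Sum>p | p \<in> P \<and> S / (2 * \<kappa>) \<le> cmod (l p z). (S / (2 * \<kappa>) / cmod (l p z)) ^ 7) \<le> 128 * M"
proof -
  define \<sigma> where "\<sigma> = S / (2 * \<kappa>)"
  have \<sigma>: "\<sigma> > 0" "\<sigma> \<le> S" using S \<kappa>_ge_1 by (auto simp: \<sigma>_def divide_le_eq)
  define F where "F = {p \<in> P. \<sigma> \<le> cmod (l p z)}"
  have F: "finite F" using P by (simp add: F_def separated_def)
  have "\<exists>k. 2 ^ k \<le> cmod (l p z) / \<sigma> \<and> cmod (l p z) / \<sigma> < 2 ^ Suc k" if "p \<in> F" for p
    using that \<sigma> by (intro dyadic_level) (simp add: F_def)
  then obtain k where k: "\<And>p. p \<in> F \<Longrightarrow> 2 ^ k p \<le> cmod (l p z) / \<sigma>"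
    "\<And>p. p \<in> F \<Longrightarrow> cmod (l p z) / \<sigma> < 2 ^ Suc (k p)"
    by metis
  have tm: "(\<sigma> / cmod (l p z)) ^ 7 \<le> (1/2) ^ (7 * k p)" if "p \<in> F" for p
  proof -
    have "\<sigma> \<le> cmod (l p z)" using that by (simp add: F_def)
    then have "0 < cmod (l p z)" using \<sigma> by linarith
    then have "\<sigma> / cmod (l p z) \<le> 1 / 2 ^ k p"
      using k(1)[OF that] \<sigma> by (simp add: field_simps)
    then have "(\<sigma> / cmod (l p z)) ^ 7 \<le> (1 / 2 ^ k p) ^ 7"
      using \<sigma> by (intro power_mono) auto
    then show ?thesis by (simp add: power_mult power_divide mult.commute flip: power_mult)
  qed
  have level: "real (card {p \<in> F. k p = i}) \<le> M * 64 * 2 ^ (6 * i)" for i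
  proof -
    have "{p \<in> F. k p = i} \<subseteq> {p\<in>P. cmod (l p z) \<le> 2 ^ Suc i * S}"
    proof safe
      fix p assume p: "p \<in> F"
      then show "p \<in> P" by (simp add: F_def)
      have "cmod (l p z) \<le> 2 ^ Suc (k p) * \<sigma>" using k(2)[OF p] \<sigma> by (simp add: divide_less_eq)
      also have "\<dots> \<le> 2 ^ Suc (k p) * S" using \<sigma> by (intro mult_left_mono) auto
      finally show "cmod (l p z) \<le> 2 ^ Suc (k p) * S" .
    qed
    then have "real (card {p \<in> F. k p = i}) \<le> real (card {p\<in>P. cmod (l p z) \<le> 2 ^ Suc i * S})"
      using P by (intro of_nat_mono card_mono) (auto simp: separated_def)
    also have "\<dots> \<le> M * (2 ^ Suc i * S / S) ^ 6"
    proof (rule count_bound[OF P z S])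
      show "S \<le> 2 ^ Suc i * S"
        using mult_right_mono[OF one_le_power[of 2 "Suc i"], of S] S by simp
    qed
    also have "\<dots> = M * 64 * 2 ^ (6 * i)"
      using S by (simp add: power_mult_distrib power_mult mult.commute flip: power_mult)
    finally show ?thesis .
  qed
  have "(\<Sum>p\<in>F. (\<sigma> / cmod (l p z)) ^ 7) \<le> (\<Sum>p\<in>F. (1/2) ^ (7 * k p))"
    by (intro sum_mono tm)
  also have "\<dots> = (\<Sum>i\<in>k ` F. \<Sum>p | p \<in> F \<and> k p = i. (1/2) ^ (7 * k p))"
    by (rule sum.image_gen[OF F])
  also have "\<dots> = (\<Sum>i\<in>k ` F. real (card {p \<in> F. k p = i}) * (1/2) ^ (7 * i))"
    by (intro sum.cong) auto
  also have "\<dots> \<le> (\<Sum>i\<in>k ` F. (M * 64 * 2 ^ (6 * i)) * (1/2) ^ (7 * i))"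
    by (intro sum_mono mult_right_mono level) auto
  also have "\<dots> = (\<Sum>i\<in>k ` F. M * 64 * (1/2) ^ i)"
  proof (intro sum.cong refl)
    fix i
    have "(2::real) ^ (6 * i) * (1/2) ^ (7 * i) = (2 ^ 6 * (1/2) ^ 7) ^ i"
      by (simp only: power_mult power_mult_distrib)
    also have "(2::real) ^ 6 * (1/2) ^ 7 = 1/2" by (simp add: power_divide)
    finally show "(M * 64 * 2 ^ (6 * i)) * (1/2) ^ (7 * i) = M * 64 * (1/2) ^ i" by simp
  qed
  also have "\<dots> \<le> M * 64 * 2"
    unfolding sum_distrib_left[symmetric] using M_pos F
    by (intro mult_left_mono sum_half_powers_le) auto
  finally show ?thesis by (simp add: F_def \<sigma>_def)
qed

section \<open>The peak sum\<close>

lemma holomorphic2_on_l: "holomorphic2_on (l p) X"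
  unfolding holomorphic2_on_def
proof
  fix z
  have "((\<lambda>z. l p z) has_derivative (\<lambda>v. - cnj (fst (N p)) * fst v + - cnj (snd (N p)) * snd v)) (at z)"
    unfolding l_def herm_def by (auto intro!: derivative_eq_intros simp: algebra_simps)
  then show "\<exists>a b. (l p has_derivative (\<lambda>v. a * fst v + b * snd v)) (at z)" by blast
qed

text \<open>The hypothesis \<open>visible\<close> holds for every ratio \<open>B\<close> of
  quasi-distance to height, so the constants can be fixed in the order \<open>s\<close> (peak
  quality), \<open>m\<close> and \<open>H\<close> (separation), and only then the height
  \<open>t\<close>, which also makes the sum small on \<open>K\<close>.\<close>

lemma peak_sum:
  fixes A :: "c2 \<Rightarrow> c2 set"
  assumes \<Omega>: "z0 \<in> \<Omega>" and A: "\<And>\<zeta>. \<zeta> \<in> \<Gamma> \<Longrightarrow> A \<zeta> \<subseteq> \<Omega>"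
    and visible: "\<And>B \<epsilon>. B > 0 \<Longrightarrow> \<epsilon> > 0 \<Longrightarrow> \<exists>t1>0. \<forall>t p \<zeta>. 0 < t \<and> t < t1 \<and> p \<in> \<Gamma> \<and> \<zeta> \<in> \<Gamma> \<and>
      cmod (l p \<zeta>) \<le> B * t \<longrightarrow> p - t *\<^sub>R N p \<in> A \<zeta> \<and> dist (p - t *\<^sub>R N p) \<zeta> < \<epsilon>"
    and \<epsilon>: "\<epsilon> > 0" and K: "compact K" "K \<subseteq> \<Omega>"
  shows "\<exists>G Z. holomorphic2_on G \<Omega> \<and> (\<forall>z\<in>\<Omega>. cmod (G z) < 1) \<and>
        (\<forall>z\<in>K. cmod (G z) \<le> \<epsilon>) \<and> finite Z \<and> Z \<subseteq> \<Omega> \<and> (\<forall>z\<in>Z. cmod (G z - 1) \<le> \<epsilon>) \<and>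
        (\<forall>\<zeta>\<in>\<Gamma>. \<exists>z\<in>Z \<inter> A \<zeta>. dist z \<zeta> < \<epsilon>)"
proof -
  \<comment> \<open>One third each for the defect of the main term at its peak, for the far terms
    and for the normalization by \<open>w\<close>.\<close>
  define \<eta> where "\<eta> = \<epsilon> / 3"
  have \<eta>: "\<eta> > 0" using \<epsilon> by (simp add: \<eta>_def)
  \<comment> \<open>The ratio \<open>a / t\<close>. The first summand gives
    \<open>7 * C\<^sup>2 / s \<le> \<eta>\<close> for Bernoulli's inequality at the peak; the second
    gives \<open>t * C\<^sup>2 < a\<close>, so that the peak point counts as near its own
    \<open>p\<close>.\<close>
  define s where "s = 7 * C\<^sup>2 / \<eta> + 2 * C\<^sup>2"
  have s: "s > 0" "s > C\<^sup>2" "7 * C\<^sup>2 / s \<le> \<eta>"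
  proof -
    have C2: "C\<^sup>2 > 0" using C_pos by simp
    have "7 * C\<^sup>2 / \<eta> > 0" using C2 \<eta> by simp
    then show 1: "s > 0" "s > C\<^sup>2" using C2 unfolding s_def by linarith+
    have "7 * C\<^sup>2 / \<eta> \<le> s" using C2 by (simp add: s_def)
    then show "7 * C\<^sup>2 / s \<le> \<eta>" using 1 \<eta> by (simp add: field_simps)
  qed
  \<comment> \<open>The ratio of the near-far threshold \<sigma> to \<open>a\<close>, large enough
    for the far terms to sum to at most \<eta>.\<close>
  define m where "m = max 1 (128 * M / \<eta>)"
  have m: "m \<ge> 1" "128 * M / m \<le> \<eta>"
  proof -
    show 1: "m \<ge> 1" by (simp add: m_def)
    have "128 * M / \<eta> \<le> m" by (simp add: m_def)
    then show "128 * M / m \<le> \<eta>" using 1 \<eta> by (simp add: field_simps)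
  qed
  \<comment> \<open>The ratio \<open>S / a\<close>; it makes the threshold
    \<open>S / (2 * \<kappa>)\<close> equal to \<open>a * m\<close>.\<close>
  define H where "H = 2 * \<kappa> * m"
  have H: "H \<ge> 1" "H > 0" "2 * \<kappa> \<le> H"
  proof -
    show "2 * \<kappa> \<le> H" using \<kappa>_ge_1 m(1) by (simp add: H_def)
    then show "H \<ge> 1" "H > 0" using \<kappa>_ge_1 by linarith+
  qed
  obtain d where d: "d > 0" "\<And>p z. p \<in> \<Gamma> \<Longrightarrow> z \<in> K \<Longrightarrow> d \<le> norm (p - z)"
  proof -
    have "K \<inter> \<Gamma> = {}" using K disjoint by blast
    then show ?thesis
      using separate_compact_closed[OF K(1) compact_imp_closed[OF compact]] that
      by (metis dist_commute dist_norm)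
  qed
  obtain t1 where t1: "t1 > 0" "\<And>t p \<zeta>. 0 < t \<Longrightarrow> t < t1 \<Longrightarrow> p \<in> \<Gamma> \<Longrightarrow> \<zeta> \<in> \<Gamma> \<Longrightarrow>
      cmod (l p \<zeta>) \<le> (\<kappa> * (s * H)) * t \<Longrightarrow> p - t *\<^sub>R N p \<in> A \<zeta> \<and> dist (p - t *\<^sub>R N p) \<zeta> < \<epsilon>"
  proof -
    have "\<kappa> * (s * H) > 0" using \<kappa>_ge_1 s H by (intro mult_pos_pos) auto
    then show ?thesis using visible[OF _ \<epsilon>] that by metis
  qed
  \<comment> \<open>On \<open>K\<close> there are at most \<open>M * (2 * C / a) ^ 6\<close> terms,
    each at most \<open>(a / (c * d\<^sup>2)) ^ 7\<close>. The product is \<open>D * a\<close>,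
    where the seventh power leaves one factor \<open>a\<close> to spare.\<close>
  define D where "D = M * (2 * C) ^ 6 / (c * d\<^sup>2) ^ 7"
  have D: "D > 0" using M_pos C_pos c_pos d(1) by (simp add: D_def)
  \<comment> \<open>The three bounds give visibility of the peaks, \<open>S \<le> 2 * C\<close> for
    counting all of \<open>P\<close>, and smallness on \<open>K\<close>.\<close>
  define t where "t = min (t1 / 2) (min (2 * C / (s * H)) (\<epsilon> / (D * s)))"
  have t: "0 < t" "t < t1" "t * (s * H) \<le> 2 * C" "D * (s * t) \<le> \<epsilon>"
  proof -
    have sH: "s * H > 0" "D * s > 0" using s H D by simp_all
    then show "0 < t" using t1(1) C_pos \<epsilon> by (simp add: t_def)
    show "t < t1" using t1(1) by (simp add: t_def min_def)
    have "t \<le> 2 * C / (s * H)" "t \<le> \<epsilon> / (D * s)" by (simp_all add: t_def)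
    then show "t * (s * H) \<le> 2 * C" "D * (s * t) \<le> \<epsilon>"
      using sH by (simp_all add: pos_le_divide_eq mult_ac)
  qed
  define a where "a = s * t"
  have a: "a > 0" using s t by (simp add: a_def)
  define S where "S = a * H"
  have S: "S > 0" "S \<le> 2 * C" "a \<le> S" "a \<le> S / (2 * \<kappa>)"
  proof -
    show "S > 0" using a H by (simp add: S_def)
    show "S \<le> 2 * C" using t(3) by (simp add: S_def a_def mult_ac)
    show "a \<le> S" using a H by (simp add: S_def)
    have "a * (2 * \<kappa>) \<le> S" unfolding S_def using a H by (intro mult_left_mono) auto
    then show "a \<le> S / (2 * \<kappa>)" using \<kappa>_ge_1 by (simp add: pos_le_divide_eq)
  qed
  obtain P where P: "separated S P" "\<And>\<zeta>. \<zeta> \<in> \<Gamma> \<Longrightarrow> \<exists>p\<in>P. cmod (l p \<zeta>) \<le> \<kappa> * S"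
    using separated_net[OF S(1) \<Omega>] by blast
  have fin: "finite P" and P_sub: "P \<subseteq> \<Gamma>" using P(1) by (auto simp: separated_def)
  define u where "u p z = (of_real a / (of_real a + l p z)) ^ 7" for p z
  \<comment> \<open>Adding \<open>a > 0\<close> to a number of positive real part increases its
    modulus.\<close>
  have denom: "cmod (l p z) \<le> cmod (of_real a + l p z)" if "p \<in> \<Gamma>" "z \<in> \<Omega>" for p z
  proof -
    have "0 < Re (l p z)" using Re_l_pos that by blast
    then have "(Re (l p z))\<^sup>2 \<le> (Re (of_real a + l p z))\<^sup>2"
      using a by (intro power_mono) auto
    then show ?thesis by (simp add: cmod_def)
  qed
  have u_lt_1: "cmod (u p z) < 1" if "p \<in> \<Gamma>" "z \<in> \<Omega>" for p z
  proof -
    have "a < Re (of_real a + l p z)" using Re_l_pos that by simp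
    also have "\<dots> \<le> cmod (of_real a + l p z)" by (rule complex_Re_le_cmod)
    finally have "cmod (of_real a / (of_real a + l p z)) < 1"
      using a by (simp add: norm_divide divide_less_eq)
    then show ?thesis unfolding u_def norm_power by (simp add: power_less_one_iff)
  qed
  have u_le: "cmod (u p z) \<le> (a / x) ^ 7" if "p \<in> \<Gamma>" "z \<in> \<Omega>" "0 < x" "x \<le> cmod (l p z)" for p z x
  proof -
    have "cmod (of_real a / (of_real a + l p z)) \<le> a / x"
      using denom[OF that(1,2)] that a unfolding norm_divide by (intro frac_le) auto
    then show ?thesis unfolding u_def norm_power by (intro power_mono) auto
  qed
  define \<sigma> where "\<sigma> = S / (2 * \<kappa>)"
  have \<sigma>: "\<sigma> > 0" "a / \<sigma> = 1 / m"
    using S a \<kappa>_ge_1 m by (auto simp: \<sigma>_def S_def H_def)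
  define far where "far z = {p \<in> P. \<sigma> \<le> cmod (l p z)}" for z
  have far_sum: "(\<Sum>p\<in>far z. cmod (u p z)) \<le> \<eta>" if z: "z \<in> \<Omega>" for z
  proof -
    have "(\<Sum>p\<in>far z. cmod (u p z)) \<le> (\<Sum>p\<in>far z. (1 / m) ^ 7 * (\<sigma> / cmod (l p z)) ^ 7)"
    proof (rule sum_mono)
      fix p assume p: "p \<in> far z"
      then have "\<sigma> \<le> cmod (l p z)" by (simp add: far_def)
      then have l: "0 < cmod (l p z)" using \<sigma> by linarith
      have "cmod (u p z) \<le> (a / cmod (l p z)) ^ 7"
        using p P_sub z l by (intro u_le) (auto simp: far_def)
      also have "a / cmod (l p z) = (1 / m) * (\<sigma> / cmod (l p z))"
        using \<sigma> unfolding \<sigma>(2)[symmetric] by simp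
      finally show "cmod (u p z) \<le> (1 / m) ^ 7 * (\<sigma> / cmod (l p z)) ^ 7"
        by (simp only: power_mult_distrib)
    qed
    also have "\<dots> \<le> (1 / m) ^ 7 * (128 * M)"
      unfolding sum_distrib_left[symmetric] far_def \<sigma>_def
      using far_sum_bound[OF P(1) _ S(1), of z] z m by (intro mult_left_mono) auto
    also have "\<dots> \<le> (1 / m) * (128 * M)"
    proof (rule mult_right_mono)
      show "(1 / m) ^ 7 \<le> 1 / m"
        using m power_decreasing[of 1 7 "1 / m"] by simp
    qed (use M_pos in simp)
    finally show ?thesis using m by simp
  qed
  have split: "(\<Sum>p\<in>P. u p z) = (\<Sum>p\<in>P - far z. u p z) + (\<Sum>p\<in>far z. u p z)" for z
    using fin by (intro sum.subset_diff) (auto simp: far_def)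
  have near: "p = q" if "z \<in> \<Omega>" "p \<in> P - far z" "q \<in> P - far z" for z p q
    using near_unique[OF P(1), of z p q] that by (auto simp: far_def \<sigma>_def)
  \<comment> \<open>The single near term is below 1 and the far terms add at most \<eta>, so this
    scaling brings the sum into the open unit disc.\<close>
  define w where "w = 1 / (1 + \<eta>)"
  have w: "0 < w" "w \<le> 1" "(1 + \<eta>) * w = 1" using \<eta> by (simp_all add: w_def)
  define G where "G z = (\<Sum>p\<in>P. u p z) * of_real w" for z
  define Z where "Z = (\<lambda>p. p - t *\<^sub>R N p) ` P"
  have Z_mem: "p - t *\<^sub>R N p \<in> \<Omega>" if "p \<in> P" for p
    using t1(2)[OF t(1,2), of p p] A[of p] that P_sub \<kappa>_ge_1 s H t by (auto simp: less_imp_le)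
  have hol: "holomorphic2_on G \<Omega>"
  proof -
    have "holomorphic2_on (u p) \<Omega>" if "p \<in> P" for p
      unfolding u_def
    proof (rule holomorphic2_on_compose[where \<phi>="\<lambda>w. (of_real a / (of_real a + w)) ^ 7"
          and T="{w. Re w > 0}"])
      show "holomorphic2_on (l p) \<Omega>" by (rule holomorphic2_on_l)
      show "open {w. Re w > 0}" by (rule open_halfspace_Re_gt)
      show "(\<lambda>w. (of_real a / (of_real a + w)) ^ 7) holomorphic_on {w. Re w > 0}"
        using a by (intro holomorphic_intros) (auto simp: complex_eq_iff)
      show "l p z \<in> {w. Re w > 0}" if "z \<in> \<Omega>" for z
        using Re_l_pos[of p z] that \<open>p \<in> P\<close> P_sub by auto
    qed
    then show ?thesis
      unfolding G_def by (intro holomorphic2_on_mult holomorphic2_on_sum holomorphic2_on_const fin)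
  qed
  have lt_1: "cmod (G z) < 1" if z: "z \<in> \<Omega>" for z
  proof -
    have "cmod (\<Sum>p\<in>P - far z. u p z) < 1"
    proof (cases "P - far z = {}")
      case False
      then obtain q where q: "q \<in> P - far z" by blast
      then have "P - far z = {q}" using near[OF z q] by blast
      then show ?thesis using u_lt_1[of q z] q P_sub z by auto
    qed (simp only: sum.empty, simp)
    moreover have "cmod (\<Sum>p\<in>far z. u p z) \<le> \<eta>"
      using far_sum[OF z] by (rule order_trans[OF norm_sum])
    ultimately have "cmod (\<Sum>p\<in>P. u p z) < 1 + \<eta>"
      unfolding split using norm_triangle_ineq[of "\<Sum>p\<in>P - far z. u p z" "\<Sum>p\<in>far z. u p z"] by linarith
    then have "cmod (\<Sum>p\<in>P. u p z) * w < (1 + \<eta>) * w" using w by (intro mult_strict_right_mono)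
    then show ?thesis using w unfolding G_def norm_mult by simp
  qed
  have on_K: "cmod (G z) \<le> \<epsilon>" if z: "z \<in> K" for z
  proof -
    have zO: "z \<in> \<Omega>" using z K by blast
    have x: "0 < c * d\<^sup>2" using c_pos d by simp
    have "cmod (\<Sum>p\<in>P. u p z) \<le> (\<Sum>p\<in>P. (a / (c * d\<^sup>2)) ^ 7)"
    proof (rule sum_norm_le)
      fix p assume "p \<in> P"
      then have p: "p \<in> \<Gamma>" using P_sub by blast
      have "c * d\<^sup>2 \<le> c * (norm (p - z))\<^sup>2"
        using d c_pos p z by (intro mult_left_mono power_mono) auto
      also have "\<dots> \<le> cmod (l p z)" using norm_sq_le_l p zO by blast
      finally show "cmod (u p z) \<le> (a / (c * d\<^sup>2)) ^ 7" using u_le[OF p zO x] by blast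
    qed
    also have "\<dots> = real (card P) * (a / (c * d\<^sup>2)) ^ 7" by simp
    also have "\<dots> \<le> (M * (2 * C / S) ^ 6) * (a / (c * d\<^sup>2)) ^ 7"
    proof (rule mult_right_mono)
      have "{p\<in>P. cmod (l p z) \<le> 2 * C} = P" using l_le zO P_sub by blast
      then show "real (card P) \<le> M * (2 * C / S) ^ 6"
        using count_bound[OF P(1), of z "2 * C"] S zO by simp
    qed (use x a in simp)
    also have "\<dots> \<le> (M * (2 * C / a) ^ 6) * (a / (c * d\<^sup>2)) ^ 7"
      using M_pos C_pos S a x by (intro mult_right_mono mult_left_mono power_mono frac_le) auto
    also have "\<dots> = D * a"
    proof -
      have "a ^ 7 = a ^ 6 * a" using power_Suc2[of a 6] by simp
      then show ?thesis using a by (simp add: D_def power_divide)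
    qed
    also have "\<dots> \<le> \<epsilon>" using t(4) by (simp add: a_def)
    finally have "cmod (\<Sum>p\<in>P. u p z) \<le> \<epsilon>" .
    moreover have "cmod (G z) \<le> cmod (\<Sum>p\<in>P. u p z)"
      unfolding G_def norm_mult using w by (intro mult_left_le) auto
    ultimately show ?thesis by linarith
  qed
  have Z: "finite Z" "Z \<subseteq> \<Omega>" using fin Z_mem by (auto simp: Z_def)
  have on_Z: "cmod (G z - 1) \<le> \<epsilon>" if zZ: "z \<in> Z" for z
  proof -
    obtain p where p: "p \<in> P" "z = p - t *\<^sub>R N p" using zZ unfolding Z_def by blast
    have pG: "p \<in> \<Gamma>" and z: "z \<in> \<Omega>" using p P_sub Z_mem by auto
    have l: "l p z = of_real (t * (norm (N p))\<^sup>2)"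
      by (simp add: l_def p(2) herm_scaleR_left herm_self)
    have N2: "(norm (N p))\<^sup>2 \<le> C\<^sup>2" using norm_N[OF pG] by (intro power_mono) auto
    have "cmod (l p z) = t * (norm (N p))\<^sup>2" unfolding l norm_of_real using t by simp
    also have "\<dots> \<le> t * C\<^sup>2" using N2 t by (intro mult_left_mono) auto
    also have "\<dots> < a" using s t by (simp add: a_def)
    also have "\<dots> \<le> \<sigma>" using S by (simp add: \<sigma>_def)
    finally have pn: "p \<in> P - far z" using p by (simp add: far_def)
    then have "P - far z = {p}" using near[OF z pn] by blast
    then have sum: "(\<Sum>q\<in>P. u q z) = u p z + (\<Sum>q\<in>far z. u q z)" unfolding split by simp
    \<comment> \<open>Along the normal \<open>l p\<close> is the real number
      \<open>t * (norm (N p))\<^sup>2\<close>, so \<open>t\<close> cancels and the seventh root of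
      \<open>u p z\<close> is \<open>1 - x\<close> at every height.\<close>
    define x where "x = (norm (N p))\<^sup>2 / (s + (norm (N p))\<^sup>2)"
    have sN: "s + (norm (N p))\<^sup>2 > 0" using s by (simp add: add_pos_nonneg)
    have x: "0 \<le> x" "7 * x \<le> \<eta>" "x \<le> 1"
    proof -
      show "0 \<le> x" using sN by (simp add: x_def)
      show "x \<le> 1" using s by (simp add: x_def divide_le_eq add_pos_nonneg)
      have "x \<le> C\<^sup>2 / s" unfolding x_def using N2 s by (intro frac_le) auto
      then show "7 * x \<le> \<eta>" using s(3) by simp
    qed
    have "of_real a + l p z = of_real (t * (s + (norm (N p))\<^sup>2))"
      unfolding l by (simp add: a_def algebra_simps)
    then have "of_real a / (of_real a + l p z) = (of_real (a / (t * (s + (norm (N p))\<^sup>2))) :: complex)"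
      by simp
    also have "a / (t * (s + (norm (N p))\<^sup>2)) = 1 - x"
    proof -
      have "1 - x = s / (s + (norm (N p))\<^sup>2)" using sN by (simp add: x_def field_simps)
      then show ?thesis using t by (simp add: a_def)
    qed
    finally have u: "u p z = of_real ((1 - x) ^ 7)" by (simp add: u_def)
    have "1 - 7 * x \<le> (1 - x) ^ 7" using Bernoulli_inequality[of "-x" 7] x by simp
    moreover have "(1 - x) ^ 7 \<le> 1" using x by (intro power_le_one) auto
    ultimately have "\<bar>(1 - x) ^ 7 - 1\<bar> \<le> \<eta>" using x by linarith
    moreover have "u p z - 1 = of_real ((1 - x) ^ 7 - 1)" by (simp add: u)
    ultimately have 1: "cmod (u p z - 1) \<le> \<eta>" by (simp only: norm_of_real)
    have 2: "cmod (\<Sum>q\<in>far z. u q z) \<le> \<eta>"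
      using far_sum[OF z] by (rule order_trans[OF norm_sum])
    have "G z - 1 = ((u p z - 1) + (\<Sum>q\<in>far z. u q z) - of_real \<eta>) * of_real w"
    proof -
      have *: "(v + v') * w - 1 = (v - 1 + v' - e) * w" if "(1 + e) * w = 1" for v v' w e :: complex
        using that by (simp add: algebra_simps)
      have "(1 + of_real \<eta>) * (of_real w :: complex) = 1"
        using w(3) by (metis of_real_1 of_real_add of_real_mult)
      from *[OF this] show ?thesis unfolding G_def sum .
    qed
    then have "cmod (G z - 1) = cmod ((u p z - 1) + (\<Sum>q\<in>far z. u q z) - of_real \<eta>) * w"
      using w by (simp add: norm_mult)
    also have "\<dots> \<le> cmod ((u p z - 1) + (\<Sum>q\<in>far z. u q z) - of_real \<eta>)"
      using w by (intro mult_left_le) auto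
    also have "\<dots> \<le> cmod (u p z - 1) + cmod (\<Sum>q\<in>far z. u q z) + \<eta>"
      using norm_triangle_ineq4[of "(u p z - 1) + (\<Sum>q\<in>far z. u q z)" "of_real \<eta>"]
        norm_triangle_ineq[of "u p z - 1" "\<Sum>q\<in>far z. u q z"] \<eta> by simp
    also have "\<dots> \<le> \<epsilon>" using 1 2 by (simp add: \<eta>_def)
    finally show ?thesis .
  qed
  have vis: "\<exists>z\<in>Z \<inter> A \<zeta>. dist z \<zeta> < \<epsilon>" if \<zeta>: "\<zeta> \<in> \<Gamma>" for \<zeta>
  proof -
    obtain p where p: "p \<in> P" "cmod (l p \<zeta>) \<le> \<kappa> * S" using P(2)[OF \<zeta>] by blast
    have "\<kappa> * S = (\<kappa> * (s * H)) * t" by (simp add: S_def a_def)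
    then have "p - t *\<^sub>R N p \<in> A \<zeta> \<and> dist (p - t *\<^sub>R N p) \<zeta> < \<epsilon>"
      using t1(2)[OF t(1,2), of p \<zeta>] p P_sub \<zeta> by auto
    moreover have "p - t *\<^sub>R N p \<in> Z" unfolding Z_def using p(1) by (rule imageI)
    ultimately show ?thesis by (intro bexI[of _ "p - t *\<^sub>R N p"] IntI) simp_all
  qed
  show ?thesis
    by (intro exI[of _ G] exI[of _ Z] conjI ballI hol Z lt_1 on_K on_Z vis)
qed

end

subsection \<open>Strict convexity near the point (1, 0)\<close>

lemma second_derivative_bound:
  fixes f :: "'a::euclidean_space \<Rightarrow> 'b::real_normed_vector"
  assumes "open S" "smooth_on S f" "x \<in> S"
  shows "\<exists>B\<ge>0. \<forall>v w. norm (second_derivative f x v w) \<le> B * norm v * norm w"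
proof (intro exI conjI allI)
  let ?B = "\<Sum>b\<in>Basis. \<Sum>c\<in>Basis. norm (second_derivative f x b c)"
  show "0 \<le> ?B" by (intro sum_nonneg) auto
  fix v w
  have "norm (second_derivative f x v w) \<le>
      (\<Sum>b\<in>Basis. \<Sum>c\<in>Basis. norm v * norm w * norm (second_derivative f x b c))"
    unfolding second_derivative_expand[OF assms, of v w]
    by (intro sum_norm_le) (auto simp: abs_mult intro!: mult_mono Basis_le_norm)
  also have "\<dots> = ?B * norm v * norm w"
    by (simp add: sum_distrib_left sum_distrib_right mult_ac)
  finally show "norm (second_derivative f x v w) \<le> ?B * norm v * norm w" .
qed

text \<open>Testing \<open>\<rho> < 0 \<Longrightarrow> \<bar>z\<bar> \<le> 1\<close> on the parabola \<open>e + s v - \<mu> s\<^sup>2 e\<close> compares \<open>\<rho>\<close> with the sphere to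
  second order.\<close>

lemma tangential_hessian_ge:
  fixes \<rho> :: "'a::euclidean_space \<Rightarrow> real"
  assumes W: "open W" "smooth_on W \<rho>" "e \<in> W" and e: "\<rho> e = 0" "norm e = 1"
    and k: "k > 0" "\<And>v. frechet_derivative \<rho> (at e) v = k * (e \<bullet> v)"
    and ball: "\<And>z. z \<in> W \<Longrightarrow> \<rho> z < 0 \<Longrightarrow> norm z \<le> 1"
    and v: "e \<bullet> v = 0"
  shows "k * (norm v)\<^sup>2 \<le> second_derivative \<rho> e v v"
proof (rule ccontr)
  define Q where "Q = second_derivative \<rho> e"
  assume "\<not> ?thesis"
  then have neg: "Q v v < k * (norm v)\<^sup>2" by (simp add: Q_def)
  \<comment> \<open>Here \<open>2 * \<mu>\<close> is the midpoint of \<open>Q v v / k\<close> and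
    \<open>(norm v)\<^sup>2\<close>. To second order, \<rho> is then negative along the parabola
    while the norm exceeds 1.\<close>
  define \<mu> where "\<mu> = (Q v v / k + (norm v)\<^sup>2) / 4"
  have Qk: "Q v v / k < (norm v)\<^sup>2" using neg k by (simp add: divide_less_eq mult.commute)
  have \<mu>: "Q v v < 2 * k * \<mu>" "2 * \<mu> < (norm v)\<^sup>2"
  proof -
    have "2 * \<mu> = (Q v v / k + (norm v)\<^sup>2) / 2" by (simp add: \<mu>_def)
    then have "Q v v / k < 2 * \<mu>" using less_half_sum[OF Qk] by simp
    then show "Q v v < 2 * k * \<mu>" using k by (simp add: divide_less_eq mult_ac)
    show "2 * \<mu> < (norm v)\<^sup>2" using Qk by (simp add: \<mu>_def)
  qed
  \<comment> \<open>The Taylor error is kept below the gap \<open>k * \<mu> - Q v v / 2\<close>, so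
    that \<rho> stays negative for small \<open>s\<close>.\<close>
  define \<epsilon> where "\<epsilon> = (k * \<mu> - Q v v / 2) / ((norm v)\<^sup>2 + 1)"
  have den: "(norm v)\<^sup>2 + 1 > 0" by (simp add: add_nonneg_pos)
  have \<epsilon>: "\<epsilon> > 0" unfolding \<epsilon>_def using \<mu> den by (intro divide_pos_pos) auto
  have \<epsilon>2: "\<epsilon> * (norm v)\<^sup>2 < k * \<mu> - Q v v / 2"
  proof -
    have "\<epsilon> * ((norm v)\<^sup>2 + 1) = k * \<mu> - Q v v / 2" using den by (simp add: \<epsilon>_def)
    then show ?thesis using \<epsilon> by (simp add: algebra_simps)
  qed
  obtain r where r: "r > 0" "ball e r \<subseteq> W" "\<And>p z. p \<in> ball e r \<Longrightarrow> z \<in> ball e r \<Longrightarrow>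
     \<bar>\<rho> z - \<rho> p - frechet_derivative \<rho> (at p) (z - p) - Q (z - p) (z - p) / 2\<bar> \<le> \<epsilon> * (norm (z - p))\<^sup>2"
    using smooth_on_taylor_second[OF W \<epsilon>] unfolding Q_def by blast
  define w where "w s = s *\<^sub>R v - (\<mu> * s\<^sup>2) *\<^sub>R e" for s
  note QL = linear_second_derivative_left[OF W, folded Q_def]
  note QR = linear_second_derivative_right[OF W(2,3), folded Q_def]
  have Qw: "Q (w s) (w s) = s\<^sup>2 * (Q v v - (\<mu> * s) * (Q v e + Q e v) + (\<mu> * s)\<^sup>2 * Q e e)" for s
    by (simp add: w_def linear_diff[OF QL] linear_diff[OF QR] linear_cmul[OF QL] linear_cmul[OF QR]
        power2_eq_square algebra_simps)
  have nw: "(norm (w s))\<^sup>2 = s\<^sup>2 * ((norm v)\<^sup>2 + (\<mu> * s)\<^sup>2)" for s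
    unfolding power2_norm_eq_inner w_def using v e(2)
    by (simp add: inner_diff_left inner_diff_right inner_commute[of v e] power2_eq_square
        norm_eq_1 algebra_simps)
  have ew: "e \<bullet> w s = - (\<mu> * s\<^sup>2)" for s
    using v e(2) by (simp add: w_def inner_diff_right norm_eq_1)
  have "((\<lambda>s. - k * \<mu> + (Q v v - (\<mu> * s) * (Q v e + Q e v) + (\<mu> * s)\<^sup>2 * Q e e) / 2 + \<epsilon> * ((norm v)\<^sup>2 + (\<mu> * s)\<^sup>2))
      \<longlongrightarrow> - k * \<mu> + (Q v v - (\<mu> * 0) * (Q v e + Q e v) + (\<mu> * 0)\<^sup>2 * Q e e) / 2 + \<epsilon> * ((norm v)\<^sup>2 + (\<mu> * 0)\<^sup>2)) (at_right 0)"
    by (intro tendsto_intros) auto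
  then have ev1: "\<forall>\<^sub>F s in at_right 0. - k * \<mu> + (Q v v - (\<mu> * s) * (Q v e + Q e v) + (\<mu> * s)\<^sup>2 * Q e e) / 2
      + \<epsilon> * ((norm v)\<^sup>2 + (\<mu> * s)\<^sup>2) < 0"
    using \<epsilon>2 by (intro order_tendstoD(2)) auto
  have "((\<lambda>s. e + w s) \<longlongrightarrow> e + (0 *\<^sub>R v - (\<mu> * 0\<^sup>2) *\<^sub>R e)) (at_right 0)"
    unfolding w_def by (intro tendsto_intros)
  then have ev2: "\<forall>\<^sub>F s in at_right 0. e + w s \<in> ball e r"
    using r(1) by (intro topological_tendstoD[where S="ball e r"]) auto
  have "\<forall>\<^sub>F s::real in at_right 0. False"
    using ev1 ev2 eventually_at_right_less[of 0]
  proof eventually_elim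
    case (elim s)
    have "\<rho> (e + w s) \<le> k * (e \<bullet> w s) + Q (w s) (w s) / 2 + \<epsilon> * (norm (w s))\<^sup>2"
      using r(3)[of e "e + w s"] r(1) elim(2) e(1) k(2)[of "w s"] by simp
    also have "\<dots> = s\<^sup>2 * (- k * \<mu> + (Q v v - (\<mu> * s) * (Q v e + Q e v) + (\<mu> * s)\<^sup>2 * Q e e) / 2
      + \<epsilon> * ((norm v)\<^sup>2 + (\<mu> * s)\<^sup>2))"
      unfolding ew Qw nw by (simp add: algebra_simps)
    also have "\<dots> < 0" using elim by (intro mult_pos_neg) auto
    finally have "norm (e + w s) \<le> 1" using ball elim(2) r(2) by blast
    then have "(norm (e + w s))\<^sup>2 \<le> 1" by (simp add: power_le_one)
    moreover have "(norm (e + w s))\<^sup>2 = (norm e)\<^sup>2 + 2 * (e \<bullet> w s) + (norm (w s))\<^sup>2"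
      by (simp add: power2_norm_eq_inner inner_add_left inner_add_right inner_commute)
    ultimately have "s\<^sup>2 * ((norm v)\<^sup>2 + (\<mu> * s)\<^sup>2 - 2 * \<mu>) \<le> 0"
      unfolding ew nw e(2) by (simp add: algebra_simps)
    then have "(norm v)\<^sup>2 + (\<mu> * s)\<^sup>2 - 2 * \<mu> \<le> 0"
      using elim(3) by (simp add: mult_le_0_iff)
    then show False using \<mu>(2) zero_le_power2[of "\<mu> * s"] by linarith
  qed
  then show False by simp
qed

text \<open>The Hessian is only known to be positive on the tangent space, with a deficit
  proportional to the normal component of \<open>v = z - p\<close>. That component is in turn
  controlled by the derivative of \<rho> at \<open>p\<close> along \<open>v\<close>, the very
  quantity to be estimated, so for small \<open>r\<close> the deficit can be absorbed.\<close>

lemma strictly_convex_near: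
  fixes \<rho> :: "'a::euclidean_space \<Rightarrow> real"
  assumes W: "open W" "smooth_on W \<rho>" "e \<in> W" and e: "norm e = 1"
    and k: "k > 0" "\<And>v. frechet_derivative \<rho> (at e) v = k * (e \<bullet> v)"
    and hess: "\<And>v. e \<bullet> v = 0 \<Longrightarrow> k * (norm v)\<^sup>2 \<le> second_derivative \<rho> e v v"
  shows "\<exists>r>0. \<exists>c>0. ball e r \<subseteq> W \<and> (\<forall>p\<in>ball e r. \<forall>z\<in>ball e r. \<rho> z \<le> \<rho> p \<longrightarrow>
     c * (norm (z - p))\<^sup>2 \<le> - frechet_derivative \<rho> (at p) (z - p))"
proof -
  define Q where "Q = second_derivative \<rho> e"
  note QL = linear_second_derivative_left[OF W, folded Q_def]
  note QR = linear_second_derivative_right[OF W(2,3), folded Q_def]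
  obtain B0 where B0: "B0 \<ge> 0" "\<And>v w. \<bar>Q v w\<bar> \<le> B0 * norm v * norm w"
    using second_derivative_bound[OF W] unfolding Q_def by auto
  \<comment> \<open>Passing from \<open>v\<close> to its tangential part \<open>T\<close> costs
    \<open>k\<close> in the norm, \<open>2 * B0\<close> in the mixed terms and \<open>B0\<close> in
    the normal term.\<close>
  define B where "B = k + 3 * B0"
  have B: "B > 0" using k B0 by (simp add: B_def)
  have Q_ge: "k * (norm v)\<^sup>2 - B * (\<bar>e \<bullet> v\<bar> * norm v) \<le> Q v v" for v
  proof -
    define \<alpha> where "\<alpha> = e \<bullet> v"
    define T where "T = v - \<alpha> *\<^sub>R e"
    have ee: "e \<bullet> e = 1" using e by (simp add: norm_eq_1)
    have eT: "e \<bullet> T = 0" by (simp add: T_def inner_diff_right ee \<alpha>_def)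
    have "v = T + \<alpha> *\<^sub>R e" by (simp add: T_def)
    have \<alpha>v: "\<bar>\<alpha>\<bar> \<le> norm v" using Cauchy_Schwarz_ineq2[of e v] e by (simp add: \<alpha>_def)
    have "(norm v)\<^sup>2 = (norm T)\<^sup>2 + \<alpha>\<^sup>2"
      unfolding power2_norm_eq_inner T_def \<alpha>_def
      by (simp add: inner_diff_left inner_diff_right inner_commute[of v e] ee power2_eq_square)
    then have T2: "(norm T)\<^sup>2 = (norm v)\<^sup>2 - \<alpha>\<^sup>2" by simp
    have Tv: "norm T \<le> norm v" by (rule power2_le_imp_le) (simp_all add: T2)
    have "Q v v = Q T T + \<alpha> * (Q T e + Q e T) + \<alpha> * \<alpha> * Q e e"
      by (subst (1 2) \<open>v = T + \<alpha> *\<^sub>R e\<close>)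
        (simp add: linear_add[OF QL] linear_add[OF QR] linear_cmul[OF QL] linear_cmul[OF QR] algebra_simps)
    moreover have "\<bar>\<alpha> * (Q T e + Q e T)\<bar> \<le> \<bar>\<alpha>\<bar> * (2 * B0 * norm v)"
    proof -
      have "\<bar>Q T e + Q e T\<bar> \<le> 2 * B0 * norm T"
        using B0(2)[of T e] B0(2)[of e T] e by simp
      also have "\<dots> \<le> 2 * B0 * norm v" using Tv B0 by (intro mult_left_mono) auto
      finally show ?thesis unfolding abs_mult by (intro mult_left_mono) auto
    qed
    moreover have "\<bar>\<alpha> * \<alpha> * Q e e\<bar> \<le> \<bar>\<alpha>\<bar> * (norm v * B0)"
      unfolding abs_mult mult.assoc using \<alpha>v B0(2)[of e e] e by (intro mult_left_mono mult_mono) auto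
    moreover have "k * (norm T)\<^sup>2 \<le> Q T T" unfolding Q_def by (rule hess[OF eT])
    moreover have "k * \<alpha>\<^sup>2 \<le> k * (\<bar>\<alpha>\<bar> * norm v)"
      unfolding power2_eq_square abs_mult_self_eq[of \<alpha>, symmetric]
      using \<alpha>v k by (intro mult_left_mono) auto
    ultimately show ?thesis
      unfolding T2 B_def \<alpha>_def[symmetric] by (simp add: algebra_simps abs_le_iff)
  qed
  obtain r1 where r1: "r1 > 0" "ball e r1 \<subseteq> W" "\<And>p z. p \<in> ball e r1 \<Longrightarrow> z \<in> ball e r1 \<Longrightarrow>
     \<bar>\<rho> z - \<rho> p - frechet_derivative \<rho> (at p) (z - p) - Q (z - p) (z - p) / 2\<bar> \<le> k / 8 * (norm (z - p))\<^sup>2"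
    using smooth_on_taylor_second[OF W, of "k / 8"] k(1) unfolding Q_def by auto
  have "cball e (r1 / 2) \<subseteq> W" using r1 by (auto simp: subset_eq)
  then obtain L where L: "L \<ge> 0" "\<And>x y v. x \<in> cball e (r1/2) \<Longrightarrow> y \<in> cball e (r1/2) \<Longrightarrow>
      norm (frechet_derivative \<rho> (at x) v - frechet_derivative \<rho> (at y) v) \<le> L * norm (x - y) * norm v"
    using smooth_on_lipschitz_derivative[OF W(2) compact_cball convex_cball] by metis
  \<comment> \<open>Since \<open>norm v \<le> 2 * r\<close>, the second bound gives
    \<open>B * norm v \<le> k\<close>; the third absorbs the variation of the derivative between
    \<open>e\<close> and \<open>p\<close>.\<close>
  define r where "r = min (r1 / 2) (min (k / (2 * B)) (k\<^sup>2 / (4 * B * (L + 1))))"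
  have r: "r > 0" "r \<le> r1 / 2" "B * r \<le> k / 2" "B * (L * r) \<le> k\<^sup>2 / 4"
  proof -
    show "r > 0" using r1 k B L by (simp add: r_def)
    show "r \<le> r1 / 2" by (simp add: r_def)
    have "r \<le> k / (2 * B)" by (simp add: r_def)
    then show "B * r \<le> k / 2" using B by (simp add: pos_le_divide_eq mult_ac)
    have "r \<le> k\<^sup>2 / (4 * B * (L + 1))" by (simp add: r_def)
    then have "B * ((L + 1) * r) \<le> k\<^sup>2 / 4" using B L by (simp add: pos_le_divide_eq mult_ac)
    moreover have "B * (L * r) \<le> B * ((L + 1) * r)"
      using B \<open>r > 0\<close> by (intro mult_left_mono mult_right_mono) auto
    ultimately show "B * (L * r) \<le> k\<^sup>2 / 4" by linarith
  qed
  have "k / 6 * (norm (z - p))\<^sup>2 \<le> - frechet_derivative \<rho> (at p) (z - p)"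
    if pz: "p \<in> ball e r" "z \<in> ball e r" "\<rho> z \<le> \<rho> p" for p z
  proof -
    define v where "v = z - p"
    define x where "x = - frechet_derivative \<rho> (at p) v"
    define y where "y = \<bar>e \<bullet> v\<bar> * norm v"
    have v2r: "norm v \<le> 2 * r"
      using pz norm_triangle_ineq4[of "z - e" "p - e"] by (simp add: v_def dist_norm norm_minus_commute)
    have "p \<in> ball e r1" "z \<in> ball e r1" using pz r(2) r1(1) by auto
    from r1(3)[OF this] have "Q v v / 2 - k / 8 * (norm v)\<^sup>2 \<le> x"
      using pz(3) unfolding v_def x_def by linarith
    then have 1: "3 / 8 * k * (norm v)\<^sup>2 - B / 2 * y \<le> x"
      using Q_ge[of v] by (simp add: y_def)
    have "norm (frechet_derivative \<rho> (at e) v - frechet_derivative \<rho> (at p) v) \<le> L * norm (e - p) * norm v"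
      using pz r r1 by (intro L(2)) auto
    also have "\<dots> \<le> L * r * norm v"
      using pz(1) L by (intro mult_right_mono mult_left_mono) (auto simp: dist_norm)
    finally have "\<bar>k * (e \<bullet> v) + x\<bar> \<le> L * r * norm v" by (simp add: k(2) x_def)
    then have "k * \<bar>e \<bullet> v\<bar> \<le> \<bar>x\<bar> + L * r * norm v"
      using k(1) abs_mult[of k "e \<bullet> v"] by linarith
    then have "k * \<bar>e \<bullet> v\<bar> * (B * norm v) \<le> (\<bar>x\<bar> + L * r * norm v) * (B * norm v)"
      using B by (intro mult_right_mono) auto
    then have "k * (B * y) \<le> \<bar>x\<bar> * (B * norm v) + B * (L * r) * (norm v)\<^sup>2"
      by (simp add: y_def algebra_simps power2_eq_square)
    also have "\<dots> \<le> \<bar>x\<bar> * k + k\<^sup>2 / 4 * (norm v)\<^sup>2"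
    proof (intro add_mono mult_left_mono mult_right_mono r)
      have "B * norm v \<le> B * (2 * r)" using v2r B by (intro mult_left_mono) auto
      then show "B * norm v \<le> k" using r(3) by simp
    qed auto
    also have "\<dots> = k * (\<bar>x\<bar> + k / 4 * (norm v)\<^sup>2)" by (simp add: algebra_simps power2_eq_square)
    finally have "B * y \<le> \<bar>x\<bar> + k / 4 * (norm v)\<^sup>2" using k(1) by simp
    \<comment> \<open>For negative \<open>x\<close> the right side is \<open>x / 2 < 0\<close>,
      which is impossible; otherwise it is \<open>3 / 2 * x\<close>, whence the constant
      \<open>k / 6\<close>.\<close>
    then have "k / 4 * (norm v)\<^sup>2 \<le> x + \<bar>x\<bar> / 2" using 1 by (simp add: algebra_simps)
    moreover have "0 \<le> k * (norm v)\<^sup>2" using k by simp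
    ultimately have "k / 6 * (norm v)\<^sup>2 \<le> x" by (simp add: abs_if split: if_splits)
    then show ?thesis by (simp add: x_def v_def)
  qed
  then show ?thesis
    using r r1 k by (intro exI[of _ r] conjI exI[of _ "k / 6"]) auto
qed

text \<open>For \<open>z\<close> near \<open>e\<close> this is local strict convexity. Away from
  \<open>e\<close>, the containment of the domain in the unit ball keeps \<open>z\<close> below the
  tangent plane at \<open>e\<close> by a fixed amount, and tilting this plane to the one at a nearby
  \<open>p\<close> loses only part of it.\<close>

lemma supporting_planes_near:
  fixes \<rho> :: "'a::euclidean_space \<Rightarrow> real"
  assumes W: "open W" "smooth_on W \<rho>" "frontier \<Omega> \<subseteq> W" "\<Omega> \<inter> W = {z \<in> W. \<rho> z < 0}"
    and zero: "\<And>q. q \<in> frontier \<Omega> \<Longrightarrow> \<rho> q = 0"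
    and ball: "\<And>z. z \<in> \<Omega> \<Longrightarrow> norm z \<le> 1"
    and e: "e \<in> frontier \<Omega>" "norm e = 1"
    and k: "k > 0" "\<And>v. frechet_derivative \<rho> (at e) v = k * (e \<bullet> v)"
  shows "\<exists>r>0. \<exists>c>0. \<forall>p\<in>frontier \<Omega> \<inter> cball e r. \<forall>z\<in>\<Omega> \<union> frontier \<Omega>.
     c * (norm (z - p))\<^sup>2 \<le> - frechet_derivative \<rho> (at p) (z - p)"
proof -
  have eW: "e \<in> W" using e W by blast
  have \<rho>_ball: "norm z \<le> 1" if "z \<in> W" "\<rho> z < 0" for z using that ball W(4) by blast
  have hess: "k * (norm v)\<^sup>2 \<le> second_derivative \<rho> e v v" if "e \<bullet> v = 0" for v
    using tangential_hessian_ge[OF W(1,2) eW zero[OF e(1)] e(2) k \<rho>_ball that] .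
  obtain r1 c1 where r1: "r1 > 0" "c1 > 0" "ball e r1 \<subseteq> W" "\<And>p z. p \<in> ball e r1 \<Longrightarrow> z \<in> ball e r1 \<Longrightarrow>
     \<rho> z \<le> \<rho> p \<Longrightarrow> c1 * (norm (z - p))\<^sup>2 \<le> - frechet_derivative \<rho> (at p) (z - p)"
    using strictly_convex_near[OF W(1,2) eW e(2) k hess] by blast
  have "cball e (r1 / 2) \<subseteq> W" using r1 by (auto simp: subset_eq)
  then obtain L where L: "L \<ge> 0" "\<And>x y v. x \<in> cball e (r1/2) \<Longrightarrow> y \<in> cball e (r1/2) \<Longrightarrow>
      norm (frechet_derivative \<rho> (at x) v - frechet_derivative \<rho> (at y) v) \<le> L * norm (x - y) * norm v"
    using smooth_on_lipschitz_derivative[OF W(2) compact_cball convex_cball] by metis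
  \<comment> \<open>Moving the base point from \<open>e\<close> to \<open>p\<close> costs
    \<open>k * r\<close> for the position and \<open>2 * L * r\<close> for the gradient, since
    \<open>norm (z - p) \<le> 2\<close>.\<close>
  define r where "r = min (r1 / 2) (k * r1\<^sup>2 / (4 * (k + 2 * L)))"
  have r: "r > 0" "r \<le> r1 / 2" "(k + 2 * L) * r \<le> k * r1\<^sup>2 / 4"
  proof -
    have kL: "k + 2 * L > 0" using k L by simp
    then show "r > 0" using r1 k by (simp add: r_def)
    show "r \<le> r1 / 2" unfolding r_def by (rule min.cobounded1)
    have "r \<le> k * r1\<^sup>2 / (4 * (k + 2 * L))" unfolding r_def by (rule min.cobounded2)
    moreover have "0 < 4 * (k + 2 * L)" using kL by simp
    ultimately have "r * (4 * (k + 2 * L)) \<le> k * r1\<^sup>2" by (simp only: pos_le_divide_eq)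
    then show "(k + 2 * L) * r \<le> k * r1\<^sup>2 / 4" by (simp add: mult_ac)
  qed
  define c where "c = min c1 (k * r1\<^sup>2 / 16)"
  have c: "c > 0" "c \<le> c1" "c \<le> k * r1\<^sup>2 / 16" using r1 k by (auto simp: c_def)
  have cl: "norm z \<le> 1" if "z \<in> \<Omega> \<union> frontier \<Omega>" for z
  proof -
    have "closure \<Omega> \<subseteq> cball 0 1" using ball by (intro closure_minimal) auto
    then show ?thesis using that closure_subset[of \<Omega>] by (auto simp: frontier_def)
  qed
  have "c * (norm (z - p))\<^sup>2 \<le> - frechet_derivative \<rho> (at p) (z - p)"
    if p: "p \<in> frontier \<Omega> \<inter> cball e r" and z: "z \<in> \<Omega> \<union> frontier \<Omega>" for p z
  proof (cases "z \<in> ball e r1")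
    case True
    have "z \<in> W" using True r1(3) by blast
    then have "\<rho> z \<le> 0" using z zero W(4) by force
    moreover have "\<rho> p = 0" using zero p by blast
    ultimately have "\<rho> z \<le> \<rho> p" by simp
    then have "c1 * (norm (z - p))\<^sup>2 \<le> - frechet_derivative \<rho> (at p) (z - p)"
      using r1 r p True by (intro r1(4)) auto
    moreover have "c * (norm (z - p))\<^sup>2 \<le> c1 * (norm (z - p))\<^sup>2" using c by (intro mult_right_mono) auto
    ultimately show ?thesis by linarith
  next
    case False
    have lin: "linear (frechet_derivative \<rho> (at e))"
      using W eW by (intro linear_frechet_derivative smooth_on_differentiable[OF W(2)])
    have "r1 \<le> norm (z - e)" using False by (simp add: dist_norm norm_minus_commute)
    \<comment> \<open>Strict convexity of the unit ball itself: for \<open>norm z \<le> 1\<close>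
      one has \<open>(norm (z - e))\<^sup>2 \<le> 2 * (e \<bullet> (e - z))\<close>.\<close>
    then have "r1\<^sup>2 \<le> (norm (z - e))\<^sup>2" using r1 by (intro power_mono) auto
    also have "\<dots> = (norm z)\<^sup>2 + 1 - 2 * (e \<bullet> z)"
      using e(2) by (simp add: power2_norm_eq_inner inner_diff_left inner_diff_right inner_commute[of z e] norm_eq_1)
    also have "\<dots> \<le> 2 * (e \<bullet> (e - z))"
      using cl[OF z] e(2) by (simp add: inner_diff_right norm_eq_1 power_le_one)
    finally have 1: "k * (r1\<^sup>2 / 2) \<le> k * (e \<bullet> (e - z))" using k(1) by (intro mult_left_mono) auto
    have zp: "norm (z - p) \<le> 2" using cl[OF z] cl[of p] p norm_triangle_ineq4[of z p] by auto
    have "\<bar>e \<bullet> (p - e)\<bar> \<le> norm (p - e)" using Cauchy_Schwarz_ineq2[of e "p - e"] e(2) by simp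
    also have "\<dots> \<le> r" using p by (simp add: dist_norm norm_minus_commute)
    finally have "k * \<bar>e \<bullet> (p - e)\<bar> \<le> k * r" using k by (intro mult_left_mono) auto
    then have 2: "- (k * r) \<le> k * (e \<bullet> (p - e))" using k(1) abs_mult[of k "e \<bullet> (p - e)"] by linarith
    have "norm (frechet_derivative \<rho> (at e) (z - p) - frechet_derivative \<rho> (at p) (z - p)) \<le> L * norm (e - p) * norm (z - p)"
      using p r r1 by (intro L(2)) auto
    also have "\<dots> \<le> L * r * 2"
      using p L zp r by (intro mult_mono) (auto simp: dist_norm)
    finally have 3: "- (L * r * 2) \<le> k * (e \<bullet> (z - p)) - frechet_derivative \<rho> (at p) (z - p)"
      by (simp add: k(2))
    have "k * (e \<bullet> (z - p)) = - (k * (e \<bullet> (e - z))) - k * (e \<bullet> (p - e))" by (simp add: inner_diff_right algebra_simps)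
    then have "k * (r1\<^sup>2 / 2) - (k * r) - L * r * 2 \<le> - frechet_derivative \<rho> (at p) (z - p)"
      using 1 2 3 by linarith
    then have 4: "k * r1\<^sup>2 / 4 \<le> - frechet_derivative \<rho> (at p) (z - p)"
      using r(3) by (simp add: algebra_simps)
    have "c * (norm (z - p))\<^sup>2 \<le> (k * r1\<^sup>2 / 16) * 2\<^sup>2"
      using c zp k by (intro mult_mono power_mono) auto
    then show ?thesis using 4 by simp
  qed
  then show ?thesis using r c by blast
qed

text \<open>A uniform interior ball condition. The boundary falls below its tangent plane at most
  quadratically, with constant \<open>K\<close>; hence for \<open>2 * t * K < 1\<close> the closed
  ball around \<open>p - t *\<^sub>R N p\<close> through \<open>p\<close> meets the boundary only in
  \<open>p\<close>.\<close>

lemma closest_point_normal: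
  fixes \<rho> :: "'a::euclidean_space \<Rightarrow> real"
  assumes W: "open W" "smooth_on W \<rho>" "frontier \<Omega> \<subseteq> W" "\<Omega> \<inter> W = {z \<in> W. \<rho> z < 0}"
    and zero: "\<And>q. q \<in> frontier \<Omega> \<Longrightarrow> \<rho> q = 0"
    and e: "e \<in> frontier \<Omega>"
    and N: "\<And>p v. p \<in> W \<Longrightarrow> frechet_derivative \<rho> (at p) v = N p \<bullet> v" "\<And>p. p \<in> frontier \<Omega> \<Longrightarrow> norm (N p) \<le> C" "C > 0"
  shows "\<exists>r>0. \<exists>t0>0. \<forall>p\<in>frontier \<Omega> \<inter> cball e r. \<forall>t. 0 < t \<longrightarrow> t < t0 \<longrightarrow> N p \<noteq> 0 \<longrightarrow>
     p - t *\<^sub>R N p \<in> \<Omega> \<and> closest_point (frontier \<Omega>) (p - t *\<^sub>R N p) = p"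
proof -
  have eW: "e \<in> W" using e W by blast
  then obtain r0 where r0: "r0 > 0" "cball e r0 \<subseteq> W"
    using W(1) open_contains_cball by blast
  obtain B where B: "B \<ge> 0" "\<And>x y. x \<in> cball e r0 \<Longrightarrow> y \<in> cball e r0 \<Longrightarrow>
      norm (\<rho> y - \<rho> x - frechet_derivative \<rho> (at x) (y - x)) \<le> B * (norm (y - x))\<^sup>2"
    using smooth_on_taylor_first[OF W(2) compact_cball convex_cball r0(2)] by metis
  \<comment> \<open>\<open>B\<close> handles boundary points near \<open>e\<close> by Taylor's
    formula; \<open>2 * C / r0\<close> handles those at distance at least \<open>r0 / 2\<close> from
    \<open>p\<close>, by the bound on \<open>N\<close> alone.\<close>
  define K where "K = B + 2 * C / r0"
  have K: "K > 0" "B \<le> K" "2 * C / r0 \<le> K" using B N(3) r0 by (auto simp: K_def intro: add_nonneg_pos)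
  have below: "- (K * (norm (q - p))\<^sup>2) \<le> N p \<bullet> (q - p)"
    if p: "p \<in> frontier \<Omega> \<inter> cball e (r0 / 2)" and q: "q \<in> frontier \<Omega>" for p q
  proof (cases "q \<in> cball e r0")
    case True
    have pc: "p \<in> cball e r0" "p \<in> W" using p r0 W(3) by auto
    have "\<rho> p = 0" "\<rho> q = 0" using zero p q by auto
    with B(2)[OF pc(1) True] have "\<bar>N p \<bullet> (q - p)\<bar> \<le> B * (norm (q - p))\<^sup>2" by (simp add: N(1)[OF pc(2)])
    also have "\<dots> \<le> K * (norm (q - p))\<^sup>2" using K by (intro mult_right_mono) auto
    finally show ?thesis by linarith
  next
    case False
    have "r0 / 2 \<le> norm (q - p)"
      using False p dist_triangle[of e q p] by (auto simp: dist_norm norm_minus_commute)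
    then have "r0 / 2 * norm (q - p) \<le> (norm (q - p))\<^sup>2"
      unfolding power2_eq_square by (intro mult_right_mono) auto
    then have 1: "2 * C / r0 * (r0 / 2 * norm (q - p)) \<le> 2 * C / r0 * (norm (q - p))\<^sup>2"
      using N(3) r0 by (intro mult_left_mono) auto
    have "\<bar>N p \<bullet> (q - p)\<bar> \<le> norm (N p) * norm (q - p)" by (rule Cauchy_Schwarz_ineq2)
    also have "\<dots> \<le> C * norm (q - p)" using N(2)[of p] p by (intro mult_right_mono) auto
    also have "\<dots> = 2 * C / r0 * (r0 / 2 * norm (q - p))" using r0 by simp
    also note 1
    also have "2 * C / r0 * (norm (q - p))\<^sup>2 \<le> K * (norm (q - p))\<^sup>2" using K by (intro mult_right_mono) auto
    finally show ?thesis by linarith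
  qed
  \<comment> \<open>The first bound makes \<open>p\<close> the nearest boundary point; the second
    keeps the point in the ball where the Taylor estimate holds.\<close>
  define t0 where "t0 = min (1 / (2 * K)) (r0 / (2 * C))"
  have t0: "t0 > 0" using K N r0 by (simp add: t0_def)
  have "p - t *\<^sub>R N p \<in> \<Omega> \<and> closest_point (frontier \<Omega>) (p - t *\<^sub>R N p) = p"
    if p: "p \<in> frontier \<Omega> \<inter> cball e (r0 / 2)" and t: "0 < t" "t < t0" and Np: "N p \<noteq> 0" for p t
  proof
    have pW: "p \<in> W" using p W by blast
    have tK: "2 * t * K < 1"
    proof -
      have "t < 1 / (2 * K)" using t by (simp add: t0_def)
      then show ?thesis using K by (simp add: pos_less_divide_eq mult_ac)
    qed
    have "t * norm (N p) \<le> t * C" using N(2)[of p] p t by (intro mult_left_mono) auto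
    also have "\<dots> \<le> r0 / 2"
    proof -
      have "t < r0 / (2 * C)" using t by (simp add: t0_def)
      then show ?thesis using N(3) by (simp add: pos_less_divide_eq mult_ac)
    qed
    finally have tN: "t * norm (N p) \<le> r0 / 2" .
    let ?z = "p - t *\<^sub>R N p"
    have zc: "?z \<in> cball e r0"
      using p tN t dist_triangle[of e ?z p] by (simp add: dist_norm[of p ?z])
    have pc: "p \<in> cball e r0" using p r0 by auto
    have n2: "0 < t * (norm (N p))\<^sup>2" using t Np by simp
    have "\<bar>\<rho> ?z - \<rho> p - N p \<bullet> (?z - p)\<bar> \<le> B * (norm (?z - p))\<^sup>2"
      using B(2)[OF pc zc] by (simp only: N(1)[OF pW] real_norm_def)
    moreover have "N p \<bullet> (?z - p) = - (t * (norm (N p))\<^sup>2)" by (simp add: power2_norm_eq_inner)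
    moreover have "B * (norm (?z - p))\<^sup>2 = B * t * (t * (norm (N p))\<^sup>2)"
      using t by (simp add: power_mult_distrib power2_eq_square)
    moreover have "\<rho> p = 0" using zero p by blast
    ultimately have "\<rho> ?z \<le> B * t * (t * (norm (N p))\<^sup>2) - t * (norm (N p))\<^sup>2" by linarith
    also have "\<dots> < 0"
    proof -
      have "B * t \<le> K * t" using K t by (intro mult_right_mono) auto
      moreover have "2 * (K * t) < 1" using tK by (simp add: mult_ac)
      moreover have "0 < K * t" using K t by simp
      ultimately have "B * t < 1" by linarith
      then have "B * t * (t * (norm (N p))\<^sup>2) < 1 * (t * (norm (N p))\<^sup>2)" using n2 by (intro mult_strict_right_mono)
      then show ?thesis by simp
    qed
    finally show "?z \<in> \<Omega>" using W(4) zc r0(2) by blast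
    have ex: "closest_point (frontier \<Omega>) ?z \<in> frontier \<Omega>"
      "\<And>y. y \<in> frontier \<Omega> \<Longrightarrow> dist ?z (closest_point (frontier \<Omega>) ?z) \<le> dist ?z y"
      using closest_point_exists[OF frontier_closed, of \<Omega> ?z] e by auto
    define q where "q = closest_point (frontier \<Omega>) ?z"
    have "(dist ?z q)\<^sup>2 \<le> (dist ?z p)\<^sup>2" using ex(2)[of p] p by (intro power_mono) (auto simp: q_def)
    moreover have "(dist ?z p)\<^sup>2 = t\<^sup>2 * (norm (N p))\<^sup>2" by (simp add: dist_norm power_mult_distrib)
    moreover have "(dist ?z q)\<^sup>2 = (norm (q - p))\<^sup>2 + 2 * t * (N p \<bullet> (q - p)) + t\<^sup>2 * (norm (N p))\<^sup>2"
    proof -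
      have "dist ?z q = norm ((q - p) + t *\<^sub>R N p)" by (simp add: dist_norm norm_minus_commute algebra_simps)
      then show ?thesis
        using dot_norm[of "q - p" "t *\<^sub>R N p"] t
        by (simp add: inner_commute[of "q - p"] power_mult_distrib)
    qed
    moreover have "2 * t * (- (K * (norm (q - p))\<^sup>2)) \<le> 2 * t * (N p \<bullet> (q - p))"
      using below[OF p] ex(1) t by (intro mult_left_mono) (auto simp: q_def)
    ultimately have "(1 - 2 * t * K) * (norm (q - p))\<^sup>2 \<le> 0" by (simp add: algebra_simps)
    then show "closest_point (frontier \<Omega>) ?z = p"
      using tK by (simp add: mult_le_0_iff q_def)
  qed
  then show ?thesis using r0(1) t0 by (intro exI[of _ "r0 / 2"] conjI exI[of _ t0]) auto
qed

subsection \<open>The coefficient functions\<close>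

lemma frechet_derivative_cplx:
  assumes "\<rho> differentiable (at z)"
  shows "frechet_derivative (cplx \<rho>) (at z) v = complex_of_real (frechet_derivative \<rho> (at z) v)"
  using frechet_derivative_bounded_linear[OF bounded_linear_of_real assms] .

lemma smooth_on_cplx: "open V \<Longrightarrow> smooth_on V \<rho> \<Longrightarrow> smooth_on V (cplx \<rho>)"
  using smooth_on_bounded_linear[OF _ bounded_linear_of_real] .

lemma smooth_on_wirtinger:
  assumes "open V" "smooth_on V f"
  shows "smooth_on V (dz1 f)" "smooth_on V (dz2 f)" "smooth_on V (dzbar1 f)" "smooth_on V (dzbar2 f)"
proof -
  have *: "smooth_on V (\<lambda>z. 1 / 2 * (frechet_derivative f (at z) a + c * frechet_derivative f (at z) b))" for a b c
    using assms by (intro smooth_on_cmult smooth_on_add smooth_on_frechet_derivative)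
  have "dz1 f = (\<lambda>z. 1 / 2 * (frechet_derivative f (at z) (1, 0) + (- \<i>) * frechet_derivative f (at z) (\<i>, 0)))"
    "dz2 f = (\<lambda>z. 1 / 2 * (frechet_derivative f (at z) (0, 1) + (- \<i>) * frechet_derivative f (at z) (0, \<i>)))"
    "dzbar1 f = (\<lambda>z. 1 / 2 * (frechet_derivative f (at z) (1, 0) + \<i> * frechet_derivative f (at z) (\<i>, 0)))"
    "dzbar2 f = (\<lambda>z. 1 / 2 * (frechet_derivative f (at z) (0, 1) + \<i> * frechet_derivative f (at z) (0, \<i>)))"
    by (simp_all add: fun_eq_iff dz1_def dz2_def dzbar1_def dzbar2_def)
  then show "smooth_on V (dz1 f)" "smooth_on V (dz2 f)" "smooth_on V (dzbar1 f)" "smooth_on V (dzbar2 f)"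
    by (simp_all only: *)
qed

definition smooth_field :: "c2 set \<Rightarrow> vfield \<Rightarrow> bool" where
  "smooth_field V X \<longleftrightarrow> (\<forall>i. smooth_on V (\<lambda>z. X z $ i))"

lemma smooth_on_field_apply:
  assumes "open V" "smooth_field V X" "smooth_on V f"
  shows "smooth_on V (field_apply X f)"
proof -
  have "smooth_on V (\<lambda>z. X z $ 1 * dz1 f z + X z $ 2 * dz2 f z + X z $ 3 * dzbar1 f z + X z $ 4 * dzbar2 f z)"
    using assms smooth_on_wirtinger[OF assms(1,3)]
    by (intro smooth_on_add smooth_on_mult) (auto simp: smooth_field_def)
  then show ?thesis by (simp add: field_apply_def[abs_def])
qed

lemma smooth_field_commutator:
  "open V \<Longrightarrow> smooth_field V X \<Longrightarrow> smooth_field V Y \<Longrightarrow> smooth_field V (commutator X Y)"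
  by (subst smooth_field_def) (simp add: commutator_def smooth_on_diff smooth_on_field_apply smooth_field_def)

lemma smooth_field_L:
  assumes "open V" "smooth_on V \<rho>"
  shows "smooth_field V (field_L \<rho>)" "smooth_field V (field_Lbar \<rho>)"
  using smooth_on_wirtinger[OF assms(1) smooth_on_cplx[OF assms]] assms(1)
  by (auto simp: smooth_field_def forall_4 field_L_def field_Lbar_def vector_4_nth
      intro: smooth_on_minus smooth_on_const)

lemma iterated_commutator_smooth:
  assumes "open V" "smooth_on V \<rho>" "iterated_commutator \<rho> k X"
  shows "smooth_field V X"
  using assms(3) by induction (use assms smooth_field_L smooth_field_commutator in auto)

lemma finite_iterated_commutators: "finite {X. iterated_commutator \<rho> k X}"
proof (induction k)
  case 0
  have "{X. iterated_commutator \<rho> 0 X} = {}" by (auto elim: iterated_commutator.cases)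
  then show ?case by simp
next
  case (Suc k)
  have sub: "{X. iterated_commutator \<rho> (Suc k) X} \<subseteq> {field_L \<rho>, field_Lbar \<rho>}
      \<union> commutator (field_L \<rho>) ` {X. iterated_commutator \<rho> k X}
      \<union> commutator (field_Lbar \<rho>) ` {X. iterated_commutator \<rho> k X}"
    by (auto elim: iterated_commutator.cases)
  show ?case by (rule finite_subset[OF sub]) (use Suc in simp)
qed

text \<open>Finiteness matters because the sum in \<open>Lambda\<close> would be 0 over an infinite
  collection.\<close>

lemma commutator_basis_finite:
  assumes "commutator_basis \<rho> V k M"
  shows "finite M"
proof (rule finite_subset)
  show "M \<subseteq> (\<Union>j\<in>{..k}. {X. iterated_commutator \<rho> j X})"
    using assms unfolding commutator_basis_def by auto
qed (simp add: finite_iterated_commutators)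

lemma commutator_basis_smooth:
  assumes "commutator_basis \<rho> V k M" "open V" "smooth_on V \<rho>" "X \<in> M"
  shows "smooth_field V X"
proof -
  obtain j where "iterated_commutator \<rho> j X"
    using assms(1,4) unfolding commutator_basis_def by blast
  then show ?thesis by (rule iterated_commutator_smooth[OF assms(2,3)])
qed

text \<open>Off the fields tangent to the level sets of \<open>\<rho>\<close>, \<open>T_coeff\<close> takes an unspecified value
  that does not depend on the point, so boundedness holds there too.\<close>

lemma T_coeff_bounded:
  assumes V: "open V" "smooth_on V \<rho>" "\<And>z. z \<in> V \<Longrightarrow> dz1 (cplx \<rho>) z \<noteq> 0 \<and> dzbar1 (cplx \<rho>) z \<noteq> 0"
    and X: "smooth_field V X" and K: "compact K" "K \<subseteq> V"
  shows "\<exists>B. \<forall>z\<in>K. cmod (T_coeff \<rho> X z) \<le> B"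
proof -
  \<comment> \<open>Solves \<open>X = c T + a L + b Lbar\<close> for \<open>c\<close>: component 2
    gives \<open>a\<close>, and component 1 then gives \<open>c\<close>.\<close>
  define g where "g z = (X z $ 1 + X z $ 2 / dz1 (cplx \<rho>) z * dz2 (cplx \<rho>) z) / dzbar1 (cplx \<rho>) z" for z
  note w = smooth_on_wirtinger[OF V(1) smooth_on_cplx[OF V(1,2)], THEN smooth_on_continuous, THEN continuous_on_subset[OF _ K(2)]]
  have Xc: "continuous_on K (\<lambda>z. X z $ i)" for i
    using X smooth_on_continuous continuous_on_subset[OF _ K(2)] unfolding smooth_field_def by blast
  have "continuous_on K g"
    unfolding g_def using V(3) K(2) by (intro continuous_intros Xc w) auto
  then have "bounded (g ` K)" by (intro compact_imp_bounded compact_continuous_image K(1))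
  then obtain B where "\<forall>w\<in>g ` K. cmod w \<le> B" unfolding bounded_iff by blast
  then have B: "cmod (g z) \<le> B" if "z \<in> K" for z using that by simp
  have "cmod (T_coeff \<rho> X z) \<le> max B (cmod (THE c::complex. False))" if z: "z \<in> K" for z
  proof (cases "\<exists>c a b. X z = c *s field_T \<rho> z + a *s field_L \<rho> z + b *s field_Lbar \<rho> z")
    case True
    then obtain c a b where c: "X z = c *s field_T \<rho> z + a *s field_L \<rho> z + b *s field_Lbar \<rho> z" by blast
    have nz: "dz1 (cplx \<rho>) z \<noteq> 0" "dzbar1 (cplx \<rho>) z \<noteq> 0" using V(3)[OF subsetD[OF K(2) z]] by auto
    have "X z $ 1 = c * dzbar1 (cplx \<rho>) z - a * dz2 (cplx \<rho>) z" "X z $ 2 = a * dz1 (cplx \<rho>) z"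
      unfolding c by (simp_all add: field_T_def field_L_def field_Lbar_def vector_4_nth)
    then have "g z = c" using nz by (simp add: g_def)
    then show ?thesis using T_coeff_eq[of \<rho> z X c a b, OF nz c] B[OF z] by simp
  next
    case False
    then have "T_coeff \<rho> X z = (THE c. False)" unfolding T_coeff_def by (intro arg_cong[where f=The]) blast
    then show ?thesis by simp
  qed
  then show ?thesis by blast
qed

lemma Lambda_bounded:
  assumes V: "open V" "smooth_on V \<rho>" "\<And>z. z \<in> V \<Longrightarrow> dz1 (cplx \<rho>) z \<noteq> 0 \<and> dzbar1 (cplx \<rho>) z \<noteq> 0"
    and M: "commutator_basis \<rho> V k M" and K: "compact K" "K \<subseteq> V"
  shows "\<exists>B. \<forall>z\<in>K. Lambda \<rho> M z \<le> B"
proof -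
  have "\<forall>X\<in>M. \<exists>B. \<forall>z\<in>K. cmod (T_coeff \<rho> X z) \<le> B"
    using T_coeff_bounded[OF V commutator_basis_smooth[OF M V(1,2)] K] by blast
  then obtain B where B: "\<And>X z. X \<in> M \<Longrightarrow> z \<in> K \<Longrightarrow> cmod (T_coeff \<rho> X z) \<le> B X"
    by metis
  have "Lambda \<rho> M z \<le> sqrt (\<Sum>X\<in>M. (B X)\<^sup>2)" if "z \<in> K" for z
    unfolding Lambda_def using B that by (intro real_sqrt_le_mono sum_mono power_mono) auto
  then show ?thesis by blast
qed

lemma Lambda_nonneg: "0 \<le> Lambda \<rho> M z"
  unfolding Lambda_def by (intro real_sqrt_ge_zero sum_nonneg) auto

lemma Lambda_ge:
  assumes "finite M" "X \<in> M"
  shows "cmod (T_coeff \<rho> X z) \<le> Lambda \<rho> M z"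
  unfolding Lambda_def using assms member_le_sum[of X M "\<lambda>X. (cmod (T_coeff \<rho> X z))\<^sup>2"]
  by (intro real_le_rsqrt) auto

section \<open>The Levi form as the coefficient of the first commutator\<close>

lemma second_derivative_cplx:
  assumes "open V" "smooth_on V \<rho>" "z \<in> V"
  shows "second_derivative (cplx \<rho>) z a b = complex_of_real (second_derivative \<rho> z a b)"
proof -
  have "((\<lambda>y. complex_of_real (frechet_derivative \<rho> (at y) a)) has_derivative
      (\<lambda>b. complex_of_real (second_derivative \<rho> z a b))) (at z)"
    unfolding second_derivative_def
    by (rule bounded_linear.has_derivative[OF bounded_linear_of_real
          smooth_on_has_derivative[OF smooth_on_frechet_derivative[OF assms(2)] assms(3)]])
  then have "((\<lambda>y. frechet_derivative (cplx \<rho>) (at y) a) has_derivative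
      (\<lambda>b. complex_of_real (second_derivative \<rho> z a b))) (at z)"
    by (rule has_derivative_transform_within_open[OF _ assms(1,3)])
      (simp add: frechet_derivative_cplx smooth_on_differentiable[OF assms(2)])
  then show ?thesis unfolding second_derivative_def[of "cplx \<rho>"] by (simp add: frechet_derivative_eqI)
qed

lemma frechet_derivative_wirtinger:
  fixes f :: "c2 \<Rightarrow> complex"
  assumes "smooth_on V f" "z \<in> V"
  defines "h \<equiv> second_derivative f z"
  shows "frechet_derivative (dz1 f) (at z) v = (h (1, 0) v - \<i> * h (\<i>, 0) v) / 2"
    "frechet_derivative (dz2 f) (at z) v = (h (0, 1) v - \<i> * h (0, \<i>) v) / 2"
    "frechet_derivative (dzbar1 f) (at z) v = (h (1, 0) v + \<i> * h (\<i>, 0) v) / 2"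
    "frechet_derivative (dzbar2 f) (at z) v = (h (0, 1) v + \<i> * h (0, \<i>) v) / 2"
proof -
  have d: "((\<lambda>y. frechet_derivative f (at y) a) has_derivative h a) (at z)" for a
    using smooth_on_has_derivative[OF smooth_on_frechet_derivative[OF assms(1)] assms(2)]
    unfolding h_def second_derivative_def[abs_def] .
  have m: "((\<lambda>y. (frechet_derivative f (at y) a - \<i> * frechet_derivative f (at y) b) / 2) has_derivative
      (\<lambda>v. (h a v - \<i> * h b v) / 2)) (at z)" for a b
    by (auto intro!: derivative_eq_intros d)
  have p: "((\<lambda>y. (frechet_derivative f (at y) a + \<i> * frechet_derivative f (at y) b) / 2) has_derivative
      (\<lambda>v. (h a v + \<i> * h b v) / 2)) (at z)" for a b
    by (auto intro!: derivative_eq_intros d)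
  show "frechet_derivative (dz1 f) (at z) v = (h (1, 0) v - \<i> * h (\<i>, 0) v) / 2"
    "frechet_derivative (dz2 f) (at z) v = (h (0, 1) v - \<i> * h (0, \<i>) v) / 2"
    "frechet_derivative (dzbar1 f) (at z) v = (h (1, 0) v + \<i> * h (\<i>, 0) v) / 2"
    "frechet_derivative (dzbar2 f) (at z) v = (h (0, 1) v + \<i> * h (0, \<i>) v) / 2"
    unfolding dz1_def[abs_def] dz2_def[abs_def] dzbar1_def[abs_def] dzbar2_def[abs_def]
    by (simp_all only: frechet_derivative_eqI[OF m] frechet_derivative_eqI[OF p])
qed

text \<open>All four identities reduce to the symmetry of the real Hessian.\<close>

lemma wirtinger_commute:
  assumes "open V" "smooth_on V \<rho>" "z \<in> V"
  shows "dz1 (dzbar1 (cplx \<rho>)) z = dzbar1 (dz1 (cplx \<rho>)) z" "dz1 (dzbar2 (cplx \<rho>)) z = dzbar2 (dz1 (cplx \<rho>)) z"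
    "dz2 (dzbar1 (cplx \<rho>)) z = dzbar1 (dz2 (cplx \<rho>)) z" "dz2 (dzbar2 (cplx \<rho>)) z = dzbar2 (dz2 (cplx \<rho>)) z"
proof -
  note F = frechet_derivative_wirtinger[OF smooth_on_cplx[OF assms(1,2)] assms(3)]
  define h where "h a b = second_derivative (cplx \<rho>) z a b" for a b
  have sym: "h a b = h b a" for a b
    unfolding h_def second_derivative_cplx[OF assms] by (simp add: second_derivative_symmetric[OF assms, of a b])
  note D = dz1_def[of "dzbar1 (cplx \<rho>)"] dz1_def[of "dzbar2 (cplx \<rho>)"]
    dz2_def[of "dzbar1 (cplx \<rho>)"] dz2_def[of "dzbar2 (cplx \<rho>)"]
    dzbar1_def[of "dz1 (cplx \<rho>)"] dzbar1_def[of "dz2 (cplx \<rho>)"]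
    dzbar2_def[of "dz1 (cplx \<rho>)"] dzbar2_def[of "dz2 (cplx \<rho>)"]
  show "dz1 (dzbar1 (cplx \<rho>)) z = dzbar1 (dz1 (cplx \<rho>)) z"
    unfolding D F h_def[symmetric] using sym[of "(1,0)" "(\<i>,0)"]
    by (simp add: algebra_simps add_divide_distrib diff_divide_distrib)
  show "dz1 (dzbar2 (cplx \<rho>)) z = dzbar2 (dz1 (cplx \<rho>)) z"
    unfolding D F h_def[symmetric]
    using sym[of "(1,0)" "(0,1)"] sym[of "(1,0)" "(0,\<i>)"] sym[of "(\<i>,0)" "(0,1)"] sym[of "(\<i>,0)" "(0,\<i>)"]
    by (simp add: algebra_simps add_divide_distrib diff_divide_distrib)
  show "dz2 (dzbar1 (cplx \<rho>)) z = dzbar1 (dz2 (cplx \<rho>)) z"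
    unfolding D F h_def[symmetric]
    using sym[of "(1,0)" "(0,1)"] sym[of "(1,0)" "(0,\<i>)"] sym[of "(\<i>,0)" "(0,1)"] sym[of "(\<i>,0)" "(0,\<i>)"]
    by (simp add: algebra_simps add_divide_distrib diff_divide_distrib)
  show "dz2 (dzbar2 (cplx \<rho>)) z = dzbar2 (dz2 (cplx \<rho>)) z"
    unfolding D F h_def[symmetric] using sym[of "(0,1)" "(0,\<i>)"]
    by (simp add: algebra_simps add_divide_distrib diff_divide_distrib)
qed

text \<open>The Levi form of \<rho> on the tangential field \<open>L\<close>, written as the
  holomorphic differential of \<rho> applied to the commutator of \<open>L\<close> and
  \<open>Lbar\<close>.\<close>

definition levi :: "(c2 \<Rightarrow> real) \<Rightarrow> c2 \<Rightarrow> complex" where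
  "levi \<rho> z = dz1 (cplx \<rho>) z * field_apply (field_Lbar \<rho>) (dz2 (cplx \<rho>)) z
     - dz2 (cplx \<rho>) z * field_apply (field_Lbar \<rho>) (dz1 (cplx \<rho>)) z"

lemma smooth_on_levi:
  assumes "open V" "smooth_on V \<rho>"
  shows "smooth_on V (levi \<rho>)"
  unfolding levi_def[abs_def]
  using smooth_on_wirtinger[OF assms(1) smooth_on_cplx[OF assms]] smooth_field_L[OF assms] assms(1)
  by (intro smooth_on_diff smooth_on_mult smooth_on_field_apply) auto

lemma field_apply_const: "field_apply X (\<lambda>_. c) z = 0"
  by (simp add: field_apply_def dz1_def dz2_def dzbar1_def dzbar2_def)

lemma field_apply_minus:
  assumes "f differentiable (at z)"
  shows "field_apply X (\<lambda>w. - f w) z = - field_apply X f z"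
proof -
  have "frechet_derivative (\<lambda>w. - f w) (at z) v = - frechet_derivative f (at z) v" for v
    using frechet_derivative_bounded_linear[OF bounded_linear_minus[OF bounded_linear_ident] assms] by simp
  then show ?thesis
    by (simp add: field_apply_def dz1_def dz2_def dzbar1_def dzbar2_def algebra_simps diff_divide_distrib add_divide_distrib)
qed

text \<open>Components 2 and 4 determine \<open>a\<close> and \<open>b\<close>, and component 1 the
  coefficient of \<open>T\<close>. Component 3 then matches because the commutator annihilates
  \<rho>, which rests on the commutation of mixed Wirtinger derivatives.\<close>

lemma commutator_L_Lbar:
  assumes "open V" "smooth_on V \<rho>" "z \<in> V" "dz1 (cplx \<rho>) z \<noteq> 0" "dzbar1 (cplx \<rho>) z \<noteq> 0"
  shows "\<exists>a b. commutator (field_L \<rho>) (field_Lbar \<rho>) z =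
     (levi \<rho> z / (dz1 (cplx \<rho>) z * dzbar1 (cplx \<rho>) z)) *s field_T \<rho> z + a *s field_L \<rho> z + b *s field_Lbar \<rho> z"
    and "commutator (field_L \<rho>) (field_Lbar \<rho>) z $ 1 * dz1 (cplx \<rho>) z
      + commutator (field_L \<rho>) (field_Lbar \<rho>) z $ 2 * dz2 (cplx \<rho>) z = levi \<rho> z"
proof -
  define X where "X = commutator (field_L \<rho>) (field_Lbar \<rho>) z"
  note sm = smooth_on_wirtinger[OF assms(1) smooth_on_cplx[OF assms(1,2)]]
  note df = smooth_on_differentiable[OF sm(2) assms(3)] smooth_on_differentiable[OF sm(4) assms(3)]
  have X: "X $ 1 = field_apply (field_Lbar \<rho>) (dz2 (cplx \<rho>)) z"
    "X $ 2 = - field_apply (field_Lbar \<rho>) (dz1 (cplx \<rho>)) z"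
    "X $ 3 = - field_apply (field_L \<rho>) (dzbar2 (cplx \<rho>)) z"
    "X $ 4 = field_apply (field_L \<rho>) (dzbar1 (cplx \<rho>)) z"
    unfolding X_def commutator_def
    using field_apply_minus[OF df(1), of "field_Lbar \<rho>"] field_apply_minus[OF df(2), of "field_L \<rho>"]
    by (simp_all add: field_L_def[of \<rho>, THEN fun_cong] field_Lbar_def[of \<rho>, THEN fun_cong]
        vector_4_nth field_apply_const)
  show levi: "X $ 1 * dz1 (cplx \<rho>) z + X $ 2 * dz2 (cplx \<rho>) z = levi \<rho> z"
    unfolding X levi_def by simp
  have tangent: "X $ 1 * dz1 (cplx \<rho>) z + X $ 2 * dz2 (cplx \<rho>) z
      + X $ 3 * dzbar1 (cplx \<rho>) z + X $ 4 * dzbar2 (cplx \<rho>) z = 0"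
    unfolding X field_apply_def field_L_def field_Lbar_def vector_4_nth wirtinger_commute[OF assms(1-3)]
    by (simp add: algebra_simps)
  define r where "r = dz1 (cplx \<rho>) z"
  define r' where "r' = dzbar1 (cplx \<rho>) z"
  have nz: "r \<noteq> 0" "r' \<noteq> 0" using assms by (auto simp: r_def r'_def)
  have "X = (levi \<rho> z / (r * r')) *s field_T \<rho> z + (X $ 2 / r) *s field_L \<rho> z + (X $ 4 / r') *s field_Lbar \<rho> z"
    unfolding vec_eq_iff forall_4
  proof (intro conjI)
    show "X $ 1 = ((levi \<rho> z / (r * r')) *s field_T \<rho> z + (X $ 2 / r) *s field_L \<rho> z + (X $ 4 / r') *s field_Lbar \<rho> z) $ 1"
      using nz levi by (simp add: field_T_def field_L_def field_Lbar_def vector_4_nth flip: r_def r'_def)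
        (simp add: field_simps)
    show "X $ 3 = ((levi \<rho> z / (r * r')) *s field_T \<rho> z + (X $ 2 / r) *s field_L \<rho> z + (X $ 4 / r') *s field_Lbar \<rho> z) $ 3"
      using nz tangent unfolding levi
      by (simp add: field_T_def field_L_def field_Lbar_def vector_4_nth flip: r_def r'_def)
        (simp add: field_simps add_eq_0_iff)
  qed (use nz in \<open>simp_all add: field_T_def field_L_def field_Lbar_def vector_4_nth flip: r_def r'_def\<close>)
  then show "\<exists>a b. X = (levi \<rho> z / (r * r')) *s field_T \<rho> z + a *s field_L \<rho> z + b *s field_Lbar \<rho> z"
    by blast
qed

lemma commutator_antisym: "commutator Y X = (\<lambda>z. - commutator X Y z)"
  by (simp add: commutator_def fun_eq_iff vec_eq_iff)

lemma T_coeff_commutator_L_Lbar: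
  assumes "open V" "smooth_on V \<rho>" "z \<in> V" "dz1 (cplx \<rho>) z \<noteq> 0" "dzbar1 (cplx \<rho>) z \<noteq> 0"
    and X: "X \<in> {commutator (field_L \<rho>) (field_Lbar \<rho>), commutator (field_Lbar \<rho>) (field_L \<rho>)}"
  shows "cmod (T_coeff \<rho> X z) = cmod (levi \<rho> z) / cmod (dz1 (cplx \<rho>) z * dzbar1 (cplx \<rho>) z)"
proof -
  let ?c = "levi \<rho> z / (dz1 (cplx \<rho>) z * dzbar1 (cplx \<rho>) z)"
  obtain a b where ab: "commutator (field_L \<rho>) (field_Lbar \<rho>) z
      = ?c *s field_T \<rho> z + a *s field_L \<rho> z + b *s field_Lbar \<rho> z"
    using commutator_L_Lbar(1)[OF assms(1-5)] by blast
  have "commutator (field_Lbar \<rho>) (field_L \<rho>) z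
      = (- ?c) *s field_T \<rho> z + (- a) *s field_L \<rho> z + (- b) *s field_Lbar \<rho> z"
    unfolding commutator_antisym[of "field_Lbar \<rho>"] ab by (simp add: vec_eq_iff)
  from T_coeff_eq[of \<rho> z "commutator (field_Lbar \<rho>) (field_L \<rho>)", OF assms(4,5) this]
    T_coeff_eq[of \<rho> z "commutator (field_L \<rho>) (field_Lbar \<rho>)", OF assms(4,5) ab] X
  show ?thesis by (auto simp: norm_divide)
qed

lemma iterated_commutator_le_1:
  assumes "iterated_commutator \<rho> j X" "j \<le> 1"
  shows "X = field_L \<rho> \<or> X = field_Lbar \<rho>"
proof -
  have "\<not> iterated_commutator \<rho> 0 Y" for Y by (auto elim: iterated_commutator.cases)
  then show ?thesis using assms by (auto elim: iterated_commutator.cases)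
qed

lemma iterated_commutator_le_2:
  assumes "iterated_commutator \<rho> j X" "j \<le> 2"
  shows "X \<in> {field_L \<rho>, field_Lbar \<rho>, (\<lambda>_. 0),
    commutator (field_L \<rho>) (field_Lbar \<rho>), commutator (field_Lbar \<rho>) (field_L \<rho>)}"
proof -
  have self: "commutator Y Y = (\<lambda>_. 0)" for Y by (simp add: commutator_def fun_eq_iff vec_eq_iff)
  from assms(1) show ?thesis
  proof cases
    case (comm_L k Y)
    then show ?thesis using iterated_commutator_le_1[of \<rho> k Y] assms(2) self by auto
  next
    case (comm_Lbar k Y)
    then show ?thesis using iterated_commutator_le_1[of \<rho> k Y] assms(2) self by auto
  qed auto
qed

text \<open>The holomorphic differential of \<rho> at \<open>e\<close> kills \<open>L\<close> and
  \<open>Lbar\<close> but not their commutator. An independent set without the commutator, in either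
  order, consists of \<open>L\<close> and \<open>Lbar\<close> at most, so the commutator could be
  added to it, against maximality.\<close>

lemma commutator_in_basis:
  assumes V: "open V" "smooth_on V \<rho>" "e \<in> V" "dz1 (cplx \<rho>) e \<noteq> 0" "dzbar1 (cplx \<rho>) e \<noteq> 0"
    and M: "commutator_basis \<rho> V 2 M" and levi: "levi \<rho> e \<noteq> 0"
  shows "commutator (field_L \<rho>) (field_Lbar \<rho>) \<in> M \<or> commutator (field_Lbar \<rho>) (field_L \<rho>) \<in> M"
proof (rule ccontr)
  define Z where "Z = commutator (field_L \<rho>) (field_Lbar \<rho>)"
  assume neg: "\<not> ?thesis"
  have ind: "lin_indep_on V M" using M by (simp add: commutator_basis_def)
  have "(\<lambda>_. 0) \<notin> M"
  proof
    assume "(\<lambda>_. 0) \<in> M"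
    then have "\<forall>X\<in>{\<lambda>_. 0 :: complex ^ 4}. (1::complex) = 0"
      using ind unfolding lin_indep_on_def by (elim allE[of _ "{\<lambda>_. 0}"] allE[of _ "\<lambda>_. 1"]) auto
    then show False by simp
  qed
  then have M_sub: "M \<subseteq> {field_L \<rho>, field_Lbar \<rho>}"
    using M neg iterated_commutator_le_2 unfolding commutator_basis_def by fastforce
  define \<phi> where "\<phi> Y = Y e $ 1 * dz1 (cplx \<rho>) e + Y e $ 2 * dz2 (cplx \<rho>) e" for Y :: vfield
  have \<phi>: "\<phi> (field_L \<rho>) = 0" "\<phi> (field_Lbar \<rho>) = 0" "\<phi> Z = levi \<rho> e"
    using commutator_L_Lbar(2)[OF V] by (simp_all add: \<phi>_def Z_def field_L_def field_Lbar_def vector_4_nth)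
  have "lin_indep_on V (insert Z M)"
    unfolding lin_indep_on_def
  proof (intro allI impI)
    fix F c assume F: "finite F \<and> F \<subseteq> insert Z M \<and> (\<forall>z\<in>V. (\<Sum>X\<in>F. c X *s X z) = 0)"
    have cZ: "c Z = 0" if "Z \<in> F"
    proof -
      have "(\<Sum>X\<in>F. c X *s X e) $ i = 0" for i using F V(3) by simp
      then have "(\<Sum>X\<in>F. c X * X e $ i) = 0" for i by simp
      then have "(\<Sum>X\<in>F. c X * X e $ 1) * dz1 (cplx \<rho>) e + (\<Sum>X\<in>F. c X * X e $ 2) * dz2 (cplx \<rho>) e = 0"
        by simp
      then have "(\<Sum>X\<in>F. c X * \<phi> X) = 0"
        by (simp add: \<phi>_def sum_distrib_right sum.distrib distrib_left mult.assoc)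
      moreover have "(\<Sum>X\<in>F. c X * \<phi> X) = c Z * \<phi> Z + (\<Sum>X\<in>F - {Z}. c X * \<phi> X)"
        using F that by (intro sum.remove) auto
      moreover have "(\<Sum>X\<in>F - {Z}. c X * \<phi> X) = 0"
        using F M_sub \<phi> by (intro sum.neutral) auto
      ultimately show ?thesis using \<phi>(3) levi by simp
    qed
    have "(\<Sum>X\<in>F - {Z}. c X *s X z) = 0" if "z \<in> V" for z
    proof -
      have "(\<Sum>X\<in>F - {Z}. c X *s X z) = (\<Sum>X\<in>F. c X *s X z)"
        using F cZ by (intro sum.mono_neutral_left) auto
      then show ?thesis using F that by simp
    qed
    then have "\<forall>X\<in>F - {Z}. c X = 0"
      using F ind unfolding lin_indep_on_def by (elim allE[of _ "F - {Z}"] allE[of _ c]) auto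
    then show "\<forall>X\<in>F. c X = 0" using cZ by blast
  qed
  moreover have "iterated_commutator \<rho> 2 Z"
    using iterated_commutator.comm_L[OF iterated_commutator.Lbar] by (simp add: Z_def numeral_2_eq_2)
  then have "insert Z M \<subseteq> {X. \<exists>j\<le>2. iterated_commutator \<rho> j X}"
    using M unfolding commutator_basis_def by auto
  ultimately have "insert Z M = M" using M unfolding commutator_basis_def by blast
  then show False using neg by (auto simp: Z_def)
qed

text \<open>At \<open>e\<close> the \<open>z\<^sub>2\<close>-derivatives of \<rho> vanish, so the
  Levi form reduces to a nonzero multiple of a quarter of the Laplacian of \<rho> in
  \<open>z\<^sub>2\<close>, which is positive.\<close>

lemma levi_nonzero:
  assumes V: "open V" "smooth_on V \<rho>" "e \<in> V" "dz1 (cplx \<rho>) e \<noteq> 0" "dzbar1 (cplx \<rho>) e \<noteq> 0"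
    and tangent: "\<And>w. frechet_derivative \<rho> (at e) (0, w) = 0"
    and pos: "\<And>w. w \<noteq> 0 \<Longrightarrow> 0 < second_derivative \<rho> e (0, w) (0, w)"
  shows "levi \<rho> e \<noteq> 0"
proof -
  have "frechet_derivative (cplx \<rho>) (at e) (0, w) = 0" for w
    by (simp add: frechet_derivative_cplx[OF smooth_on_differentiable[OF V(2,3)]] tangent)
  then have z: "dz2 (cplx \<rho>) e = 0" "dzbar2 (cplx \<rho>) e = 0" by (simp_all add: dz2_def dzbar2_def)
  define h where "h a b = second_derivative (cplx \<rho>) e a b" for a b
  have h: "h a b = complex_of_real (second_derivative \<rho> e a b)" for a b
    unfolding h_def by (rule second_derivative_cplx[OF V(1-3)])
  have sym: "h (0, 1) (0, \<i>) = h (0, \<i>) (0, 1)"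
    unfolding h by (simp add: second_derivative_symmetric[OF V(1-3), of "(0,1)"])
  have "dzbar2 (dz2 (cplx \<rho>)) e = (h (0, 1) (0, 1) + h (0, \<i>) (0, \<i>)) / 4"
    unfolding dzbar2_def[of "dz2 (cplx \<rho>)"] frechet_derivative_wirtinger[OF smooth_on_cplx[OF V(1,2)] V(3)]
      h_def[symmetric] sym by (simp add: field_simps)
  also have "\<dots> = complex_of_real ((second_derivative \<rho> e (0, 1) (0, 1) + second_derivative \<rho> e (0, \<i>) (0, \<i>)) / 4)"
    by (simp add: h)
  finally have "dzbar2 (dz2 (cplx \<rho>)) e \<noteq> 0"
    using pos[of 1] pos[of \<i>] by (simp only: of_real_eq_0_iff) simp
  moreover have "levi \<rho> e = dz1 (cplx \<rho>) e * (dzbar1 (cplx \<rho>) e * dzbar2 (dz2 (cplx \<rho>)) e)"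
    by (simp add: levi_def z field_apply_def field_Lbar_def vector_4_nth)
  ultimately show ?thesis using V(4,5) by simp
qed

text \<open>Degree at most 1 leaves only \<open>L\<close> and \<open>Lbar\<close>, whose
  \<open>T\<close>-components vanish.\<close>

lemma Lambda_nonzero_ge_2:
  assumes "Lambda_nonzero \<rho> z k"
  shows "2 \<le> k"
proof (rule ccontr)
  assume "\<not> 2 \<le> k"
  then have k: "k \<le> 1" by simp
  obtain V M where VM: "z \<in> V" "dz1 (cplx \<rho>) z \<noteq> 0" "dzbar1 (cplx \<rho>) z \<noteq> 0"
    "commutator_basis \<rho> V k M" "Lambda \<rho> M z \<noteq> 0"
    using assms unfolding Lambda_nonzero_def by blast
  have "T_coeff \<rho> X z = 0" if "X \<in> M" for X
  proof -
    have "X = field_L \<rho> \<or> X = field_Lbar \<rho>"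
      using that VM(4) k iterated_commutator_le_1 unfolding commutator_basis_def by fastforce
    moreover have "T_coeff \<rho> (field_L \<rho>) z = 0"
      by (rule T_coeff_eq[OF VM(2,3), where a=1 and b=0]) (simp add: vec_eq_iff)
    moreover have "T_coeff \<rho> (field_Lbar \<rho>) z = 0"
      by (rule T_coeff_eq[OF VM(2,3), where a=0 and b=1]) (simp add: vec_eq_iff)
    ultimately show ?thesis by auto
  qed
  then show False using VM(5) by (simp add: Lambda_def)
qed

text \<open>Guarantees that the index 2 occurs in the ranges of \<open>Dfun\<close> and
  \<open>Lambda_upper\<close>.\<close>

lemma domain_type_ge_2:
  assumes "finite_type \<Omega> \<rho>" "z \<in> frontier \<Omega>"
  shows "2 \<le> domain_type \<Omega> \<rho>"
proof -
  have "\<exists>k. Lambda_nonzero_at \<rho> z k" and bdd: "bdd_above (point_type \<rho> ` frontier \<Omega>)"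
    using assms unfolding finite_type_def by auto
  then have "Lambda_nonzero_at \<rho> z (point_type \<rho> z)"
    unfolding point_type_def by (metis LeastI)
  then have "2 \<le> point_type \<rho> z"
    unfolding Lambda_nonzero_at_def using Lambda_nonzero_ge_2 by (metis (full_types))
  also have "\<dots> \<le> domain_type \<Omega> \<rho>"
    unfolding domain_type_def using bdd assms(2) by (intro Max_ge) (auto simp: bdd_above_nat)
  finally show ?thesis .
qed

subsection \<open>Polarization and approach regions\<close>

text \<open>The factor 2 makes this the real gradient of \<rho> under the identification of
  \<open>c2\<close> with real 4-space.\<close>

definition normal_vector :: "(c2 \<Rightarrow> real) \<Rightarrow> c2 \<Rightarrow> c2" where
  "normal_vector \<rho> p = (2 * dzbar1 (cplx \<rho>) p, 2 * dzbar2 (cplx \<rho>) p)"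

lemma normal_vector_eq:
  assumes "\<rho> differentiable (at p)"
  defines "D \<equiv> frechet_derivative \<rho> (at p)"
  shows "normal_vector \<rho> p = (Complex (D (1, 0)) (D (\<i>, 0)), Complex (D (0, 1)) (D (0, \<i>)))"
  using frechet_derivative_cplx[OF assms(1)]
  by (simp add: normal_vector_def dzbar1_def dzbar2_def D_def complex_eq_iff)

lemma c2_basis_expand:
  fixes v :: c2
  shows "v = Re (fst v) *\<^sub>R (1, 0) + Im (fst v) *\<^sub>R (\<i>, 0) + Re (snd v) *\<^sub>R (0, 1) + Im (snd v) *\<^sub>R (0, \<i>)"
  by (simp add: prod_eq_iff complex_eq_iff)

lemma linear_c2_expand:
  fixes f :: "c2 \<Rightarrow> 'b::real_vector"
  assumes "linear f"
  shows "f v = Re (fst v) *\<^sub>R f (1, 0) + Im (fst v) *\<^sub>R f (\<i>, 0) + Re (snd v) *\<^sub>R f (0, 1) + Im (snd v) *\<^sub>R f (0, \<i>)"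
  by (subst c2_basis_expand[of v]) (simp only: linear_add[OF assms] linear_cmul[OF assms])

lemma frechet_derivative_normal_vector:
  assumes "\<rho> differentiable (at p)"
  shows "frechet_derivative \<rho> (at p) v = normal_vector \<rho> p \<bullet> v"
  unfolding normal_vector_eq[OF assms] linear_c2_expand[OF linear_frechet_derivative[OF assms], of v]
  by (simp add: inner_prod_def inner_complex_def mult_ac)

text \<open>A frontier point is not in the open set, so \<rho> is not negative there; but it is a
  limit of points where \<rho> is negative.\<close>

lemma defining_function_zero:
  assumes "open \<Omega>" "open W" "continuous_on W \<rho>" "frontier \<Omega> \<subseteq> W" "\<Omega> \<inter> W = {z \<in> W. \<rho> z < 0}"
    and q: "q \<in> frontier \<Omega>"
  shows "\<rho> q = (0::real)"
proof (rule antisym)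
  have qW: "q \<in> W" using assms by blast
  have "q \<notin> \<Omega>" using q assms(1) by (simp add: frontier_def interior_open)
  then show "0 \<le> \<rho> q" using assms(5) qW by force
  show "\<rho> q \<le> 0"
  proof (rule ccontr)
    assume "\<not> ?thesis"
    moreover have "open {z \<in> W. 0 < \<rho> z}"
      using continuous_open_preimage[OF assms(3,2), of "{0<..}"] by (simp add: vimage_def Int_def conj_commute)
    ultimately have "{z \<in> W. 0 < \<rho> z} \<inter> \<Omega> \<noteq> {}"
      using qW q by (subst open_Int_closure_eq_empty[symmetric]) (auto simp: frontier_def)
    then show False using assms(5) by force
  qed
qed

lemma vanishes_infinite_order_at_imp_zero:
  assumes "vanishes_infinite_order_at g p"
  shows "g p = 0"
proof -
  obtain C where "\<forall>\<^sub>F x in nhds p. cmod (g x) \<le> C * dist x p ^ 1"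
    using assms unfolding vanishes_infinite_order_at_def by blast
  from eventually_nhds_x_imp_x[OF this] show ?thesis by simp
qed

lemma vanishes_infinite_order_at_has_derivative:
  fixes g :: "'a::real_normed_vector \<Rightarrow> complex"
  assumes "vanishes_infinite_order_at g p"
  shows "(g has_derivative (\<lambda>_. 0)) (at p)"
proof -
  obtain C where C: "\<forall>\<^sub>F x in nhds p. cmod (g x) \<le> C * dist x p ^ 2"
    using assms unfolding vanishes_infinite_order_at_def by blast
  have "((\<lambda>x. C * dist x p) \<longlongrightarrow> C * dist p p) (at p)" by (intro tendsto_intros)
  then have lim: "((\<lambda>x. C * dist x p) \<longlongrightarrow> 0) (at p)" by simp
  have "((\<lambda>x. norm (g x - g p - 0) / norm (x - p)) \<longlongrightarrow> 0) (at p)"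
  proof (rule tendsto_sandwich[OF _ _ tendsto_const lim])
    show "\<forall>\<^sub>F x in at p. norm (g x - g p - 0) / norm (x - p) \<le> C * dist x p"
      using C unfolding eventually_at_filter
    proof eventually_elim
      case (elim x)
      then show ?case
        using vanishes_infinite_order_at_imp_zero[OF assms]
        by (auto simp: divide_le_eq dist_norm power2_eq_square mult.assoc)
    qed
  qed auto
  then show ?thesis by (simp add: has_derivative_iff_norm)
qed

text \<open>The three conditions on the diagonal say that the derivative in the first variable is
  complex linear, that the one in the second is its conjugate, and that they add up to the
  derivative of \<rho>. So the real part is half the derivative of \<rho>, and a complex linear form
  is determined by its real part.\<close>

lemma polarization_derivative:
  assumes W: "open W" "smooth_on W \<rho>" "w \<in> W" and R: "polarization W \<rho> R"
  shows "frechet_derivative (\<lambda>(z, w). R z w) (at (w, w)) (v, 0) = herm v (normal_vector \<rho> w) / 2"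
proof -
  define F where "F = (\<lambda>(z, w). R z w)"
  define D where "D = frechet_derivative F (at (w, w))"
  have "smooth_on (W \<times> W) F" and Rdiag: "\<And>z. z \<in> W \<Longrightarrow> F (z, z) = complex_of_real (\<rho> z)"
    and van1: "vanishes_infinite_order_at (\<lambda>(z, w). dzbar1 (\<lambda>u. R u w) z) (w, w)"
    and van2: "vanishes_infinite_order_at (\<lambda>(z, w). dzbar2 (\<lambda>u. R u w) z) (w, w)"
    and van3: "vanishes_infinite_order_at (\<lambda>(z, w). R z w - cnj (R w z)) (w, w)"
    using R W(3) unfolding polarization_def F_def by auto
  then have FD: "(F has_derivative D) (at (w, w))"
    unfolding D_def using W(3) by (intro smooth_on_has_derivative[of "W \<times> W"]) auto
  note lin = has_derivative_linear[OF FD]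
  have slice: "((\<lambda>u. R u w) has_derivative (\<lambda>v. D (v, 0))) (at w)"
  proof -
    have "((\<lambda>u. (u, w)) has_derivative (\<lambda>v. (v, 0))) (at w)" by (auto intro!: derivative_eq_intros)
    from has_derivative_compose[OF this FD] show ?thesis by (simp add: F_def)
  qed
  have diag: "D (v, v) = complex_of_real (frechet_derivative \<rho> (at w) v)" for v
  proof -
    have "((\<lambda>u. (u, u)) has_derivative (\<lambda>v. (v, v))) (at w)" by (auto intro!: derivative_eq_intros)
    from has_derivative_compose[OF this FD]
    have "(cplx \<rho> has_derivative (\<lambda>v. D (v, v))) (at w)"
      by (rule has_derivative_transform_within_open[OF _ W(1,3) Rdiag])
    from fun_cong[OF frechet_derivative_eqI[OF this], of v]
    show ?thesis by (simp add: frechet_derivative_cplx[OF smooth_on_differentiable[OF W(2,3)]])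
  qed
  have swap: "D (0, v) = cnj (D (v, 0))" for v
  proof -
    have "((\<lambda>x::c2 \<times> c2. (snd x, fst x)) has_derivative (\<lambda>x. (snd x, fst x))) (at (w, w))"
      by (auto intro!: derivative_eq_intros)
    from has_derivative_compose[OF this, of F D] FD
    have "((\<lambda>x. F (snd x, fst x)) has_derivative (\<lambda>x. D (snd x, fst x))) (at (w, w))" by simp
    from has_derivative_diff[OF FD bounded_linear.has_derivative[OF bounded_linear_cnj this]]
    have "((\<lambda>x. F x - cnj (F (snd x, fst x))) has_derivative (\<lambda>x. D x - cnj (D (snd x, fst x)))) (at (w, w))" .
    moreover have "(\<lambda>x. F x - cnj (F (snd x, fst x))) = (\<lambda>(z, w). R z w - cnj (R w z))"
      by (auto simp: F_def fun_eq_iff)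
    ultimately have "((\<lambda>(z, w). R z w - cnj (R w z)) has_derivative (\<lambda>x. D x - cnj (D (snd x, fst x)))) (at (w, w))"
      by (simp only:)
    from has_derivative_unique[OF this vanishes_infinite_order_at_has_derivative[OF van3]]
    have "(\<lambda>x. D x - cnj (D (snd x, fst x))) = (\<lambda>_. 0)" .
    from fun_cong[OF this, of "(0, v)"] show ?thesis by simp
  qed
  have Re_D: "Re (D (v, 0)) = frechet_derivative \<rho> (at w) v / 2" for v
  proof -
    have "D (v, v) = D (v, 0) + D (0, v)" using linear_add[OF lin, of "(v, 0)" "(0, v)"] by simp
    then have "complex_of_real (frechet_derivative \<rho> (at w) v) = D (v, 0) + cnj (D (v, 0))"
      by (simp add: diag swap)
    then have "Re (complex_of_real (frechet_derivative \<rho> (at w) v)) = Re (D (v, 0) + cnj (D (v, 0)))"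
      by (rule arg_cong)
    then show ?thesis by simp
  qed
  have fr: "frechet_derivative (\<lambda>u. R u w) (at w) = (\<lambda>v. D (v, 0))"
    by (rule frechet_derivative_eqI[OF slice])
  have CR: "D ((\<i>, 0), 0) = \<i> * D ((1, 0), 0)" "D ((0, \<i>), 0) = \<i> * D ((0, 1), 0)"
  proof -
    have "D ((1, 0), 0) + \<i> * D ((\<i>, 0), 0) = 0" "D ((0, 1), 0) + \<i> * D ((0, \<i>), 0) = 0"
      using vanishes_infinite_order_at_imp_zero[OF van1] vanishes_infinite_order_at_imp_zero[OF van2]
      by (simp_all add: dzbar1_def dzbar2_def fr)
    then have "\<i> * (D ((1, 0), 0) + \<i> * D ((\<i>, 0), 0)) = 0" "\<i> * (D ((0, 1), 0) + \<i> * D ((0, \<i>), 0)) = 0"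
      by simp_all
    then show "D ((\<i>, 0), 0) = \<i> * D ((1, 0), 0)" "D ((0, \<i>), 0) = \<i> * D ((0, 1), 0)"
      by (simp_all add: algebra_simps flip: mult.assoc)
  qed
  have lin0: "linear (\<lambda>v. D (v, 0))" by (rule has_derivative_linear[OF slice])
  let ?N = "normal_vector \<rho> w"
  have d: "\<rho> differentiable (at w)" by (rule smooth_on_differentiable[OF W(2,3)])
  have coeff: "D ((1, 0), 0) = cnj (fst ?N) / 2" "D ((0, 1), 0) = cnj (snd ?N) / 2"
    using Re_D[of "(1, 0)"] Re_D[of "(\<i>, 0)"] Re_D[of "(0, 1)"] Re_D[of "(0, \<i>)"]
    unfolding CR normal_vector_eq[OF d] by (simp_all add: complex_eq_iff)
  have "D (v, 0) = fst v * D ((1, 0), 0) + snd v * D ((0, 1), 0)"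
    unfolding linear_c2_expand[OF lin0, of v] CR
    by (subst complex_eq[of "fst v"], subst complex_eq[of "snd v"]) (simp add: scaleR_conv_of_real algebra_simps)
  then show ?thesis
    unfolding F_def[symmetric] D_def[symmetric] by (simp add: coeff herm_def add_divide_distrib)
qed

text \<open>Taylor's formula at \<open>(w, w)\<close>, where the polarization vanishes. It shows
  that the second condition of the approach region is governed by the same quasi-distance
  \<open>l w p\<close>, up to a squared Euclidean distance.\<close>

lemma polarization_bound:
  assumes W: "open W" "smooth_on W \<rho>" "e \<in> W" and R: "polarization W \<rho> R"
  shows "\<exists>r>0. \<exists>C\<ge>0. \<forall>p\<in>cball e r. \<forall>w\<in>cball e r. \<rho> w = 0 \<longrightarrow>
     cmod (R p w) \<le> cmod (herm (w - p) (normal_vector \<rho> w)) + C * (norm (p - w))\<^sup>2"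
proof -
  define F where "F = (\<lambda>(z, w). R z w)"
  have F: "smooth_on (W \<times> W) F" using R by (simp add: polarization_def F_def)
  have "open (W \<times> W)" "(e, e) \<in> W \<times> W" using W by (auto intro: open_Times)
  then obtain r where r: "r > 0" "cball (e, e) r \<subseteq> W \<times> W" using open_contains_cball by blast
  obtain C where C: "C \<ge> 0" "\<And>x y. x \<in> cball (e, e) r \<Longrightarrow> y \<in> cball (e, e) r \<Longrightarrow>
      norm (F y - F x - frechet_derivative F (at x) (y - x)) \<le> C * (norm (y - x))\<^sup>2"
    using smooth_on_taylor_first[OF F compact_cball convex_cball r(2)] by metis
  have "cmod (R p w) \<le> cmod (herm (w - p) (normal_vector \<rho> w)) + C * (norm (p - w))\<^sup>2"
    if p: "p \<in> cball e (r / 2)" and w: "w \<in> cball e (r / 2)" "\<rho> w = 0" for p w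
  proof -
    have in_ball: "(a, b) \<in> cball (e, e) r" if "a \<in> cball e (r / 2)" "b \<in> cball e (r / 2)" for a b
    proof -
      have "dist (e, e) (a, b) \<le> dist e a + dist e b"
        unfolding dist_Pair_Pair by (rule sqrt_sum_squares_le_sum) auto
      then show ?thesis using that by simp
    qed
    have wW: "w \<in> W" using in_ball[OF w(1) w(1)] r(2) by blast
    have 1: "F (w, w) = 0" using R wW w(2) by (simp add: polarization_def F_def)
    have 2: "F (p, w) = R p w" by (simp add: F_def)
    have 3: "frechet_derivative F (at (w, w)) ((p, w) - (w, w)) = herm (p - w) (normal_vector \<rho> w) / 2"
      unfolding polarization_derivative[OF W(1,2) wW R, of "p - w", symmetric] by (simp add: F_def)
    have 4: "norm ((p, w) - (w, w)) = norm (p - w)" by (simp add: norm_Pair)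
    have "norm (R p w - herm (p - w) (normal_vector \<rho> w) / 2) \<le> C * (norm (p - w))\<^sup>2"
      using C(2)[OF in_ball[OF w(1) w(1)] in_ball[OF p w(1)]] unfolding 1 2 3 4 diff_0_right .
    then have "cmod (R p w) \<le> cmod (herm (p - w) (normal_vector \<rho> w) / 2) + C * (norm (p - w))\<^sup>2"
      using norm_triangle_ineq2[of "R p w" "herm (p - w) (normal_vector \<rho> w) / 2"] by linarith
    moreover have "cmod (herm (p - w) (normal_vector \<rho> w) / 2) \<le> cmod (herm (w - p) (normal_vector \<rho> w))"
      using herm_minus_left[of "w - p" "normal_vector \<rho> w"] by (simp add: norm_divide)
    ultimately show ?thesis by linarith
  qed
  then show ?thesis using r C by (intro exI[of _ "r / 2"] conjI exI[of _ C]) auto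
qed

section \<open>Points on the normal lie in the approach regions\<close>

lemma bdist_normal:
  assumes "proj \<Omega> z = p" "z = p - t *\<^sub>R normal_vector \<rho> p" "t > 0"
  shows "bdist \<Omega> z = t * norm (normal_vector \<rho> p)" "bdist_n \<Omega> \<rho> z = t * norm (normal_vector \<rho> p)"
proof -
  let ?N = "normal_vector \<rho> p"
  show "bdist \<Omega> z = t * norm ?N" unfolding bdist_def assms(1) using assms by (simp add: dist_norm)
  define n where "n = (dzbar1 (cplx \<rho>) p, dzbar2 (cplx \<rho>) p)"
  have N: "?N = 2 *\<^sub>R n" by (simp add: normal_vector_def n_def scaleR_conv_of_real)
  have zp: "z - p = (- (2 * t)) *\<^sub>R n" using assms(2) N by simp
  have "fst (z - p) * cnj (fst n) + snd (z - p) * cnj (snd n) = herm (z - p) n" by (simp add: herm_def)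
  also have "\<dots> = of_real (- (2 * t) * (norm n)\<^sup>2)"
    unfolding zp herm_scaleR_left herm_self by simp
  finally have "cmod (fst (z - p) * cnj (fst n) + snd (z - p) * cnj (snd n)) = 2 * t * (norm n)\<^sup>2"
    using assms(3) by (simp only: norm_of_real) simp
  then have "bdist_n \<Omega> \<rho> z = 2 * t * (norm n)\<^sup>2 / norm n"
    unfolding bdist_n_def assms(1) Let_def n_def[symmetric] by simp
  then show "bdist_n \<Omega> \<rho> z = t * norm ?N" by (simp add: N power2_eq_square)
qed

text \<open>Since \<open>bdist \<Omega> z / B\<close> is at most 1, higher roots of it are larger,
  so \<open>k = 2\<close> gives the smallest.\<close>

lemma Dfun_ge:
  assumes "2 \<le> domain_type \<Omega> \<rho>" "proj \<Omega> z = p" "bdist \<Omega> z \<le> 1" "1 \<le> B"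
    and \<Lambda>: "\<And>k. k \<in> {2..domain_type \<Omega> \<rho>} \<Longrightarrow> Lambda \<rho> (M k) p \<le> B" "Lambda \<rho> (M 2) p \<noteq> 0"
  shows "sqrt (bdist \<Omega> z / B) \<le> Dfun \<Omega> \<rho> M z"
  unfolding Dfun_def assms(2)
proof (rule cINF_greatest)
  show "{k \<in> {2..domain_type \<Omega> \<rho>}. Lambda \<rho> (M k) p \<noteq> 0} \<noteq> {}" using assms by auto
  have b: "0 \<le> bdist \<Omega> z" by (simp add: bdist_def)
  fix k assume k: "k \<in> {k \<in> {2..domain_type \<Omega> \<rho>}. Lambda \<rho> (M k) p \<noteq> 0}"
  then have pos: "0 < Lambda \<rho> (M k) p" using Lambda_nonneg[of \<rho> "M k" p] by simp
  have "sqrt (bdist \<Omega> z / B) = root 2 (bdist \<Omega> z / B)" by (simp add: sqrt_def)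
  also have "\<dots> \<le> root k (bdist \<Omega> z / B)"
    using k b assms(3,4) by (cases "k = 2") (auto intro!: real_root_increasing simp: divide_le_eq)
  also have "\<dots> \<le> root k (bdist \<Omega> z / Lambda \<rho> (M k) p)"
    using k pos b \<Lambda>(1) assms(4) by (intro real_root_le_mono divide_left_mono mult_pos_pos) auto
  finally show "sqrt (bdist \<Omega> z / B) \<le> root k (bdist \<Omega> z / Lambda \<rho> (M k) p)" .
qed

lemma Lambda_upper_ge:
  assumes "2 \<le> domain_type \<Omega> \<rho>" "0 \<le> \<theta>"
  shows "\<theta>\<^sup>2 * Lambda \<rho> (M 2) \<zeta> \<le> Lambda_upper \<Omega> \<rho> M \<theta> \<zeta>"
  unfolding Lambda_upper_def
  using assms member_le_sum[of 2 "{2..domain_type \<Omega> \<rho>}" "\<lambda>k. \<theta> ^ k * Lambda \<rho> (M k) \<zeta>"]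
  by (auto simp: Lambda_nonneg)

lemma aperture_large:
  assumes "aperture h"
  shows "\<exists>d>0. \<forall>x. 0 < x \<longrightarrow> x < d \<longrightarrow> B < h x"
proof -
  have "\<forall>\<^sub>F x in at_right 0. B < h x"
    using assms unfolding aperture_def filterlim_at_top_dense by blast
  then show ?thesis unfolding eventually_at_right_field by blast
qed

text \<open>The upper bound is compactness. The lower bound holds because the collection of degree 2
  contains the commutator of \<open>L\<close> and \<open>Lbar\<close> in one of its two orders,
  whose coefficient has continuous modulus and is nonzero at \<open>e\<close>.\<close>

lemma Lambda_bounds_near:
  assumes V: "open V" "smooth_on V \<rho>" "\<And>z. z \<in> V \<Longrightarrow> dz1 (cplx \<rho>) z \<noteq> 0 \<and> dzbar1 (cplx \<rho>) z \<noteq> 0"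
    and M: "\<And>k. commutator_basis \<rho> V k (M k)" and e: "e \<in> V" "levi \<rho> e \<noteq> 0"
  shows "\<exists>r>0. \<exists>B\<ge>1. \<exists>\<mu>>0. cball e r \<subseteq> V \<and> (\<forall>p\<in>cball e r.
    (\<forall>k\<in>{2..m}. Lambda \<rho> (M k) p \<le> B) \<and> \<mu> \<le> Lambda \<rho> (M 2) p)"
proof -
  obtain r1 where r1: "r1 > 0" "cball e r1 \<subseteq> V" using V(1) e(1) open_contains_cball by blast
  have "\<forall>k. \<exists>B. \<forall>z\<in>cball e r1. Lambda \<rho> (M k) z \<le> B"
    using Lambda_bounded[OF V M compact_cball r1(2)] by blast
  then obtain b where b: "\<And>k z. z \<in> cball e r1 \<Longrightarrow> Lambda \<rho> (M k) z \<le> b k"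
    by metis
  define B where "B = 1 + (\<Sum>k\<in>{2..m}. \<bar>b k\<bar>)"
  have B: "1 \<le> B" by (simp add: B_def sum_nonneg)
  have bB: "b k \<le> B" if "k \<in> {2..m}" for k
    using member_le_sum[OF that, of "\<lambda>k. \<bar>b k\<bar>"] abs_ge_self[of "b k"] unfolding B_def by simp
  define g where "g z = cmod (levi \<rho> z) / cmod (dz1 (cplx \<rho>) z * dzbar1 (cplx \<rho>) z)" for z
  have nz: "dz1 (cplx \<rho>) z \<noteq> 0" "dzbar1 (cplx \<rho>) z \<noteq> 0" if "z \<in> V" for z using V(3)[OF that] by auto
  note w = smooth_on_wirtinger[OF V(1) smooth_on_cplx[OF V(1,2)], THEN smooth_on_continuous]
  have "continuous_on V g"
    unfolding g_def using nz
    by (intro continuous_intros w smooth_on_continuous[OF smooth_on_levi[OF V(1,2)]]) auto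
  then have "isCont g e" using V(1) e(1) continuous_on_eq_continuous_at by blast
  moreover have ge: "g e > 0" using nz[OF e(1)] e(2) by (simp add: g_def)
  ultimately have "\<forall>\<^sub>F z in at e. g e / 2 < g z"
    unfolding isCont_def by (intro order_tendstoD(1)) auto
  then obtain r2 where r2: "r2 > 0" "\<And>z. z \<noteq> e \<Longrightarrow> dist z e < r2 \<Longrightarrow> g e / 2 < g z"
    unfolding eventually_at by blast
  have "commutator (field_L \<rho>) (field_Lbar \<rho>) \<in> M 2 \<or> commutator (field_Lbar \<rho>) (field_L \<rho>) \<in> M 2"
    using commutator_in_basis[OF V(1,2) e(1) nz[OF e(1)] M e(2)] .
  then obtain X where X: "X \<in> M 2"
    "X \<in> {commutator (field_L \<rho>) (field_Lbar \<rho>), commutator (field_Lbar \<rho>) (field_L \<rho>)}"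
    by blast
  define r where "r = min r1 (r2 / 2)"
  have "g e / 2 \<le> Lambda \<rho> (M 2) p" if p: "p \<in> cball e r" for p
  proof -
    have pV: "p \<in> V" using p r1 by (auto simp: r_def)
    have "g e / 2 \<le> g p"
    proof (cases "p = e")
      case False
      then show ?thesis using r2(2)[OF False] p r2(1) by (simp add: r_def dist_commute)
    qed (use ge in simp)
    also have "g p = cmod (T_coeff \<rho> X p)"
      using T_coeff_commutator_L_Lbar[OF V(1,2) pV nz[OF pV] X(2)] by (simp add: g_def)
    also have "\<dots> \<le> Lambda \<rho> (M 2) p"
      using X(1) commutator_basis_finite[OF M] by (intro Lambda_ge) auto
    finally show ?thesis .
  qed
  moreover have "Lambda \<rho> (M k) p \<le> B" if "p \<in> cball e r" "k \<in> {2..m}" for p k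
    using b[of p k] bB[OF that(2)] that(1) by (simp add: r_def)
  moreover have "cball e r \<subseteq> V" using r1 by (auto simp: r_def)
  moreover have "r > 0" using r1 r2 by (simp add: r_def)
  ultimately show ?thesis
    using B ge by (intro exI[of _ r] conjI exI[of _ B] exI[of _ "g e / 2"]) auto
qed

text \<open>The Lipschitz bound for the derivative is tested on the vector
  \<open>normal_vector \<rho> p - normal_vector \<rho> q\<close> itself.\<close>

lemma normal_vector_lipschitz:
  assumes "smooth_on W \<rho>" "compact K" "convex K" "K \<subseteq> W"
  shows "\<exists>C\<ge>0. \<forall>p\<in>K. \<forall>q\<in>K. norm (normal_vector \<rho> p - normal_vector \<rho> q) \<le> C * norm (p - q)"
proof -
  obtain C where C: "C \<ge> 0" "\<And>p q v. p \<in> K \<Longrightarrow> q \<in> K \<Longrightarrow>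
      norm (frechet_derivative \<rho> (at p) v - frechet_derivative \<rho> (at q) v) \<le> C * norm (p - q) * norm v"
    using smooth_on_lipschitz_derivative[OF assms] by metis
  have "norm (normal_vector \<rho> p - normal_vector \<rho> q) \<le> C * norm (p - q)" if pq: "p \<in> K" "q \<in> K" for p q
  proof (cases "normal_vector \<rho> p = normal_vector \<rho> q")
    case True
    then show ?thesis using C(1) by simp
  next
    case False
    define n where "n = normal_vector \<rho> p - normal_vector \<rho> q"
    have d: "\<rho> differentiable (at p)" "\<rho> differentiable (at q)"
      using assms pq smooth_on_differentiable by blast+
    have "norm n * norm n = frechet_derivative \<rho> (at p) n - frechet_derivative \<rho> (at q) n"
      by (simp add: frechet_derivative_normal_vector[OF d(1)] frechet_derivative_normal_vector[OF d(2)]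
          n_def flip: inner_diff_left power2_eq_square power2_norm_eq_inner)
    also have "\<dots> \<le> C * norm (p - q) * norm n" using C(2)[OF pq, of n] by simp
    finally show ?thesis using False unfolding n_def by (simp add: mult_le_cancel_right)
  qed
  then show ?thesis using C(1) by blast
qed

lemma normal_vector_bounded:
  assumes "open W" "smooth_on W \<rho>" "compact K" "K \<subseteq> W"
  shows "\<exists>C>0. \<forall>p\<in>K. norm (normal_vector \<rho> p) \<le> C"
proof -
  note w = smooth_on_wirtinger[OF assms(1) smooth_on_cplx[OF assms(1,2)], THEN smooth_on_continuous,
      THEN continuous_on_subset[OF _ assms(4)]]
  have "continuous_on K (normal_vector \<rho>)"
    unfolding normal_vector_def[abs_def] by (intro continuous_intros w)
  then have "bounded (normal_vector \<rho> ` K)" by (intro compact_imp_bounded compact_continuous_image assms(3))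
  then show ?thesis by (auto simp: bounded_pos)
qed

text \<open>At height \<open>t\<close> on the normal, \<open>Dfun\<close> is at least
  \<open>sqrt (n * t / B)\<close> and \<open>Lambda_upper\<close> at \<zeta> at least
  \<open>n * t / B * \<mu>\<close>. Both conditions thus compare quantities of equal order in
  \<open>t\<close>, and the ratios have only to be exceeded by the apertures.\<close>

lemma mem_approach_region:
  assumes z: "z \<in> \<Omega>" "z \<in> V" "proj \<Omega> z = p" "z = p - t *\<^sub>R normal_vector \<rho> p" "t > 0"
    and n: "0 < n" "n \<le> norm (normal_vector \<rho> p)"
    and \<delta>: "\<delta> = t * norm (normal_vector \<rho> p)" "\<delta> \<le> 1"
    and type: "2 \<le> domain_type \<Omega> \<rho>" and B: "1 \<le> B" "\<And>k. k \<in> {2..domain_type \<Omega> \<rho>} \<Longrightarrow> Lambda \<rho> (M k) p \<le> B"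
    and \<mu>: "0 < \<mu>" "\<mu> \<le> Lambda \<rho> (M 2) p" "\<mu> \<le> Lambda \<rho> (M 2) \<zeta>"
    and dist: "dist z \<zeta> \<le> a * sqrt t" "a * sqrt (B / n) < h1 \<delta>"
    and R: "cmod (R p \<zeta>) \<le> b * t" "b * B / (n * \<mu>) < h2 \<delta>" "0 \<le> a" "0 \<le> b"
  shows "z \<in> approach_region \<Omega> \<rho> V M R h1 h2 \<zeta>"
proof -
  define D where "D = Dfun \<Omega> \<rho> M z"
  note bd = bdist_normal[OF z(3-5), folded \<delta>(1)]
  have nt: "0 < n * t / B" using n z B by simp
  have "n * t / B \<le> \<delta> / B"
    using n z B mult_right_mono[OF n(2), of t] by (intro divide_right_mono) (auto simp: \<delta>(1) mult.commute)
  then have "sqrt (n * t / B) \<le> sqrt (\<delta> / B)" by simp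
  also have "\<dots> \<le> D"
    unfolding D_def bd(1)[symmetric]
    using \<delta> B \<mu> bd by (intro Dfun_ge[OF type z(3)]) auto
  finally have D: "sqrt (n * t / B) \<le> D" .
  have D0: "0 \<le> D" using D nt by (meson less_imp_le order_trans real_sqrt_ge_zero)
  have h0: "0 \<le> h1 \<delta>" "0 \<le> h2 \<delta>"
  proof -
    have "0 \<le> a * sqrt (B / n)" "0 \<le> b * B / (n * \<mu>)" using R n B \<mu> by auto
    then show "0 \<le> h1 \<delta>" "0 \<le> h2 \<delta>" using dist(2) R(2) by linarith+
  qed
  have "dist z \<zeta> \<le> a * (sqrt (B / n) * sqrt (n * t / B))"
    using dist(1) n B by (simp flip: real_sqrt_mult)
  also have "\<dots> < h1 \<delta> * sqrt (n * t / B)"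
    unfolding mult.assoc[symmetric] using dist(2) nt by (intro mult_strict_right_mono) auto
  also have "\<dots> \<le> h1 \<delta> * D" using D h0 by (intro mult_left_mono) auto
  finally have 1: "dist z \<zeta> < h1 \<delta> * D" .
  have "n * t / B \<le> D\<^sup>2" using D nt D0 real_sqrt_le_iff[of "n * t / B" "D\<^sup>2"] by simp
  then have "n * t / B * \<mu> \<le> D\<^sup>2 * Lambda \<rho> (M 2) \<zeta>"
    using \<mu> nt by (intro mult_mono) auto
  also have "\<dots> \<le> Lambda_upper \<Omega> \<rho> M D \<zeta>" by (rule Lambda_upper_ge[OF type D0])
  finally have U: "n * t / B * \<mu> \<le> Lambda_upper \<Omega> \<rho> M D \<zeta>" .
  have "cmod (R p \<zeta>) \<le> b * B / (n * \<mu>) * (n * t / B * \<mu>)"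
    using R(1) n B \<mu> by simp
  also have "\<dots> < h2 \<delta> * (n * t / B * \<mu>)"
    using R(2) nt \<mu> by (intro mult_strict_right_mono mult_pos_pos) auto
  also have "\<dots> \<le> h2 \<delta> * Lambda_upper \<Omega> \<rho> M D \<zeta>" using U h0 by (intro mult_left_mono) auto
  finally show ?thesis
    using 1 z unfolding approach_region_def bd(2)[symmetric] D_def by simp
qed

theorem theorem3p5:
  fixes \<Omega> W V :: "c2 set"
    and \<rho> :: "c2 \<Rightarrow> real"
    and R :: "c2 \<Rightarrow> c2 \<Rightarrow> complex"
    and M :: "nat \<Rightarrow> vfield set"
    and h1 h2 :: "real \<Rightarrow> real"
  assumes "smoothly_bounded_domain \<Omega> W \<rho>"
    and "finite_type \<Omega> \<rho>"
    and "\<forall>z\<in>\<Omega>. norm z \<le> 1"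
    and "(1, 0) \<in> frontier \<Omega>"
    and "dz1 (cplx \<rho>) (1, 0) \<noteq> 0"
    and "dzbar1 (cplx \<rho>) (1, 0) \<noteq> 0"
    and "outward_normal \<rho> (1, 0) (1, 0)"
    and "small_nbhd \<Omega> W \<rho> (1, 0) V"
    and "\<forall>k. commutator_basis \<rho> V k (M k)"
    and "polarization W \<rho> R"
    and "aperture h1"
    and "aperture h2"
  shows "\<exists>U f. openin (top_of_set (frontier \<Omega>)) U \<and> (1, 0) \<in> U \<and> U \<subseteq> V \<and>
           holomorphic2_on f \<Omega> \<and> bounded (f ` \<Omega>) \<and>
           (\<forall>\<zeta>\<in>U. \<not> (\<exists>l. (f \<longlongrightarrow> l) (at \<zeta> within approach_region \<Omega> \<rho> V M R h1 h2 \<zeta>)))"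
proof -
  define e :: c2 where "e = (1, 0)"
  define N where "N = normal_vector \<rho>"
  have \<Omega>: "open \<Omega>" "\<Omega> \<noteq> {}" "bounded \<Omega>"
    and W: "open W" "smooth_on W \<rho>" "frontier \<Omega> \<subseteq> W" "\<Omega> \<inter> W = {z \<in> W. \<rho> z < 0}"
    using assms(1) unfolding smoothly_bounded_domain_def defining_function_def by auto
  have V: "open V" "e \<in> V" "V \<subseteq> W" "\<And>z. z \<in> V \<Longrightarrow> dz1 (cplx \<rho>) z \<noteq> 0 \<and> dzbar1 (cplx \<rho>) z \<noteq> 0"
    using assms(8) unfolding small_nbhd_def e_def by auto
  have smV: "smooth_on V \<rho>" by (rule smooth_on_subset[OF W(2) V(3)])
  have M: "\<And>k. commutator_basis \<rho> V k (M k)" using assms(9) by blast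
  have e: "e \<in> frontier \<Omega>" "norm e = 1" using assms(4) by (simp_all add: e_def norm_Pair)
  have eW: "e \<in> W" using e W by blast
  obtain k where k: "k > 0" "\<And>v. frechet_derivative \<rho> (at e) v = k * (e \<bullet> v)"
    using assms(7) unfolding outward_normal_def e_def by blast
  have ball: "\<And>z. z \<in> \<Omega> \<Longrightarrow> norm z \<le> 1" using assms(3) by blast
  have zero: "\<rho> q = 0" if "q \<in> frontier \<Omega>" for q
    by (rule defining_function_zero[OF \<Omega>(1) W(1) smooth_on_continuous[OF W(2)] W(3,4) that])
  have DN: "frechet_derivative \<rho> (at p) v = N p \<bullet> v" if "p \<in> W" for p v
    unfolding N_def by (rule frechet_derivative_normal_vector[OF smooth_on_differentiable[OF W(2) that]])
  have hess: "k * (norm v)\<^sup>2 \<le> second_derivative \<rho> e v v" if "e \<bullet> v = 0" for v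
  proof (rule tangential_hessian_ge[OF W(1,2) eW zero[OF e(1)] e(2) k _ that])
    show "norm z \<le> 1" if "z \<in> W" "\<rho> z < 0" for z using that ball W(4) by blast
  qed
  \<comment> \<open>The vectors \<open>(0, w)\<close> are tangent at \<open>e\<close>, so the
    curvature bound \<open>hess\<close> inherited from the sphere makes the Levi form
    nondegenerate.\<close>
  have levi: "levi \<rho> e \<noteq> 0"
  proof (rule levi_nonzero[OF V(1) smV V(2)])
    show "dz1 (cplx \<rho>) e \<noteq> 0" "dzbar1 (cplx \<rho>) e \<noteq> 0" using V(4)[OF V(2)] by auto
    show "frechet_derivative \<rho> (at e) (0, w) = 0" for w unfolding k(2) by (simp add: e_def inner_prod_def)
    show "0 < second_derivative \<rho> e (0, w) (0, w)" if "w \<noteq> 0" for w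
    proof -
      have "0 < k * (norm ((0, w) :: c2))\<^sup>2" using k(1) that by simp
      also have "\<dots> \<le> second_derivative \<rho> e (0, w) (0, w)" by (rule hess) (simp add: e_def inner_prod_def)
      finally show ?thesis .
    qed
  qed
  have type: "2 \<le> domain_type \<Omega> \<rho>" by (rule domain_type_ge_2[OF assms(2) e(1)])
  obtain r1 c where r1: "r1 > 0" "c > 0" "\<And>p z. p \<in> frontier \<Omega> \<inter> cball e r1 \<Longrightarrow> z \<in> \<Omega> \<union> frontier \<Omega> \<Longrightarrow>
      c * (norm (z - p))\<^sup>2 \<le> - frechet_derivative \<rho> (at p) (z - p)"
    using supporting_planes_near[OF W zero ball e k] by blast
  have compact: "compact (frontier \<Omega>)" by (rule compact_frontier_bounded[OF \<Omega>(3)])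
  obtain C1 where C1: "C1 > 0" "\<And>p. p \<in> frontier \<Omega> \<Longrightarrow> norm (N p) \<le> C1"
    using normal_vector_bounded[OF W(1,2) compact W(3)] unfolding N_def by blast
  obtain r2 t0 where r2: "r2 > 0" "t0 > 0" "\<And>p t. p \<in> frontier \<Omega> \<inter> cball e r2 \<Longrightarrow> 0 < t \<Longrightarrow> t < t0 \<Longrightarrow>
      N p \<noteq> 0 \<Longrightarrow> p - t *\<^sub>R N p \<in> \<Omega> \<and> proj \<Omega> (p - t *\<^sub>R N p) = p"
    using closest_point_normal[OF W zero e(1) DN C1(2,1)] by metis
  obtain r3 B \<mu> where r3: "r3 > 0" "cball e r3 \<subseteq> V" and B: "B \<ge> 1" "\<mu> > 0"
    "\<And>p k. p \<in> cball e r3 \<Longrightarrow> k \<in> {2..domain_type \<Omega> \<rho>} \<Longrightarrow> Lambda \<rho> (M k) p \<le> B"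
    "\<And>p. p \<in> cball e r3 \<Longrightarrow> \<mu> \<le> Lambda \<rho> (M 2) p"
    using Lambda_bounds_near[OF V(1) smV V(4) M V(2) levi, of "domain_type \<Omega> \<rho>"] by metis
  have "cball e r3 \<subseteq> W" using r3 V by blast
  then obtain L where L: "L \<ge> 0" "\<And>p q. p \<in> cball e r3 \<Longrightarrow> q \<in> cball e r3 \<Longrightarrow> norm (N p - N q) \<le> L * norm (p - q)"
    using normal_vector_lipschitz[OF W(2) compact_cball convex_cball] unfolding N_def by metis
  obtain r4 CR where r4: "r4 > 0" "CR \<ge> 0" "\<And>p w. p \<in> cball e r4 \<Longrightarrow> w \<in> cball e r4 \<Longrightarrow> \<rho> w = 0 \<Longrightarrow>
      cmod (R p w) \<le> cmod (herm (w - p) (N w)) + CR * (norm (p - w))\<^sup>2"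
    using polarization_bound[OF W(1,2) eW assms(10)] unfolding N_def by metis
  define r where "r = min (min r1 r2) (min (r3 / 2) (min r4 (k / (2 * (L + 1)))))"
  have "r > 0" using r1(1) r2(1) r3(1) r4(1) k(1) L(1) by (simp add: r_def)
  moreover have "r \<le> r1" "r \<le> r2" "r \<le> r3 / 2" "r \<le> r4" "r \<le> k / (2 * (L + 1))"
    by (simp_all only: r_def min_le_iff_disj order_refl simp_thms)
  ultimately have r: "r > 0" "r \<le> r1" "r \<le> r2" "r \<le> r3 / 2" "r \<le> r4" "r \<le> k / (2 * (L + 1))" .
  \<comment> \<open>Taken with a closed ball, since the locale requires compactness; the relatively
    open \<open>U\<close> is cut out inside it at the end.\<close>
  define \<Gamma> where "\<Gamma> = frontier \<Omega> \<inter> cball e r"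
  define C where "C = max C1 L"
  have C: "C > 0" "C1 \<le> C" "L \<le> C" using C1 by (auto simp: C_def)
  have normN: "k / 2 \<le> norm (N p)" if "p \<in> cball e r" for p
  proof -
    have "k = N e \<bullet> e" using k(2)[of e] e(2) DN[OF eW] by (simp add: norm_eq_1)
    also have "\<dots> \<le> norm (N e)" using norm_cauchy_schwarz[of "N e" e] e(2) by simp
    finally have "k \<le> norm (N e)" .
    moreover have "norm (N e - N p) \<le> L * norm (e - p)" using that r r3 by (intro L(2)) auto
    moreover have "L * norm (e - p) \<le> L * r" using that L by (intro mult_left_mono) (auto simp: dist_norm)
    moreover have "L * r \<le> k / 2"
    proof -
      have "r * (2 * (L + 1)) \<le> k" using r(6) L by (simp add: pos_le_divide_eq)
      then show ?thesis using r(1) by (simp add: algebra_simps)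
    qed
    ultimately show ?thesis using norm_triangle_ineq2[of "N e" "N p"] by linarith
  qed
  interpret support_family \<Omega> \<Gamma> N c C
  proof
    show "norm z \<le> 1" if "z \<in> \<Omega> \<union> \<Gamma>" for z
    proof -
      have "closure \<Omega> \<subseteq> cball 0 1" using ball by (intro closure_minimal) auto
      then show ?thesis using that closure_subset[of \<Omega>] by (auto simp: frontier_def \<Gamma>_def)
    qed
    show "\<Gamma> \<inter> \<Omega> = {}" using \<Omega>(1) by (auto simp: \<Gamma>_def frontier_def interior_open)
    show "compact \<Gamma>" unfolding \<Gamma>_def by (intro compact_Int_closed compact closed_cball)
    show "c > 0" "C > 0" by fact+
    show "c * (norm (p - z))\<^sup>2 \<le> Re (herm (p - z) (N p))" if "p \<in> \<Gamma>" "z \<in> \<Omega> \<union> \<Gamma>" for p z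
    proof -
      have "c * (norm (z - p))\<^sup>2 \<le> - frechet_derivative \<rho> (at p) (z - p)"
        using that r by (intro r1(3)) (auto simp: \<Gamma>_def)
      moreover have "p \<in> W" using that W by (auto simp: \<Gamma>_def)
      ultimately show ?thesis
        by (simp add: DN Re_herm inner_commute[of _ "N p"] inner_diff_right norm_minus_commute)
    qed
    show "norm (N p) \<le> C" if "p \<in> \<Gamma>" for p using C1(2)[of p] C that by (auto simp: \<Gamma>_def)
    show "norm (N p - N q) \<le> C * norm (p - q)" if "p \<in> \<Gamma>" "q \<in> \<Gamma>" for p q
    proof -
      have "norm (N p - N q) \<le> L * norm (p - q)" using that r r3 by (intro L(2)) (auto simp: \<Gamma>_def)
      also have "\<dots> \<le> C * norm (p - q)" using C by (intro mult_right_mono) auto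
      finally show ?thesis .
    qed
  qed
  let ?A = "approach_region \<Omega> \<rho> V M R h1 h2"
  have visible: "\<exists>t1>0. \<forall>t p \<zeta>. 0 < t \<and> t < t1 \<and> p \<in> \<Gamma> \<and> \<zeta> \<in> \<Gamma> \<and> cmod (l p \<zeta>) \<le> S * t \<longrightarrow>
      p - t *\<^sub>R N p \<in> ?A \<zeta> \<and> dist (p - t *\<^sub>R N p) \<zeta> < \<epsilon>" if S: "S > 0" and \<epsilon>: "\<epsilon> > 0" for S \<epsilon>
  proof -
    \<comment> \<open>Strict convexity gives
      \<open>norm (p - \<zeta>) \<le> sqrt (S / c) * sqrt t\<close>, and
      \<open>t * C \<le> C * sqrt t\<close> for \<open>t \<le> 1\<close>. Similarly \<open>b\<close>
      collects the two terms of the polarization estimate after reversing \<open>l\<close> by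
      \<open>quasi_symmetric\<close>.\<close>
    define a where "a = sqrt (S / c) + C"
    define b where "b = \<kappa> * S + CR * (S / c)"
    have ab: "a > 0" "b \<ge> 0"
      using S c_pos C r4 \<kappa>_ge_1 by (auto simp: a_def b_def intro!: add_nonneg_pos add_nonneg_nonneg)
    obtain d1 where d1: "d1 > 0" "\<And>x. 0 < x \<Longrightarrow> x < d1 \<Longrightarrow> a * sqrt (B / (k / 2)) < h1 x"
      using aperture_large[OF assms(11)] by metis
    obtain d2 where d2: "d2 > 0" "\<And>x. 0 < x \<Longrightarrow> x < d2 \<Longrightarrow> b * B / (k / 2 * \<mu>) < h2 x"
      using aperture_large[OF assms(12)] by metis
    \<comment> \<open>Bounds the distance \<open>t * norm (N p)\<close> to the boundary: below
      \<open>d1\<close> and \<open>d2\<close> the apertures are large enough, 1 is needed for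
      \<open>Dfun_ge\<close>, and \<open>r3 / 2\<close> keeps the point in \<open>V\<close>.\<close>
    define s where "s = Min {d1, d2, 1, r3 / 2}"
    have s: "s > 0" "s \<le> d1" "s \<le> d2" "s \<le> 1" "s \<le> r3 / 2" using d1 d2 r3 by (auto simp: s_def)
    \<comment> \<open>The last entry ensures \<open>a * sqrt t < \<epsilon>\<close>, so that the
      peak point is also close to \<zeta>.\<close>
    define t1 where "t1 = Min {t0, 1, s / C, (\<epsilon> / a)\<^sup>2}"
    have t1: "t1 > 0" "t1 \<le> t0" "t1 \<le> 1" "t1 \<le> s / C" "t1 \<le> (\<epsilon> / a)\<^sup>2"
      using r2 s C \<epsilon> ab by (auto simp: t1_def)
    have "p - t *\<^sub>R N p \<in> ?A \<zeta> \<and> dist (p - t *\<^sub>R N p) \<zeta> < \<epsilon>"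
      if t: "0 < t" "t < t1" and p: "p \<in> \<Gamma>" and \<zeta>: "\<zeta> \<in> \<Gamma>" and l: "cmod (l p \<zeta>) \<le> S * t" for t p \<zeta>
    proof -
      have pF: "p \<in> frontier \<Omega>" "p \<in> cball e r" and \<zeta>F: "\<zeta> \<in> frontier \<Omega>" "\<zeta> \<in> cball e r"
        using p \<zeta> by (auto simp: \<Gamma>_def)
      have Np: "k / 2 \<le> norm (N p)" "norm (N p) \<le> C" using normN pF norm_N p by auto
      then have "N p \<noteq> 0" using k(1) by auto
      then have z: "p - t *\<^sub>R N p \<in> \<Omega>" "proj \<Omega> (p - t *\<^sub>R N p) = p"
        using r2(3)[of p t] pF t t1 r by auto
      have tN: "t * norm (N p) \<le> t * C" using Np t by (intro mult_left_mono) auto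
      also have "\<dots> < s"
      proof -
        have "t < s / C" using t t1 by linarith
        then show ?thesis by (simp only: pos_less_divide_eq[OF C(1)])
      qed
      finally have ts: "t * norm (N p) < s" .
      have zV: "p - t *\<^sub>R N p \<in> V"
      proof -
        have "dist e (p - t *\<^sub>R N p) \<le> dist e p + t * norm (N p)"
          using dist_triangle[of e "p - t *\<^sub>R N p" p] t by (simp add: dist_norm[of p "p - _"])
        then have "p - t *\<^sub>R N p \<in> cball e r3" using pF r ts s by simp
        then show ?thesis using r3 by blast
      qed
      have sq: "(norm (p - \<zeta>))\<^sup>2 \<le> S / c * t"
        using norm_sq_le_l[of p \<zeta>] p \<zeta> l c_pos by (simp add: field_simps)
      have "norm (p - \<zeta>) \<le> sqrt (S / c) * sqrt t"
        using sq by (metis real_le_rsqrt real_sqrt_mult)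
      moreover have "t \<le> sqrt t" using t t1 by (intro real_le_rsqrt) (simp add: power2_eq_square mult_left_le)
      then have "t * C \<le> C * sqrt t" using C by simp
      moreover have "dist (p - t *\<^sub>R N p) \<zeta> \<le> norm (p - \<zeta>) + t * norm (N p)"
        using norm_triangle_ineq4[of "p - \<zeta>" "t *\<^sub>R N p"] t by (simp add: dist_norm algebra_simps)
      ultimately have dist: "dist (p - t *\<^sub>R N p) \<zeta> \<le> a * sqrt t"
        using tN unfolding a_def distrib_right by linarith
      have "cmod (R p \<zeta>) \<le> cmod (l \<zeta> p) + CR * (norm (p - \<zeta>))\<^sup>2"
        unfolding l_def using pF \<zeta>F zero r by (intro r4(3)) auto
      also have "cmod (l \<zeta> p) \<le> \<kappa> * cmod (l p \<zeta>)" by (rule quasi_symmetric[OF p \<zeta>])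
      also have "\<kappa> * cmod (l p \<zeta>) \<le> \<kappa> * (S * t)" using l \<kappa>_ge_1 by (intro mult_left_mono) auto
      also have "CR * (norm (p - \<zeta>))\<^sup>2 \<le> CR * (S / c * t)" using sq r4 by (intro mult_left_mono) auto
      finally have Rb: "cmod (R p \<zeta>) \<le> b * t" by (simp add: b_def algebra_simps)
      have \<delta>0: "0 < t * norm (N p)" using t \<open>N p \<noteq> 0\<close> by simp
      have "p - t *\<^sub>R N p \<in> ?A \<zeta>"
      proof (rule mem_approach_region[where n="k / 2" and \<delta>="t * norm (N p)" and B=B and \<mu>=\<mu> and a=a and b=b])
        show "a * sqrt (B / (k / 2)) < h1 (t * norm (N p))" using d1(2)[OF \<delta>0] ts s by simp
        show "b * B / (k / 2 * \<mu>) < h2 (t * norm (N p))" using d2(2)[OF \<delta>0] ts s by simp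
        have pr3: "p \<in> cball e r3" "\<zeta> \<in> cball e r3" using pF \<zeta>F r r3 by auto
        show "\<And>k. k \<in> {2..domain_type \<Omega> \<rho>} \<Longrightarrow> Lambda \<rho> (M k) p \<le> B" using B(3) pr3 by blast
        show "\<mu> \<le> Lambda \<rho> (M 2) p" "\<mu> \<le> Lambda \<rho> (M 2) \<zeta>" using B(4) pr3 by auto
      qed (use z zV t Np k(1) ts s type B(1,2) dist Rb ab in \<open>auto simp: N_def\<close>)
      moreover have "a * sqrt t < \<epsilon>"
      proof -
        have "sqrt t < \<epsilon> / a" using t t1 ab \<epsilon> by (intro real_less_lsqrt) auto
        then show ?thesis using ab by (simp add: pos_less_divide_eq mult.commute)
      qed
      ultimately show ?thesis using dist by linarith
    qed
    then show ?thesis using t1(1) by blast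
  qed
  define U where "U = frontier \<Omega> \<inter> ball e r"
  have U\<Gamma>: "U \<subseteq> \<Gamma>" by (auto simp: U_def \<Gamma>_def)
  obtain z0 where z0: "z0 \<in> \<Omega>" using \<Omega>(2) by blast
  have "\<exists>f. holomorphic2_on f \<Omega> \<and> bounded (f ` \<Omega>) \<and> (\<forall>\<zeta>\<in>U. \<not> (\<exists>l. (f \<longlongrightarrow> l) (at \<zeta> within ?A \<zeta>)))"
  proof (rule bounded_holomorphic2_without_limits_disc[OF \<Omega>(1)])
    show "U \<inter> \<Omega> = {}" using U\<Gamma> disjoint by blast
    fix \<epsilon> :: real and K :: "c2 set" assume K: "\<epsilon> > 0" "compact K" "K \<subseteq> \<Omega>"
    have "?A \<zeta> \<subseteq> \<Omega>" for \<zeta> by (auto simp: approach_region_def)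
    from peak_sum[OF z0 this visible K] obtain G Z where
      "holomorphic2_on G \<Omega> \<and> (\<forall>z\<in>\<Omega>. cmod (G z) < 1) \<and>
        (\<forall>z\<in>K. cmod (G z) \<le> \<epsilon>) \<and> finite Z \<and> Z \<subseteq> \<Omega> \<and> (\<forall>z\<in>Z. cmod (G z - 1) \<le> \<epsilon>)"
      "\<forall>\<zeta>\<in>\<Gamma>. \<exists>z\<in>Z \<inter> ?A \<zeta>. dist z \<zeta> < \<epsilon>"
      by auto
    moreover from this(2) have "\<forall>\<zeta>\<in>U. \<exists>z\<in>Z \<inter> ?A \<zeta>. dist z \<zeta> < \<epsilon>"
      using subsetD[OF U\<Gamma>] by simp
    ultimately show "\<exists>G Z. holomorphic2_on G \<Omega> \<and> (\<forall>z\<in>\<Omega>. cmod (G z) < 1) \<and>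
        (\<forall>z\<in>K. cmod (G z) \<le> \<epsilon>) \<and> finite Z \<and> Z \<subseteq> \<Omega> \<and> (\<forall>z\<in>Z. cmod (G z - 1) \<le> \<epsilon>) \<and>
        (\<forall>\<zeta>\<in>U. \<exists>z\<in>Z \<inter> ?A \<zeta>. dist z \<zeta> < \<epsilon>)"
      by (intro exI[of _ G] exI[of _ Z]) simp
  qed
  moreover have "openin (top_of_set (frontier \<Omega>)) U" unfolding U_def by (rule openin_open_Int) simp
  moreover have "(1, 0) \<in> U" using e(1) r(1) by (simp add: U_def e_def)
  moreover have "U \<subseteq> V" using r r3 by (auto simp: U_def)
  ultimately show ?thesis by blast
qed

end
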